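(* For every integer $s\geq 1$ and every finite class $\mathcal{C}$ of biconnected graphs, the problem \textsc{Max $\mathcal{C}$-Block Graph} can be solved in polynomial time on $sP_3$-free graphs.
   Context: A connected graph $G$ on at least two vertices is biconnected if $G-u$ is connected for every vertex $u$. A block of a graph is an inclusion-wise maximal biconnected subgraph. For a set $\mathcal{C}$ of biconnected graphs, a graph $G$ is a $\mathcal{C}$-block graph if every block of $G$ is isomorphic to some graph in $\mathcal{C}$. The class $\mathcal{C}$ is fixed (not part of the input). \textsc{Max $\mathcal{C}$-Block Graph}: given a graph $G=(V,E)$ with vertex weights $\mathfrak{w}:V\to\mathbb{Q}^+$, find a set $X\subseteq V$ of maximum total weight such that the induced subgraph $G[X]$ is a $\mathcal{C}$-block graph. $P_r$ denotes the path on $r$ vertices, $sH$ the disjoint union of $s$ copies of $H$, and a graph is $H$-free if it has no induced subgraph isomorphic to $H$. *)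

theory Defs
  imports
    "Graph_Theory.Pair_Digraph"
    "Graph_Theory.Digraph_Isomorphism"
    "HOL-Computational_Algebra.Polynomial"
begin

section \<open>Polynomial-time computation\<close>

text \<open>
  The machine model is the WHILE language over binary trees (N. D. Jones, Computability and
  Complexity from a Programming Perspective), with one change: an operation is charged the
  number of nodes of the tree it produces, and not 1. Hence a tree held in a variable at any
  time is either the input or has at most as many nodes as the time spent so far, so a Turing
  machine can simulate a run with polynomial overhead, handling the trees as strings. Conversely
  a Turing machine is simulated, again with polynomial overhead, by keeping the two halves of
  each tape as lists. So polynomial time in this model is polynomial time in the usual sense.

  The size of a tree (function size) is its number of Node constructors.
\<close>

datatype btree = Leaf | Node btree btree

type_synonym store = "nat \<Rightarrow> btree"

datatype expr =
    Var nat
  | LeafE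
  | NodeE expr expr
  | LeftE expr
  | RightE expr
  | EqualE expr expr

primrec left :: "btree \<Rightarrow> btree" where
  "left Leaf = Leaf"
| "left (Node l r) = l"

primrec right :: "btree \<Rightarrow> btree" where
  "right Leaf = Leaf"
| "right (Node l r) = r"

definition enc_bool :: "bool \<Rightarrow> btree" where
  "enc_bool b = (if b then Node Leaf Leaf else Leaf)"

primrec expr_val :: "expr \<Rightarrow> store \<Rightarrow> btree" where
  "expr_val (Var x) \<sigma> = \<sigma> x"
| "expr_val LeafE \<sigma> = Leaf"
| "expr_val (NodeE e f) \<sigma> = Node (expr_val e \<sigma>) (expr_val f \<sigma>)"
| "expr_val (LeftE e) \<sigma> = left (expr_val e \<sigma>)"
| "expr_val (RightE e) \<sigma> = right (expr_val e \<sigma>)"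
| "expr_val (EqualE e f) \<sigma> = enc_bool (expr_val e \<sigma> = expr_val f \<sigma>)"

primrec expr_cost :: "expr \<Rightarrow> store \<Rightarrow> nat" where
  "expr_cost (Var x) \<sigma> = 1 + size (\<sigma> x)"
| "expr_cost LeafE \<sigma> = 1"
| "expr_cost (NodeE e f) \<sigma> =
     expr_cost e \<sigma> + expr_cost f \<sigma> + 1 + size (expr_val (NodeE e f) \<sigma>)"
| "expr_cost (LeftE e) \<sigma> = expr_cost e \<sigma> + 1 + size (expr_val (LeftE e) \<sigma>)"
| "expr_cost (RightE e) \<sigma> = expr_cost e \<sigma> + 1 + size (expr_val (RightE e) \<sigma>)"
| "expr_cost (EqualE e f) \<sigma> =
     expr_cost e \<sigma> + expr_cost f \<sigma> + 1 + size (expr_val (EqualE e f) \<sigma>)"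

datatype com =
    Skip
  | Assign nat expr
  | Seq com com
  | Cond expr com com
  | While expr com

text \<open>
  exec c \<sigma> t \<tau>: started in store \<sigma>, the program c halts after time t in store \<tau>.
  A test counts as false exactly if its value is Leaf.
\<close>

inductive exec :: "com \<Rightarrow> store \<Rightarrow> nat \<Rightarrow> store \<Rightarrow> bool" where
  exec_Skip: "exec Skip \<sigma> 1 \<sigma>"
| exec_Assign: "exec (Assign x e) \<sigma> (1 + expr_cost e \<sigma>) (\<sigma>(x := expr_val e \<sigma>))"
| exec_Seq: "exec c \<sigma> t \<rho> \<Longrightarrow> exec d \<rho> u \<tau> \<Longrightarrow> exec (Seq c d) \<sigma> (t + u) \<tau>"
| exec_Cond_true: "expr_val e \<sigma> \<noteq> Leaf \<Longrightarrow> exec c \<sigma> t \<tau> \<Longrightarrow>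
    exec (Cond e c d) \<sigma> (1 + expr_cost e \<sigma> + t) \<tau>"
| exec_Cond_false: "expr_val e \<sigma> = Leaf \<Longrightarrow> exec d \<sigma> t \<tau> \<Longrightarrow>
    exec (Cond e c d) \<sigma> (1 + expr_cost e \<sigma> + t) \<tau>"
| exec_While_true: "expr_val e \<sigma> \<noteq> Leaf \<Longrightarrow> exec c \<sigma> t \<rho> \<Longrightarrow> exec (While e c) \<rho> u \<tau> \<Longrightarrow>
    exec (While e c) \<sigma> (1 + expr_cost e \<sigma> + t + u) \<tau>"
| exec_While_false: "expr_val e \<sigma> = Leaf \<Longrightarrow>
    exec (While e c) \<sigma> (1 + expr_cost e \<sigma>) \<sigma>"

inductive_cases exec_SkipE: "exec Skip \<sigma> t \<tau>"
inductive_cases exec_AssignE: "exec (Assign x e) \<sigma> t \<tau>"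
inductive_cases exec_SeqE: "exec (Seq c d) \<sigma> t \<tau>"
inductive_cases exec_CondE: "exec (Cond e c d) \<sigma> t \<tau>"
inductive_cases exec_WhileE: "exec (While e c) \<sigma> t \<tau>"

lemma exec_deterministic:
  "exec c \<sigma> t \<tau> \<Longrightarrow> exec c \<sigma> t' \<tau>' \<Longrightarrow> t' = t \<and> \<tau>' = \<tau>"
proof (induction arbitrary: t' \<tau>' rule: exec.induct)
  case (exec_Skip \<sigma>)
  from exec_Skip.prems show ?case by (rule exec_SkipE) simp
next
  case (exec_Assign x e \<sigma>)
  from exec_Assign.prems show ?case by (rule exec_AssignE) simp
next
  case (exec_Seq c \<sigma> t \<rho> d u \<tau>)
  from exec_Seq.prems obtain t1 \<rho>' u1 where
    "exec c \<sigma> t1 \<rho>'" "exec d \<rho>' u1 \<tau>'" "t' = t1 + u1"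
    by (rule exec_SeqE)
  with exec_Seq.IH(1)[of t1 \<rho>'] exec_Seq.IH(2)[of u1 \<tau>'] show ?case by simp
next
  case (exec_Cond_true e \<sigma> c t \<tau> d)
  from exec_Cond_true.prems obtain t1 where
    "exec c \<sigma> t1 \<tau>'" "t' = 1 + expr_cost e \<sigma> + t1"
    by (rule exec_CondE) (use exec_Cond_true.hyps in simp_all)
  with exec_Cond_true.IH[of t1 \<tau>'] show ?case by simp
next
  case (exec_Cond_false e \<sigma> d t \<tau> c)
  from exec_Cond_false.prems obtain t1 where
    "exec d \<sigma> t1 \<tau>'" "t' = 1 + expr_cost e \<sigma> + t1"
    by (rule exec_CondE) (use exec_Cond_false.hyps in simp_all)
  with exec_Cond_false.IH[of t1 \<tau>'] show ?case by simp
next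
  case (exec_While_true e \<sigma> c t \<rho> u \<tau>)
  from exec_While_true.prems obtain t1 \<rho>' u1 where
    "exec c \<sigma> t1 \<rho>'" "exec (While e c) \<rho>' u1 \<tau>'" "t' = 1 + expr_cost e \<sigma> + t1 + u1"
    by (rule exec_WhileE) (use exec_While_true.hyps in simp_all)
  with exec_While_true.IH(1)[of t1 \<rho>'] exec_While_true.IH(2)[of u1 \<tau>'] show ?case by simp
next
  case (exec_While_false e \<sigma> c)
  from exec_While_false.prems show ?case
    by (rule exec_WhileE) (use exec_While_false.hyps in simp_all)
qed

text \<open>
  A computational problem with instances I, an encoding of instances, and a relation between
  instances and admissible (encoded) answers. Input and output are passed in variable 0; all
  other variables start as Leaf. Instances outside I are not constrained at all, so I also
  expresses the restriction of a problem to a class of inputs.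
\<close>

definition poly_time_solvable ::
  "'i set \<Rightarrow> ('i \<Rightarrow> btree) \<Rightarrow> ('i \<Rightarrow> btree \<Rightarrow> bool) \<Rightarrow> bool" where
  "poly_time_solvable I enc answer \<longleftrightarrow>
     (\<exists>c. \<exists>p :: nat poly. \<forall>x\<in>I. \<exists>t \<tau>.
        exec c ((\<lambda>_. Leaf)(0 := enc x)) t \<tau> \<and>
        t \<le> poly p (size (enc x)) \<and>
        answer x (\<tau> 0))"


section \<open>Encodings\<close>

definition enc_list :: "btree list \<Rightarrow> btree" where
  "enc_list ts = foldr Node ts Leaf"

text \<open>Binary, least significant bit first.\<close>

fun enc_nat :: "nat \<Rightarrow> btree" where
  "enc_nat n = (if n = 0 then Leaf else Node (enc_bool (odd n)) (enc_nat (n div 2)))"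

declare enc_nat.simps [simp del]

text \<open>Used for positive rationals only: numerator and denominator in lowest terms.\<close>

definition enc_rat :: "rat \<Rightarrow> btree" where
  "enc_rat q = (case quotient_of q of (a, b) \<Rightarrow> Node (enc_nat (nat a)) (enc_nat (nat b)))"

text \<open>
  A graph on the vertices 0, ..., n - 1 is given as the list of its vertices, each with its
  weight and its row of the adjacency matrix.
\<close>

definition enc_weighted_graph :: "nat pair_pre_digraph \<times> (nat \<Rightarrow> rat) \<Rightarrow> btree" where
  "enc_weighted_graph = (\<lambda>(G, w). let n = card (pverts G) in
     enc_list (map (\<lambda>u. Node (enc_rat (w u))
                          (enc_list (map (\<lambda>v. enc_bool ((u, v) \<in> parcs G)) [0..<n])))
                 [0..<n]))"

definition enc_vertices :: "nat list \<Rightarrow> btree" where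
  "enc_vertices vs = enc_list (map enc_nat vs)"


section \<open>Graphs\<close>

text \<open>
  Finite simple graphs are the symmetric loop-free digraphs without parallel arcs of the locales
  graph and pair_graph. A connected graph is nonempty (Digraph_Component.connected).
\<close>

definition biconnected :: "('a, 'b) pre_digraph \<Rightarrow> bool" where
  "biconnected G \<longleftrightarrow>
     graph G \<and> 2 \<le> card (verts G) \<and> Digraph_Component.connected G \<and>
     (\<forall>u\<in>verts G. Digraph_Component.connected (pre_digraph.del_vert G u))"

text \<open>
  Here max_subgraph is maximality with respect to the subgraph relation; H need not be induced
  a priori, and is itself a (symmetric) graph since it is biconnected.
\<close>

definition block :: "('a, 'b) pre_digraph \<Rightarrow> ('a, 'b) pre_digraph \<Rightarrow> bool" where
  "block G H \<longleftrightarrow> pre_digraph.max_subgraph G biconnected H"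

definition block_graph :: "('c, 'd) pre_digraph set \<Rightarrow> ('a, 'b) pre_digraph \<Rightarrow> bool" where
  "block_graph \<C> G \<longleftrightarrow> (\<forall>H. block G H \<longrightarrow> (\<exists>K\<in>\<C>. digraph_iso H K))"

definition path_graph :: "nat \<Rightarrow> nat pair_pre_digraph" where
  "path_graph r = \<lparr> pverts = {..<r},
     parcs = {(i, j). i < r \<and> j < r \<and> (j = Suc i \<or> i = Suc j)} \<rparr>"

definition disjoint_copies :: "nat \<Rightarrow> 'a pair_pre_digraph \<Rightarrow> (nat \<times> 'a) pair_pre_digraph" where
  "disjoint_copies s H = \<lparr> pverts = {..<s} \<times> pverts H,
     parcs = {((i, u), (i, v)) | i u v. i < s \<and> (u, v) \<in> parcs H} \<rparr>"

definition free_of :: "('c, 'd) pre_digraph \<Rightarrow> ('a, 'b) pre_digraph \<Rightarrow> bool" where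
  "free_of H G \<longleftrightarrow> \<not> (\<exists>K. induced_subgraph K G \<and> digraph_iso K H)"


section \<open>Max C-Block Graph\<close>

definition weighted_graphs :: "(nat pair_pre_digraph \<times> (nat \<Rightarrow> rat)) set" where
  "weighted_graphs =
     {(G, w). pair_graph G \<and> (\<exists>n. pverts G = {..<n}) \<and> (\<forall>v\<in>pverts G. 0 < w v)}"

definition feasible ::
  "('c, 'd) pre_digraph set \<Rightarrow> 'a pair_pre_digraph \<Rightarrow> 'a set \<Rightarrow> bool" where
  "feasible \<C> G X \<longleftrightarrow> X \<subseteq> pverts G \<and> block_graph \<C> (with_proj G \<restriction> X)"

definition optimal ::
  "('c, 'd) pre_digraph set \<Rightarrow> 'a pair_pre_digraph \<times> ('a \<Rightarrow> rat) \<Rightarrow> 'a set \<Rightarrow> bool" where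
  "optimal \<C> = (\<lambda>(G, w) X.
     feasible \<C> G X \<and> (\<forall>Y. feasible \<C> G Y \<longrightarrow> (\<Sum>v\<in>Y. w v) \<le> (\<Sum>v\<in>X. w v)))"

text \<open>
  Max C-Block Graph restricted to the inputs whose graph satisfies P. The answer is any listing
  without repetition of an optimal set.
\<close>

definition max_block_graph_poly_time_on ::
  "(nat pair_pre_digraph \<Rightarrow> bool) \<Rightarrow> ('c, 'd) pre_digraph set \<Rightarrow> bool" where
  "max_block_graph_poly_time_on P \<C> \<longleftrightarrow>
     poly_time_solvable {(G, w) \<in> weighted_graphs. P G} enc_weighted_graph
       (\<lambda>x t. \<exists>vs. t = enc_vertices vs \<and> distinct vs \<and> optimal \<C> x (set vs))"

end

theory Submission
  imports Defs "HOL-Library.Ramsey"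
begin

text \<open>
  Let d bound the sizes of the graphs in the class. In a solution F (an sP3-free graph whose
  biconnected subgraphs have at most d vertices) a vertex v of large degree is adjacent to many
  components of F - v. Given many such vertices, Ramsey's theorem yields s pairwise non-adjacent
  ones, and each of them is the middle of a P3 inside two private components, which gives an
  induced sP3. So there are boundedly many vertices of large degree. What remains has bounded
  degree, and the closed neighbourhood of a maximal family of pairwise anticomplete P3s meets all
  its P3s. After adding boundedly many further components, F consists of a set W of bounded size
  and of cliques of bounded size, each attached to at most one vertex of W. The blocks of F are
  then those of F[W] together with those of each clique with its attachment.

  The algorithm guesses W. The admissible cliques form a conflict graph (two cliques conflict if
  they meet or are adjacent), which again contains no sP3, and the task is to find an independent
  set of maximum weight in it. All independent sets are covered by polynomially many P3-free
  sets, in each of which the best independent set consists of a heaviest clique per component.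
  Whether a set of bounded size induces a block graph of the class is read off a finite table of
  adjacency patterns.
\<close>


text \<open>The obstacle is that a solution can be large and its blocks can share cut vertices, so
  neither a bounded guess nor a test of bounded subsets describes it directly. The core is shaped to
  remove this: a clique together with its only neighbour in W meets the rest of the solution in at
  most one vertex, so separation at one vertex makes its blocks and its weight independent of the
  other cliques. The only global condition left is that the chosen cliques are pairwise disjoint and
  non-adjacent. A component attached to two vertices of W would break this and has to move into W;
  there are few of those, because the components attached to both w and w' put as many neighbours of
  w into one biconnected set. The bound on W and the depth of the cluster enumeration depend on s
  and the class only, so all lists of guesses have polynomial length. The bound and the table of
  patterns are fixed before any input; they enter the program as constants, and no block is computed
  at run time.\<close>

section \<open>Encodable types\<close>

lemma enc_list_simps [simp]:
  "enc_list [] = Leaf" "enc_list (t # ts) = Node t (enc_list ts)"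
  by (simp_all add: enc_list_def)

lemma enc_list_eq_iff [simp]: "enc_list ts = enc_list us \<longleftrightarrow> ts = us"
proof (induction ts arbitrary: us)
  case Nil
  then show ?case by (cases us) auto
next
  case (Cons t ts)
  then show ?case by (cases us) auto
qed

lemma enc_bool_eq_iff [simp]: "enc_bool a = enc_bool b \<longleftrightarrow> a = b"
  by (auto simp: enc_bool_def)

lemma enc_nat_eq_iff [simp]: "enc_nat m = enc_nat n \<longleftrightarrow> m = n"
proof (induction m arbitrary: n rule: less_induct)
  case (less m)
  show ?case
  proof (cases "m = 0 \<or> n = 0")
    case True
    then show ?thesis by (subst (1 2) enc_nat.simps) auto
  next
    case False
    have "enc_nat m = enc_nat n \<longleftrightarrow> odd m = odd n \<and> enc_nat (m div 2) = enc_nat (n div 2)"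
      using False by (subst (1 2) enc_nat.simps) auto
    also have "\<dots> \<longleftrightarrow> odd m = odd n \<and> m div 2 = n div 2"
      using less.IH[of "m div 2"] False by simp
    also have "\<dots> \<longleftrightarrow> m = n"
      by (metis odd_two_times_div_two_succ even_two_times_div_two)
    finally show ?thesis .
  qed
qed

text \<open>Injectivity is what lets the machine compare values: \<open>EqualE\<close> compares
  trees, and by \<open>enc_eq_iff\<close> equal trees mean equal values.\<close>

class encodable =
  fixes enc :: "'a \<Rightarrow> btree"
  assumes enc_inject: "enc x = enc y \<Longrightarrow> x = y"

lemma enc_eq_iff [simp]: "enc x = enc y \<longleftrightarrow> x = y"
  using enc_inject by blast

instantiation bool :: encodable
begin
definition enc_of_bool: "enc b = enc_bool b"
instance by standard (simp add: enc_of_bool)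
end

instantiation nat :: encodable
begin
definition enc_of_nat: "enc n = enc_nat n"
instance by standard (simp add: enc_of_nat)
end

instantiation list :: (encodable) encodable
begin
definition enc_of_list: "enc xs = enc_list (map enc xs)"
instance by standard (auto simp: enc_of_list inj_def dest: map_inj_on)
end

instantiation prod :: (encodable, encodable) encodable
begin
definition enc_of_prod: "enc p = Node (enc (fst p)) (enc (snd p))"
instance by standard (simp add: enc_of_prod prod_eq_iff)
end

lemma enc_Nil [simp]: "enc [] = Leaf"
  and enc_Cons [simp]: "enc (x # xs) = Node (enc x) (enc xs)"
  by (simp_all add: enc_of_list)

lemma enc_Pair [simp]: "enc (x, y) = Node (enc x) (enc y)"
  by (simp add: enc_of_prod)

lemma enc_True [simp]: "enc True = Node Leaf Leaf"
  and enc_False [simp]: "enc False = Leaf"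
  by (simp_all add: enc_of_bool enc_bool_def)

abbreviation enc_size :: "'a::encodable \<Rightarrow> nat" where "enc_size x \<equiv> size (enc x)"

lemma enc_size_bool: "enc_size (b :: bool) \<le> 1"
  by (cases b) auto

lemma enc_size_append [simp]: "enc_size (xs @ ys) = enc_size xs + enc_size ys"
  by (induction xs) auto

lemma length_le_enc_size: "length xs \<le> enc_size xs"
  by (induction xs) auto

lemma enc_size_snd: "enc_size (snd p) < enc_size p"
  by (simp add: enc_of_prod)

section \<open>Closure of polynomial bounds under arithmetic\<close>

section \<open>Polynomial bounds\<close>

text \<open>The base is \<open>n + 2\<close> so that it is at least 2 even at \<open>n = 0\<close>:
  constants, sums and factors of 2 are absorbed by a larger exponent.\<close>

definition poly_bounded :: "(nat \<Rightarrow> nat) \<Rightarrow> bool" where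
  "poly_bounded g \<longleftrightarrow> (\<exists>k. \<forall>n. g n \<le> (n + 2) ^ k)"

named_theorems pb_intros

lemma poly_bounded_power [pb_intros]: "poly_bounded (\<lambda>n. (n + 2) ^ k)"
  by (auto simp: poly_bounded_def)

lemma poly_bounded_mono: "poly_bounded g \<Longrightarrow> (\<And>n. f n \<le> g n) \<Longrightarrow> poly_bounded f"
  unfolding poly_bounded_def by (meson order_trans)

lemma poly_bounded_const [pb_intros]: "poly_bounded (\<lambda>_. c)"
proof -
  have "c \<le> (n + 2) ^ c" for n :: nat
  proof -
    have "c \<le> 2 ^ c" by (simp add: less_imp_le)
    also have "\<dots> \<le> (n + 2) ^ c" by (simp add: power_mono)
    finally show ?thesis .
  qed
  then show ?thesis unfolding poly_bounded_def by blast
qed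

lemma poly_bounded_id [pb_intros]: "poly_bounded (\<lambda>n. n)"
  by (rule poly_bounded_mono[OF poly_bounded_power[of 1]]) simp

lemma poly_bounded_add [pb_intros]:
  assumes "poly_bounded f" "poly_bounded g"
  shows "poly_bounded (\<lambda>n. f n + g n)"
proof -
  obtain a b where ab: "\<And>n. f n \<le> (n + 2) ^ a" "\<And>n. g n \<le> (n + 2) ^ b"
    using assms unfolding poly_bounded_def by blast
  have "f n + g n \<le> (n + 2) ^ (a + b + 1)" for n
  proof -
    have "f n \<le> (n + 2) ^ (a + b)" "g n \<le> (n + 2) ^ (a + b)"
      using ab[of n] power_increasing[of a "a + b" "n + 2"] power_increasing[of b "a + b" "n + 2"]
      by linarith+
    then have "f n + g n \<le> 2 * (n + 2) ^ (a + b)" by simp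
    also have "\<dots> \<le> (n + 2) * (n + 2) ^ (a + b)" by (intro mult_right_mono) auto
    finally show ?thesis by simp
  qed
  then show ?thesis unfolding poly_bounded_def by blast
qed

lemma poly_bounded_mult [pb_intros]:
  assumes "poly_bounded f" "poly_bounded g"
  shows "poly_bounded (\<lambda>n. f n * g n)"
proof -
  obtain a b where ab: "\<And>n. f n \<le> (n + 2) ^ a" "\<And>n. g n \<le> (n + 2) ^ b"
    using assms unfolding poly_bounded_def by blast
  have "f n * g n \<le> (n + 2) ^ (a + b)" for n
    using mult_mono[OF ab(1)[of n] ab(2)[of n]] by (simp add: power_add)
  then show ?thesis unfolding poly_bounded_def by blast
qed

lemma poly_bounded_power' [pb_intros]: "poly_bounded g \<Longrightarrow> poly_bounded (\<lambda>n. g n ^ k)"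
  by (induction k) (auto intro: pb_intros)

lemma poly_bounded_Suc [pb_intros]: "poly_bounded g \<Longrightarrow> poly_bounded (\<lambda>n. Suc (g n))"
  using poly_bounded_add[OF _ poly_bounded_const[of 1]] by simp

section \<open>Closure of polynomial-time functions under composition, pairing, branching and
  loops\<close>

section \<open>Polynomial-time functions\<close>

text \<open>
  The program may start with arbitrary contents in the variables other than 0, and it leaves the
  variables from N on untouched. This is what makes programs composable.
\<close>

definition runs :: "com \<Rightarrow> nat \<Rightarrow> nat \<Rightarrow> ('a::encodable \<Rightarrow> 'b::encodable) \<Rightarrow> bool" where
  "runs c N k f \<longleftrightarrow> (\<forall>\<sigma> x. \<sigma> 0 = enc x \<longrightarrow>
     enc_size (f x) \<le> (enc_size x + 2) ^ k \<and>
     (\<exists>t \<tau>. exec c \<sigma> t \<tau> \<and> \<tau> 0 = enc (f x) \<and> (\<forall>i\<ge>N. \<tau> i = \<sigma> i) \<and> t \<le> (enc_size x + 2) ^ k))"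

definition ptime :: "('a::encodable \<Rightarrow> 'b::encodable) \<Rightarrow> bool" where
  "ptime f \<longleftrightarrow> (\<exists>c N k. runs c N k f)"

named_theorems ptime_intros

lemma ptime_I:
  assumes "poly_bounded q" "poly_bounded q'"
    and "\<And>x. enc_size (f x) \<le> q' (enc_size x)"
    and "\<And>\<sigma> x. \<sigma> 0 = enc x \<Longrightarrow>
      \<exists>t \<tau>. exec c \<sigma> t \<tau> \<and> \<tau> 0 = enc (f x) \<and> (\<forall>i\<ge>N. \<tau> i = \<sigma> i) \<and> t \<le> q (enc_size x)"
  shows "ptime f"
proof -
  obtain k where k: "\<And>n. q n + q' n \<le> (n + 2) ^ k"
    using poly_bounded_add[OF assms(1,2)] unfolding poly_bounded_def by blast
  have "runs c N k f"
    unfolding runs_def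
  proof (intro allI impI conjI)
    fix \<sigma> :: store and x :: 'a
    assume "\<sigma> 0 = enc x"
    then obtain t \<tau> where "exec c \<sigma> t \<tau>" "\<tau> 0 = enc (f x)" "\<forall>i\<ge>N. \<tau> i = \<sigma> i" "t \<le> q (enc_size x)"
      using assms(4) by blast
    moreover have "t \<le> (enc_size x + 2) ^ k" using \<open>t \<le> q (enc_size x)\<close> k[of "enc_size x"] by linarith
    ultimately show "\<exists>t \<tau>. exec c \<sigma> t \<tau> \<and> \<tau> 0 = enc (f x) \<and> (\<forall>i\<ge>N. \<tau> i = \<sigma> i) \<and> t \<le> (enc_size x + 2) ^ k"
      by blast
    show "enc_size (f x) \<le> (enc_size x + 2) ^ k" using assms(3)[of x] k[of "enc_size x"] by linarith
  qed
  then show ?thesis unfolding ptime_def by blast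
qed

lemma runsE:
  assumes "runs c N k f" "\<sigma> 0 = enc x"
  obtains t \<tau> where "exec c \<sigma> t \<tau>" "\<tau> 0 = enc (f x)" "\<And>i. i \<ge> N \<Longrightarrow> \<tau> i = \<sigma> i"
    "t \<le> (enc_size x + 2) ^ k"
  using assms unfolding runs_def by blast

lemma runs_enc_size: "runs c N k f \<Longrightarrow> enc_size (f x) \<le> (enc_size x + 2) ^ k"
  unfolding runs_def by (erule allE[of _ "\<lambda>_. enc x"]) auto

lemma ptime_enc_size:
  assumes "ptime f"
  obtains k where "\<And>x. enc_size (f x) \<le> (enc_size x + 2) ^ k"
  using assms runs_enc_size unfolding ptime_def by blast

text \<open>A program sees only encodings, so functions with equal encodings are interchangeable.
  This changes types for free, for instance from a pair to a list cell or from a list of bits to a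
  number.\<close>

lemma ptime_cast: "ptime f \<Longrightarrow> (\<And>x. enc (g x) = enc (f x)) \<Longrightarrow> ptime g"
  unfolding ptime_def runs_def by simp

lemma ptime_expr:
  assumes "poly_bounded q"
    and "\<And>\<sigma> x. \<sigma> 0 = enc x \<Longrightarrow> expr_val e \<sigma> = enc (f x) \<and> expr_cost e \<sigma> \<le> q (enc_size x)"
    and "poly_bounded q'" "\<And>x. enc_size (f x) \<le> q' (enc_size x)"
  shows "ptime f"
proof (rule ptime_I[where c = "Assign 0 e" and N = 1, OF _ assms(3,4)])
  show "poly_bounded (\<lambda>n. 1 + q n)" by (intro pb_intros assms)
next
  fix \<sigma> :: store and x :: 'a
  assume "\<sigma> 0 = enc x"
  with assms(2) have "expr_val e \<sigma> = enc (f x)" "expr_cost e \<sigma> \<le> q (enc_size x)" by auto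
  with exec_Assign[of 0 e \<sigma>] show "\<exists>t \<tau>. exec (Assign 0 e) \<sigma> t \<tau> \<and> \<tau> 0 = enc (f x) \<and>
      (\<forall>i\<ge>1. \<tau> i = \<sigma> i) \<and> t \<le> 1 + q (enc_size x)"
    by (intro exI[of _ "1 + expr_cost e \<sigma>"] exI[of _ "\<sigma>(0 := expr_val e \<sigma>)"]) auto
qed

lemma ptime_enc_eq:
  assumes "\<And>x. enc (f x) = enc x"
  shows "ptime f"
  by (rule ptime_expr[where e = "Var 0" and q = "\<lambda>n. 1 + n" and q' = "\<lambda>n. n"])
    (auto intro!: pb_intros simp: assms)

lemma ptime_id [ptime_intros]: "ptime (\<lambda>x. x)"
  by (rule ptime_enc_eq) simp

primrec const_expr :: "btree \<Rightarrow> expr" where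
  "const_expr Leaf = LeafE"
| "const_expr (Node l r) = NodeE (const_expr l) (const_expr r)"

lemma const_expr: "expr_val (const_expr b) \<sigma> = b"
  "expr_cost (const_expr b) \<sigma> = expr_cost (const_expr b) (\<lambda>_. Leaf)"
proof -
  show 1: "expr_val (const_expr b) \<sigma> = b" for b \<sigma> by (induction b) auto
  show "expr_cost (const_expr b) \<sigma> = expr_cost (const_expr b) (\<lambda>_. Leaf)"
    by (induction b) (auto simp: 1)
qed

lemma ptime_const [ptime_intros]: "ptime (\<lambda>_. c)"
proof (rule ptime_expr[where e = "const_expr (enc c)"])
  show "poly_bounded (\<lambda>_. expr_cost (const_expr (enc c)) (\<lambda>_. Leaf))" "poly_bounded (\<lambda>_. enc_size c)"
    by (rule pb_intros)+
next
  fix \<sigma> :: store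
  show "expr_val (const_expr (enc c)) \<sigma> = enc c \<and>
      expr_cost (const_expr (enc c)) \<sigma> \<le> expr_cost (const_expr (enc c)) (\<lambda>_. Leaf)"
    using const_expr[of "enc c" \<sigma>] by simp
qed simp

lemma ptime_comp:
  assumes "ptime f" "ptime g"
  shows "ptime (\<lambda>x. g (f x))"
proof -
  obtain c N k where f: "runs c N k f" using assms(1) unfolding ptime_def by blast
  obtain d M j where g: "runs d M j g" using assms(2) unfolding ptime_def by blast
  define q where "q n = (n + 2) ^ k + ((n + 2) ^ k + 2) ^ j" for n :: nat
  have pb: "poly_bounded q" unfolding q_def by (intro pb_intros)
  have *: "(enc_size (f x) + 2) ^ j \<le> ((enc_size x + 2) ^ k + 2) ^ j" for x
    using runs_enc_size[OF f, of x] by (intro power_mono) auto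
  show ?thesis
  proof (rule ptime_I[where c = "Seq c d" and N = "max N M", OF pb pb])
    show "enc_size (g (f x)) \<le> q (enc_size x)" for x
      using runs_enc_size[OF g, of "f x"] *[of x] unfolding q_def by linarith
  next
    fix \<sigma> :: store and x :: 'a
    assume "\<sigma> 0 = enc x"
    then obtain t \<rho> where 1: "exec c \<sigma> t \<rho>" "\<rho> 0 = enc (f x)" "\<And>i. i \<ge> N \<Longrightarrow> \<rho> i = \<sigma> i"
      "t \<le> (enc_size x + 2) ^ k" by (rule runsE[OF f]) blast
    from 1(2) obtain u \<tau> where 2: "exec d \<rho> u \<tau>" "\<tau> 0 = enc (g (f x))" "\<And>i. i \<ge> M \<Longrightarrow> \<tau> i = \<rho> i"
      "u \<le> (enc_size (f x) + 2) ^ j" by (rule runsE[OF g]) blast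
    have "t + u \<le> q (enc_size x)" using 1(4) 2(4) *[of x] unfolding q_def by linarith
    then show "\<exists>t \<tau>. exec (Seq c d) \<sigma> t \<tau> \<and> \<tau> 0 = enc (g (f x)) \<and>
        (\<forall>i\<ge>max N M. \<tau> i = \<sigma> i) \<and> t \<le> q (enc_size x)"
      using exec_Seq[OF 1(1) 2(1)] 1(3) 2(2,3) by (intro exI[of _ "t + u"] exI[of _ \<tau>]) auto
  qed
qed

lemma ptime_fst [ptime_intros]: "ptime f \<Longrightarrow> ptime (\<lambda>x. fst (f x))"
  by (rule ptime_comp[where g = fst], assumption,
      rule ptime_expr[where e = "LeftE (Var 0)" and q = "\<lambda>n. 2 + 2 * n" and q' = "\<lambda>n. n"])
    (auto intro!: pb_intros simp: enc_of_prod)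

lemma ptime_snd [ptime_intros]: "ptime f \<Longrightarrow> ptime (\<lambda>x. snd (f x))"
  by (rule ptime_comp[where g = snd], assumption,
      rule ptime_expr[where e = "RightE (Var 0)" and q = "\<lambda>n. 2 + 2 * n" and q' = "\<lambda>n. n"])
    (auto intro!: pb_intros simp: enc_of_prod)

lemma exec_Assign': "\<tau> = \<sigma>(x := expr_val e \<sigma>) \<Longrightarrow> t = 1 + expr_cost e \<sigma> \<Longrightarrow> exec (Assign x e) \<sigma> t \<tau>"
  using exec_Assign by simp

text \<open>Both programs communicate through variable 0 and may destroy the variables below
  \<open>N\<close> and \<open>M\<close>. The input is therefore kept in \<open>L\<close> and the
  first result in \<open>L + 1\<close>, out of the reach of both.\<close>

lemma ptime_Pair [ptime_intros]:
  assumes "ptime f" "ptime g"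
  shows "ptime (\<lambda>x. (f x, g x))"
proof -
  obtain c N k where f: "runs c N k f" using assms(1) unfolding ptime_def by blast
  obtain d M j where g: "runs d M j g" using assms(2) unfolding ptime_def by blast
  define L where "L = max (max N M) 1"
  have L: "L \<ge> N" "L \<ge> M" "L \<ge> 1" unfolding L_def by auto
  define q where "q n = 5 * (n + 2) ^ k + 5 * (n + 2) ^ j + 2 * n + 12" for n :: nat
  have pb: "poly_bounded q" unfolding q_def by (intro pb_intros)
  let ?c = "Seq (Assign L (Var 0)) (Seq c (Seq (Assign (L + 1) (Var 0)) (Seq (Assign 0 (Var L))
    (Seq d (Assign 0 (NodeE (Var (L + 1)) (Var 0)))))))"
  show ?thesis
  proof (rule ptime_I[where c = ?c and N = "L + 2", OF pb pb])
    show "enc_size (f x, g x) \<le> q (enc_size x)" for x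
      using runs_enc_size[OF f, of x] runs_enc_size[OF g, of x] unfolding q_def by simp
  next
    fix \<sigma> :: store and x :: 'a
    assume \<sigma>: "\<sigma> 0 = enc x"
    define \<sigma>1 where "\<sigma>1 = \<sigma>(L := enc x)"
    have e1: "exec (Assign L (Var 0)) \<sigma> (2 + enc_size x) \<sigma>1"
      by (rule exec_Assign') (auto simp: \<sigma> \<sigma>1_def)
    have "\<sigma>1 0 = enc x" using \<sigma> L by (simp add: \<sigma>1_def)
    then obtain t \<rho> where 1: "exec c \<sigma>1 t \<rho>" "\<rho> 0 = enc (f x)" "\<And>i. i \<ge> N \<Longrightarrow> \<rho> i = \<sigma>1 i"
      "t \<le> (enc_size x + 2) ^ k" by (rule runsE[OF f]) blast
    define \<rho>1 where "\<rho>1 = \<rho>(L + 1 := enc (f x))"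
    have e2: "exec (Assign (L + 1) (Var 0)) \<rho> (2 + enc_size (f x)) \<rho>1"
      by (rule exec_Assign') (auto simp: \<rho>1_def 1(2))
    define \<rho>2 where "\<rho>2 = \<rho>1(0 := enc x)"
    have "\<rho>1 L = enc x" using 1(3)[of L] L by (simp add: \<rho>1_def \<sigma>1_def)
    then have e3: "exec (Assign 0 (Var L)) \<rho>1 (2 + enc_size x) \<rho>2"
      by (intro exec_Assign') (auto simp: \<rho>2_def)
    have "\<rho>2 0 = enc x" by (simp add: \<rho>2_def)
    then obtain u \<tau> where 2: "exec d \<rho>2 u \<tau>" "\<tau> 0 = enc (g x)" "\<And>i. i \<ge> M \<Longrightarrow> \<tau> i = \<rho>2 i"
      "u \<le> (enc_size x + 2) ^ j" by (rule runsE[OF g]) blast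
    have "\<tau> (L + 1) = enc (f x)" using 2(3)[of "L + 1"] L by (simp add: \<rho>2_def \<rho>1_def)
    then have e4: "exec (Assign 0 (NodeE (Var (L + 1)) (Var 0))) \<tau> (5 + 2 * enc_size (f x) + 2 * enc_size (g x))
        (\<tau>(0 := enc (f x, g x)))"
      by (intro exec_Assign') (auto simp: 2(2))
    define T where "T = (2 + enc_size x) + (t + ((2 + enc_size (f x)) + ((2 + enc_size x) + (u + (5 + 2 * enc_size (f x) + 2 * enc_size (g x))))))"
    have ex: "exec ?c \<sigma> T (\<tau>(0 := enc (f x, g x)))"
      unfolding T_def by (intro exec_Seq[OF e1] exec_Seq[OF 1(1)] exec_Seq[OF e2] exec_Seq[OF e3] exec_Seq[OF 2(1)] e4)
    have "T \<le> q (enc_size x)"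
      using 1(4) 2(4) runs_enc_size[OF f, of x] runs_enc_size[OF g, of x] unfolding q_def T_def by linarith
    moreover have "(\<tau>(0 := enc (f x, g x))) i = \<sigma> i" if "i \<ge> L + 2" for i
      using 1(3)[of i] 2(3)[of i] that L by (simp add: \<rho>2_def \<rho>1_def \<sigma>1_def)
    ultimately show "\<exists>t \<tau>. exec ?c \<sigma> t \<tau> \<and> \<tau> 0 = enc (f x, g x) \<and> (\<forall>i\<ge>L + 2. \<tau> i = \<sigma> i) \<and> t \<le> q (enc_size x)"
      using ex by (intro exI[of _ T] exI[of _ "\<tau>(0 := enc (f x, g x))"]) auto
  qed
qed

lemma ptime_If [ptime_intros]:
  assumes "ptime b" "ptime f" "ptime g"
  shows "ptime (\<lambda>x. if b x then f x else g x)"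
proof -
  obtain c0 N0 k0 where b: "runs c0 N0 k0 b" using assms(1) unfolding ptime_def by blast
  obtain c N k where f: "runs c N k f" using assms(2) unfolding ptime_def by blast
  obtain d M j where g: "runs d M j g" using assms(3) unfolding ptime_def by blast
  define L where "L = max (max N M) (max N0 1)"
  have L: "L \<ge> N" "L \<ge> M" "L \<ge> N0" "L \<ge> 1" unfolding L_def by auto
  define q where "q n = (n + 2) ^ k0 + (n + 2) ^ k + (n + 2) ^ j + 2 * n + 12" for n :: nat
  have pb: "poly_bounded q" unfolding q_def by (intro pb_intros)
  let ?c = "Seq (Assign L (Var 0)) (Seq c0 (Cond (Var 0) (Seq (Assign 0 (Var L)) c) (Seq (Assign 0 (Var L)) d)))"
  show ?thesis
  proof (rule ptime_I[where c = ?c and N = "L + 1", OF pb pb])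
    show "enc_size (if b x then f x else g x) \<le> q (enc_size x)" for x
      using runs_enc_size[OF f, of x] runs_enc_size[OF g, of x] unfolding q_def by simp
  next
    fix \<sigma> :: store and x :: 'a
    assume \<sigma>: "\<sigma> 0 = enc x"
    define \<sigma>1 where "\<sigma>1 = \<sigma>(L := enc x)"
    have e1: "exec (Assign L (Var 0)) \<sigma> (2 + enc_size x) \<sigma>1"
      by (rule exec_Assign') (auto simp: \<sigma> \<sigma>1_def)
    have "\<sigma>1 0 = enc x" using \<sigma> L by (simp add: \<sigma>1_def)
    then obtain t \<rho> where 1: "exec c0 \<sigma>1 t \<rho>" "\<rho> 0 = enc (b x)" "\<And>i. i \<ge> N0 \<Longrightarrow> \<rho> i = \<sigma>1 i"
      "t \<le> (enc_size x + 2) ^ k0" by (rule runsE[OF b]) blast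
    define \<rho>1 where "\<rho>1 = \<rho>(0 := enc x)"
    have "\<rho> L = enc x" using 1(3)[of L] L by (simp add: \<sigma>1_def)
    then have e2: "exec (Assign 0 (Var L)) \<rho> (2 + enc_size x) \<rho>1"
      by (intro exec_Assign') (auto simp: \<rho>1_def)
    have \<rho>1: "\<rho>1 0 = enc x" "\<And>i. i \<ge> L + 1 \<Longrightarrow> \<rho>1 i = \<sigma> i"
      using 1(3) L by (auto simp: \<rho>1_def \<sigma>1_def)
    show "\<exists>t \<tau>. exec ?c \<sigma> t \<tau> \<and> \<tau> 0 = enc (if b x then f x else g x) \<and>
        (\<forall>i\<ge>L + 1. \<tau> i = \<sigma> i) \<and> t \<le> q (enc_size x)"
    proof (cases "b x")
      case True
      from \<rho>1(1) obtain u \<tau> where 2: "exec c \<rho>1 u \<tau>" "\<tau> 0 = enc (f x)" "\<And>i. i \<ge> N \<Longrightarrow> \<tau> i = \<rho>1 i"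
        "u \<le> (enc_size x + 2) ^ k" by (rule runsE[OF f]) blast
      have ex: "exec ?c \<sigma> ((2 + enc_size x) + (t + (1 + expr_cost (Var 0) \<rho> + ((2 + enc_size x) + u)))) \<tau>"
        by (intro exec_Seq[OF e1] exec_Seq[OF 1(1)] exec_Cond_true exec_Seq[OF e2] 2(1))
          (simp add: 1(2) True)
      have "enc_size (b x) \<le> 1" by (rule enc_size_bool)
      then have "(2 + enc_size x) + (t + (1 + expr_cost (Var 0) \<rho> + ((2 + enc_size x) + u))) \<le> q (enc_size x)"
        using 1(2,4) 2(4) unfolding q_def by simp
      moreover have "\<forall>i\<ge>L + 1. \<tau> i = \<sigma> i" using 2(3) \<rho>1(2) L by simp
      ultimately show ?thesis using ex 2(2) True by auto
    next
      case False
      from \<rho>1(1) obtain u \<tau> where 2: "exec d \<rho>1 u \<tau>" "\<tau> 0 = enc (g x)" "\<And>i. i \<ge> M \<Longrightarrow> \<tau> i = \<rho>1 i"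
        "u \<le> (enc_size x + 2) ^ j" by (rule runsE[OF g]) blast
      have ex: "exec ?c \<sigma> ((2 + enc_size x) + (t + (1 + expr_cost (Var 0) \<rho> + ((2 + enc_size x) + u)))) \<tau>"
        by (intro exec_Seq[OF e1] exec_Seq[OF 1(1)] exec_Cond_false exec_Seq[OF e2] 2(1))
          (simp add: 1(2) False)
      have "enc_size (b x) \<le> 1" by (rule enc_size_bool)
      then have "(2 + enc_size x) + (t + (1 + expr_cost (Var 0) \<rho> + ((2 + enc_size x) + u))) \<le> q (enc_size x)"
        using 1(2,4) 2(4) unfolding q_def by simp
      moreover have "\<forall>i\<ge>L + 1. \<tau> i = \<sigma> i" using 2(3) \<rho>1(2) L by simp
      ultimately show ?thesis using ex 2(2) False by auto
    qed
  qed
qed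

lemma ptime_eq [ptime_intros]:
  assumes "ptime f" "ptime g"
  shows "ptime (\<lambda>x. f x = g x)"
proof (rule ptime_comp[OF ptime_Pair[OF assms], of "\<lambda>p. fst p = snd p", simplified])
  show "ptime (\<lambda>p :: 'b \<times> 'b. fst p = snd p)"
    by (rule ptime_expr[where e = "EqualE (LeftE (Var 0)) (RightE (Var 0))" and q = "\<lambda>n. 8 + 4 * n" and q' = "\<lambda>_. 1"])
      (auto intro!: pb_intros simp: enc_of_prod enc_of_bool enc_bool_def)
qed

text \<open>Variable \<open>A\<close> holds the parameter, \<open>B\<close> the rest of the list and
  \<open>D\<close> the accumulator, all beyond the variables of \<open>c\<close>. \<open>M\<close>
  bounds the accumulator after every prefix of the list, not only at the end, since the time of a
  single step depends on it; \<open>T\<close> then bounds each round, and the extra 1 in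
  \<open>length es + 1\<close> pays for the final failing test.\<close>

lemma runs_loop:
  assumes c: "runs c N k (\<lambda>p :: 'x::encodable \<times> 'e::encodable \<times> 'a::encodable. st (fst p) (snd (snd p)) (fst (snd p)))"
    and V: "A \<ge> max N 1" "B = A + 1" "D = A + 2"
    and body: "body = Seq (Assign 0 (NodeE (Var A) (NodeE (LeftE (Var B)) (Var D))))
      (Seq c (Seq (Assign D (Var 0)) (Assign B (RightE (Var B)))))"
    and T: "T = 20 * M + 30 + (3 * M + 4) ^ k"
    and M: "enc_size x \<le> M" "enc_size es \<le> M" "\<And>es1 es2. es = es1 @ es2 \<Longrightarrow> enc_size (foldl (st x) a es1) \<le> M"
    and \<sigma>: "\<sigma> A = enc x" "\<sigma> B = enc es" "\<sigma> D = enc a"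
  shows "\<exists>t \<tau>. exec (While (Var B) body) \<sigma> t \<tau> \<and> \<tau> D = enc (foldl (st x) a es) \<and>
    (\<forall>i>D. \<tau> i = \<sigma> i) \<and> t \<le> (length es + 1) * T"
  using M \<sigma>
proof (induction es arbitrary: a \<sigma>)
  case Nil
  have "exec (While (Var B) body) \<sigma> (1 + expr_cost (Var B) \<sigma>) \<sigma>"
    by (rule exec_While_false) (simp add: Nil)
  then show ?case using Nil T by (intro exI[of _ "1 + expr_cost (Var B) \<sigma>"] exI[of _ \<sigma>]) auto
next
  case (Cons e es)
  let ?f = "\<lambda>p :: 'x \<times> 'e \<times> 'a. st (fst p) (snd (snd p)) (fst (snd p))"
  have szs: "enc_size x \<le> M" "enc_size e + enc_size es + 1 \<le> M" "enc_size a \<le> M" "enc_size (st x a e) \<le> M"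
    using Cons.prems(1,2) Cons.prems(3)[of "[]" "e # es"] Cons.prems(3)[of "[e]" es] by simp_all
  define \<sigma>1 where "\<sigma>1 = \<sigma>(0 := enc (x, e, a))"
  have e1: "exec (Assign 0 (NodeE (Var A) (NodeE (LeftE (Var B)) (Var D)))) \<sigma>
      (11 + 2 * enc_size x + 4 * enc_size e + 3 * enc_size a + enc_size es) \<sigma>1"
    by (rule exec_Assign') (auto simp: \<sigma>1_def Cons.prems)
  have "\<sigma>1 0 = enc (x, e, a)" by (simp add: \<sigma>1_def)
  then obtain t \<rho> where 1: "exec c \<sigma>1 t \<rho>" "\<rho> 0 = enc (?f (x, e, a))" "\<And>i. i \<ge> N \<Longrightarrow> \<rho> i = \<sigma>1 i"
    "t \<le> (enc_size (x, e, a) + 2) ^ k" by (rule runsE[OF c]) blast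
  define \<rho>1 where "\<rho>1 = \<rho>(D := enc (st x a e))"
  have e2: "exec (Assign D (Var 0)) \<rho> (2 + enc_size (st x a e)) \<rho>1"
    by (rule exec_Assign') (auto simp: \<rho>1_def 1(2))
  define \<rho>2 where "\<rho>2 = \<rho>1(B := enc es)"
  have "\<rho>1 B = enc (e # es)" using 1(3)[of B] V Cons.prems by (simp add: \<rho>1_def \<sigma>1_def)
  then have e3: "exec (Assign B (RightE (Var B))) \<rho>1 (4 + enc_size e + 2 * enc_size es) \<rho>2"
    by (intro exec_Assign') (auto simp: \<rho>2_def)
  have *: "\<rho>2 A = enc x" "\<rho>2 B = enc es" "\<rho>2 D = enc (st x a e)"
    using 1(3)[of A] V Cons.prems by (auto simp: \<rho>2_def \<rho>1_def \<sigma>1_def)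
  have fr: "\<forall>i>D. \<rho>2 i = \<sigma> i"
    using 1(3) V by (auto simp: \<rho>2_def \<rho>1_def \<sigma>1_def)
  have "\<exists>u \<tau>. exec (While (Var B) body) \<rho>2 u \<tau> \<and> \<tau> D = enc (foldl (st x) (st x a e) es) \<and>
      (\<forall>i>D. \<tau> i = \<rho>2 i) \<and> u \<le> (length es + 1) * T"
  proof (rule Cons.IH)
    show "enc_size (foldl (st x) (st x a e) es1) \<le> M" if "es = es1 @ es2" for es1 es2
      using Cons.prems(3)[of "e # es1" es2] that by simp
  qed (use szs * in auto)
  then obtain u \<tau> where 2: "exec (While (Var B) body) \<rho>2 u \<tau>" "\<tau> D = enc (foldl (st x) (st x a e) es)"
      "\<forall>i>D. \<tau> i = \<rho>2 i" "u \<le> (length es + 1) * T" by blast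
  define t' where "t' = (11 + 2 * enc_size x + 4 * enc_size e + 3 * enc_size a + enc_size es) + (t + ((2 + enc_size (st x a e)) + (4 + enc_size e + 2 * enc_size es)))"
  have "exec body \<sigma> t' \<rho>2"
    unfolding body t'_def by (intro exec_Seq[OF e1] exec_Seq[OF 1(1)] exec_Seq[OF e2] e3)
  then have ex: "exec (While (Var B) body) \<sigma> (1 + expr_cost (Var B) \<sigma> + t' + u) \<tau>"
    by (rule exec_While_true[OF _ _ 2(1), rotated]) (simp add: Cons.prems)
  have "(enc_size (x, e, a) + 2) ^ k \<le> (3 * M + 4) ^ k"
    by (rule power_mono) (use szs in auto)
  moreover have "expr_cost (Var B) \<sigma> = 2 + enc_size e + enc_size es" by (simp add: Cons.prems)
  ultimately have "1 + expr_cost (Var B) \<sigma> + t' \<le> T"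
    using szs 1(4) unfolding T t'_def by linarith
  then have "1 + expr_cost (Var B) \<sigma> + t' + u \<le> (length (e # es) + 1) * T"
    using 2(4) by simp
  then show ?case using ex 2(2,3) fr by auto
qed

text \<open>Iterating a polynomial-time step can produce exponentially large values, as repeated
  doubling of a tree shows, so a polynomial bound on all intermediate accumulators is a
  premise.\<close>

lemma ptime_foldl:
  assumes "ptime l" "ptime i" "ptime (\<lambda>p. st (fst p) (snd (snd p)) (fst (snd p)))"
    and "poly_bounded q" "\<And>x es1 es2. l x = es1 @ es2 \<Longrightarrow> enc_size (foldl (st x) (i x) es1) \<le> q (enc_size x)"
  shows "ptime (\<lambda>x :: 'x::encodable. foldl (st x) (i x) (l x))"
proof -
  obtain d L j where d: "runs d L j (\<lambda>x. (x, l x, i x))"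
    using ptime_Pair[OF ptime_id ptime_Pair[OF assms(1,2)]] unfolding ptime_def by blast
  obtain c N k where c: "runs c N k (\<lambda>p. st (fst p) (snd (snd p)) (fst (snd p)))"
    using assms(3) unfolding ptime_def by blast
  define A B D where ABD: "A = max (max N 1) L" "B = A + 1" "D = A + 2"
  define body where body: "body = Seq (Assign 0 (NodeE (Var A) (NodeE (LeftE (Var B)) (Var D))))
      (Seq c (Seq (Assign D (Var 0)) (Assign B (RightE (Var B)))))"
  define M where "M n = (n + 2) ^ j + q n" for n :: nat
  define T where "T n = 20 * M n + 30 + (3 * M n + 4) ^ k" for n
  define q' where "q' n = (n + 2) ^ j + (M n + 1) * T n + 20 * M n + 50" for n
  have pb: "poly_bounded q'" unfolding q'_def T_def M_def by (intro pb_intros assms(4))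
  let ?c = "Seq d (Seq (Assign A (LeftE (Var 0))) (Seq (Assign B (LeftE (RightE (Var 0))))
    (Seq (Assign D (RightE (RightE (Var 0)))) (Seq (While (Var B) body) (Assign 0 (Var D))))))"
  show ?thesis
  proof (rule ptime_I[where c = ?c and N = "D + 1", OF pb assms(4)])
    show "enc_size (foldl (st x) (i x) (l x)) \<le> q (enc_size x)" for x
      using assms(5)[of x "l x" "[]"] by simp
  next
    fix \<sigma> :: store and x :: 'x
    assume \<sigma>: "\<sigma> 0 = enc x"
    obtain t \<rho> where 1: "exec d \<sigma> t \<rho>" "\<rho> 0 = enc (x, l x, i x)" "\<And>i. i \<ge> L \<Longrightarrow> \<rho> i = \<sigma> i"
      "t \<le> (enc_size x + 2) ^ j" using \<sigma> by (rule runsE[OF d]) blast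
    define m where "m = enc_size (x, l x, i x)"
    have m: "enc_size x + enc_size (l x) + enc_size (i x) + 2 = m" by (simp add: m_def)
    have mM: "m \<le> M (enc_size x)" using runs_enc_size[OF d, of x] by (simp add: m_def M_def)
    define \<rho>1 where "\<rho>1 = \<rho>(A := enc x)"
    define \<rho>2 where "\<rho>2 = \<rho>1(B := enc (l x))"
    define \<rho>3 where "\<rho>3 = \<rho>2(D := enc (i x))"
    have e1: "exec (Assign A (LeftE (Var 0))) \<rho> (1 + (1 + (1 + m) + enc_size x)) \<rho>1"
      by (rule exec_Assign') (auto simp: \<rho>1_def 1(2) m_def)
    have r1: "\<rho>1 0 = enc (x, l x, i x)" using 1(2) by (simp add: \<rho>1_def ABD)
    have e2: "exec (Assign B (LeftE (RightE (Var 0)))) \<rho>1 (1 + (1 + (1 + (1 + m) + enc_size (l x, i x)) + enc_size (l x))) \<rho>2"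
      by (rule exec_Assign') (auto simp: \<rho>2_def r1 m_def)
    have r2: "\<rho>2 0 = enc (x, l x, i x)" using r1 by (simp add: \<rho>2_def ABD)
    have e3: "exec (Assign D (RightE (RightE (Var 0)))) \<rho>2 (1 + (1 + (1 + (1 + m) + enc_size (l x, i x)) + enc_size (i x))) \<rho>3"
      by (rule exec_Assign') (auto simp: \<rho>3_def r2 m_def)
    have r3: "\<rho>3 A = enc x" "\<rho>3 B = enc (l x)" "\<rho>3 D = enc (i x)" "\<forall>i>D. \<rho>3 i = \<sigma> i"
      using 1(3) by (auto simp: \<rho>1_def \<rho>2_def \<rho>3_def ABD)
    have "\<exists>u \<tau>. exec (While (Var B) body) \<rho>3 u \<tau> \<and> \<tau> D = enc (foldl (st x) (i x) (l x)) \<and>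
      (\<forall>i>D. \<tau> i = \<rho>3 i) \<and> u \<le> (length (l x) + 1) * T (enc_size x)"
    proof (rule runs_loop[OF c _ _ _ body])
      show "T (enc_size x) = 20 * M (enc_size x) + 30 + (3 * M (enc_size x) + 4) ^ k" by (simp add: T_def)
      show "enc_size (foldl (st x) (i x) es1) \<le> M (enc_size x)" if "l x = es1 @ es2" for es1 es2
        using assms(5)[OF that] by (simp add: M_def)
    qed (use r3 m mM in \<open>auto simp: ABD\<close>)
    then obtain u \<tau> where 2: "exec (While (Var B) body) \<rho>3 u \<tau>" "\<tau> D = enc (foldl (st x) (i x) (l x))"
      "\<forall>i>D. \<tau> i = \<rho>3 i" "u \<le> (length (l x) + 1) * T (enc_size x)" by blast
    define r where "r = enc (foldl (st x) (i x) (l x))"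
    have e4: "exec (Assign 0 (Var D)) \<tau> (2 + size r) (\<tau>(0 := r))"
      by (rule exec_Assign') (auto simp: 2(2) r_def)
    have rM: "size r \<le> M (enc_size x)" using assms(5)[of x "l x" "[]"] by (simp add: r_def M_def)
    define t' where "t' = t + ((1 + (1 + (1 + m) + enc_size x)) + ((1 + (1 + (1 + (1 + m) + enc_size (l x, i x)) + enc_size (l x))) +
      ((1 + (1 + (1 + (1 + m) + enc_size (l x, i x)) + enc_size (i x))) + (u + (2 + size r)))))"
    have ex: "exec ?c \<sigma> t' (\<tau>(0 := r))"
      unfolding t'_def
      by (intro exec_Seq[OF 1(1)] exec_Seq[OF e1] exec_Seq[OF e2] exec_Seq[OF e3] exec_Seq[OF 2(1)] e4)
    have "(length (l x) + 1) * T (enc_size x) \<le> (M (enc_size x) + 1) * T (enc_size x)"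
      using length_le_enc_size[of "l x"] m mM by (intro mult_right_mono) auto
    moreover have "enc_size (l x, i x) \<le> m" using m by simp
    ultimately have "t' \<le> q' (enc_size x)"
      using 1(4) 2(4) rM m mM unfolding t'_def q'_def by linarith
    moreover have "\<forall>i\<ge>D + 1. (\<tau>(0 := r)) i = \<sigma> i" using 2(3) r3(4) by auto
    ultimately show "\<exists>t \<tau>. exec ?c \<sigma> t \<tau> \<and> \<tau> 0 = enc (foldl (st x) (i x) (l x)) \<and>
        (\<forall>i\<ge>D + 1. \<tau> i = \<sigma> i) \<and> t \<le> q' (enc_size x)"
      using ex r_def by (intro exI[of _ t'] exI[of _ "\<tau>(0 := r)"]) auto
  qed
qed

text \<open>Growth by an amount that depends on \<open>x\<close> and \<open>e\<close> but not on the
  accumulator adds up to a polynomial over the whole list. The measure may differ from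
  \<open>enc_size\<close> by a constant factor; for numbers it is \<open>bitlen\<close>, since
  \<open>enc_size\<close> also counts the one bits.\<close>

lemma ptime_foldl_measure:
  fixes \<mu> :: "'a::encodable \<Rightarrow> nat"
  assumes "ptime l" "ptime i" "ptime (\<lambda>p. st (fst p) (snd (snd p)) (fst (snd p)))"
    and step: "\<And>x e a. \<mu> (st x a e) \<le> \<mu> a + (enc_size x + enc_size e + 2) ^ k"
    and \<mu>: "\<And>a. enc_size a \<le> c * \<mu> a" "\<And>a. \<mu> a \<le> enc_size a"
  shows "ptime (\<lambda>x :: 'x::encodable. foldl (st x) (i x) (l x))"
proof -
  obtain a where a: "\<And>x. enc_size (i x) \<le> (enc_size x + 2) ^ a" using ptime_enc_size[OF assms(2)] by blast
  obtain b where b: "\<And>x. enc_size (l x) \<le> (enc_size x + 2) ^ b" using ptime_enc_size[OF assms(1)] by blast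
  define q where "q n = c * ((n + 2) ^ a + (n + 2) ^ b * (n + (n + 2) ^ b + 2) ^ k)" for n :: nat
  show ?thesis
  proof (rule ptime_foldl[OF assms(1-3)])
    show "poly_bounded q" unfolding q_def by (intro pb_intros)
    fix x es1 es2
    assume es: "l x = es1 @ es2"
    have *: "\<mu> (foldl (st x) (i x) es) \<le> \<mu> (i x) + length es * (enc_size x + enc_size es + 2) ^ k" for es
    proof (induction es rule: rev_induct)
      case (snoc e es)
      have "(enc_size x + enc_size es + 2) ^ k \<le> (enc_size x + enc_size (es @ [e]) + 2) ^ k"
        by (intro power_mono) auto
      then have "length es * (enc_size x + enc_size es + 2) ^ k \<le> length es * (enc_size x + enc_size (es @ [e]) + 2) ^ k"
        by (rule mult_left_mono) simp
      moreover have "(enc_size x + enc_size e + 2) ^ k \<le> (enc_size x + enc_size (es @ [e]) + 2) ^ k"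
        by (intro power_mono) auto
      ultimately have "\<mu> (st x (foldl (st x) (i x) es) e) \<le>
          \<mu> (i x) + ((enc_size x + enc_size (es @ [e]) + 2) ^ k + length es * (enc_size x + enc_size (es @ [e]) + 2) ^ k)"
        using snoc step[of x "foldl (st x) (i x) es" e] by linarith
      then show ?case
        by (simp only: foldl_append foldl.simps length_append_singleton mult_Suc)
    qed simp
    have 1: "\<mu> (i x) \<le> (enc_size x + 2) ^ a" using \<mu>(2)[of "i x"] a[of x] by linarith
    have le: "enc_size es1 \<le> (enc_size x + 2) ^ b" using b[of x] es by simp
    have "length es1 * (enc_size x + enc_size es1 + 2) ^ k \<le> (enc_size x + 2) ^ b * (enc_size x + (enc_size x + 2) ^ b + 2) ^ k"
      using le length_le_enc_size[of es1] by (intro mult_mono power_mono) auto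
    with 1 *[of es1] have "\<mu> (foldl (st x) (i x) es1) \<le> (enc_size x + 2) ^ a + (enc_size x + 2) ^ b * (enc_size x + (enc_size x + 2) ^ b + 2) ^ k"
      by linarith
    then show "enc_size (foldl (st x) (i x) es1) \<le> q (enc_size x)"
      unfolding q_def by (meson \<mu>(1) mult_left_mono le0 order_trans)
  qed
qed

lemma ptime_foldl_add:
  assumes "ptime l" "ptime i" "ptime (\<lambda>p. st (fst p) (snd (snd p)) (fst (snd p)))"
    and "\<And>x e a. enc_size (st x a e) \<le> enc_size a + (enc_size x + enc_size e + 2) ^ k"
  shows "ptime (\<lambda>x :: 'x::encodable. foldl (st x) (i x) (l x))"
  using assms by (rule ptime_foldl_measure[where \<mu> = enc_size and c = 1]) auto

section \<open>List operations as folds\<close>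

subsection \<open>Lists\<close>

lemma ptime_Cons [ptime_intros]: "ptime f \<Longrightarrow> ptime g \<Longrightarrow> ptime (\<lambda>x. f x # g x)"
  by (rule ptime_cast[OF ptime_Pair]) auto

lemma rev_eq_foldl: "rev xs = foldl (\<lambda>a e. e # a) [] xs"
  by (simp add: foldl_conv_fold rev_conv_fold) 

lemma ptime_rev [ptime_intros]: "ptime f \<Longrightarrow> ptime (\<lambda>x. rev (f x))"
  unfolding rev_eq_foldl
  by (rule ptime_foldl_add[where k = 1]) (auto intro!: ptime_intros)

lemma append_eq_foldl: "xs @ ys = foldl (\<lambda>a e. e # a) ys (rev xs)"
  by (induction xs) auto

lemma ptime_append [ptime_intros]: "ptime f \<Longrightarrow> ptime g \<Longrightarrow> ptime (\<lambda>x. f x @ g x)"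
  unfolding append_eq_foldl
  by (rule ptime_foldl_add[where k = 1]) (auto intro!: ptime_intros)

lemma map_eq_foldl: "map f xs = rev (foldl (\<lambda>a e. f e # a) [] xs)"
  by (induction xs rule: rev_induct) auto

lemma ptime_app2:
  assumes "ptime (\<lambda>p. f (fst p) (snd p))" "ptime g" "ptime h"
  shows "ptime (\<lambda>x. f (g x) (h x))"
  using ptime_comp[OF ptime_Pair[OF assms(2,3)] assms(1)] by simp

lemma ptime_map [ptime_intros]:
  assumes "ptime l" "ptime (\<lambda>p. f (fst p) (snd p))"
  shows "ptime (\<lambda>x. map (f x) (l x))"
proof -
  obtain k where k: "\<And>p. enc_size (f (fst p) (snd p)) \<le> (enc_size p + 2) ^ k"
    using ptime_enc_size[OF assms(2)] by blast
  \<comment> \<open>The pair \<open>(x, e)\<close> has one node more than \<open>x\<close> and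
    \<open>e\<close> together, so with \<open>m = enc_size x + enc_size e\<close> the bound for
    \<open>f\<close> is \<open>(m + 3) ^ k\<close>. The estimate
    \<open>m + 3 \<le> (m + 2) ^ 2\<close> restores the base, and one more factor absorbs the
    \<open>+ 1\<close> of the list cell.\<close>
  have *: "enc_size (f x e) + 1 \<le> (enc_size x + enc_size e + 2) ^ (2 * k + 1)" for x e
  proof -
    have "enc_size x + enc_size e + 3 \<le> (enc_size x + enc_size e + 2) ^ 2" by (simp add: power2_eq_square)
    then have "(enc_size x + enc_size e + 3) ^ k \<le> (enc_size x + enc_size e + 2) ^ (2 * k)"
      by (simp only: power_mult power_mono)
    moreover have "enc_size (f x e) \<le> (enc_size x + enc_size e + 3) ^ k" using k[of "(x, e)"] by (simp add: numeral_3_eq_3)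
    moreover have "(enc_size x + enc_size e + 2) ^ (2 * k) + 1 \<le> 2 * (enc_size x + enc_size e + 2) ^ (2 * k)" by simp
    moreover have "2 * (enc_size x + enc_size e + 2) ^ (2 * k) \<le> (enc_size x + enc_size e + 2) * (enc_size x + enc_size e + 2) ^ (2 * k)"
      by (intro mult_right_mono) auto
    ultimately have "enc_size (f x e) + 1 \<le> (enc_size x + enc_size e + 2) * (enc_size x + enc_size e + 2) ^ (2 * k)" by linarith
    then show ?thesis by simp
  qed
  have "ptime (\<lambda>x. foldl (\<lambda>a e. f x e # a) [] (l x))"
  proof (rule ptime_foldl_add[where k = "2 * k + 1", OF assms(1) ptime_const])
    show "ptime (\<lambda>p. f (fst p) (fst (snd p)) # snd (snd p))"
      by (intro ptime_intros ptime_app2[OF assms(2)])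
    show "enc_size (f x e # a) \<le> enc_size a + (enc_size x + enc_size e + 2) ^ (2 * k + 1)" for x e a
      using *[of x e] by simp
  qed
  then show ?thesis unfolding map_eq_foldl by (rule ptime_rev)
qed

lemma concat_eq_foldl: "concat xs = foldl (\<lambda>a e. a @ e) [] xs"
  by (induction xs rule: rev_induct) auto

lemma ptime_concat [ptime_intros]: "ptime f \<Longrightarrow> ptime (\<lambda>x. concat (f x))"
  unfolding concat_eq_foldl
  by (rule ptime_foldl_add[where k = 1]) (auto intro!: ptime_intros)

lemma filter_eq_concat: "filter P xs = concat (map (\<lambda>e. if P e then [e] else []) xs)"
  by (induction xs) auto

lemma ptime_filter [ptime_intros]:
  assumes "ptime l" "ptime (\<lambda>p. P (fst p) (snd p))"
  shows "ptime (\<lambda>x. filter (P x) (l x))"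
  unfolding filter_eq_concat by (intro ptime_intros assms)

lemma ptime_not [ptime_intros]: "ptime f \<Longrightarrow> ptime (\<lambda>x. \<not> f x)"
  by (rule ptime_cast[OF ptime_If[OF _ ptime_const ptime_const, of f False True]]) auto

lemma ptime_conj [ptime_intros]: "ptime f \<Longrightarrow> ptime g \<Longrightarrow> ptime (\<lambda>x. f x \<and> g x)"
  by (rule ptime_cast[OF ptime_If[OF _ _ ptime_const, of f g False]]) auto

lemma ptime_disj [ptime_intros]: "ptime f \<Longrightarrow> ptime g \<Longrightarrow> ptime (\<lambda>x. f x \<or> g x)"
  by (rule ptime_cast[OF ptime_If[OF _ ptime_const, of f g True]]) auto

lemma ptime_imp [ptime_intros]: "ptime f \<Longrightarrow> ptime g \<Longrightarrow> ptime (\<lambda>x. f x \<longrightarrow> g x)"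
  by (rule ptime_cast[OF ptime_disj[OF ptime_not, of f g]]) auto

lemma ptime_Bex [ptime_intros]:
  assumes "ptime l" "ptime (\<lambda>p. P (fst p) (snd p))"
  shows "ptime (\<lambda>x. \<exists>e\<in>set (l x). P x e)"
proof -
  have "ptime (\<lambda>x. \<not> filter (P x) (l x) = [])" by (intro ptime_intros assms)
  then show ?thesis by (rule ptime_cast) (auto simp: filter_empty_conv)
qed

lemma ptime_Ball [ptime_intros]:
  assumes "ptime l" "ptime (\<lambda>p. P (fst p) (snd p))"
  shows "ptime (\<lambda>x. \<forall>e\<in>set (l x). P x e)"
proof -
  have "ptime (\<lambda>x. \<not> (\<exists>e\<in>set (l x). \<not> P x e))" by (intro ptime_intros assms)
  then show ?thesis by simp
qed

lemma ptime_member [ptime_intros]: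
  assumes "ptime f" "ptime l"
  shows "ptime (\<lambda>x. f x \<in> set (l x))"
proof -
  have "ptime (\<lambda>x. \<exists>e\<in>set (l x). e = f x)"
    by (intro ptime_intros assms ptime_comp[OF ptime_fst[OF ptime_id] assms(1)])
  then show ?thesis by simp
qed

lemma takeWhile_eq_foldl:
  "takeWhile P xs = snd (foldl (\<lambda>a e. if fst a \<and> P e then (True, snd a @ [e]) else (False, snd a)) (True, []) xs)"
proof -
  let ?s = "\<lambda>a e. if fst a \<and> P e then (True, snd a @ [e]) else (False, snd a)"
  have "foldl ?s (False, ys) xs = (False, ys)" for ys by (induction xs) auto
  then have "snd (foldl ?s (True, ys) xs) = ys @ takeWhile P xs" for ys
    by (induction xs arbitrary: ys) auto
  then show ?thesis by simp
qed

lemma ptime_takeWhile [ptime_intros]: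
  assumes "ptime l" "ptime (\<lambda>p. P (fst p) (snd p))"
  shows "ptime (\<lambda>x. takeWhile (P x) (l x))"
  unfolding takeWhile_eq_foldl
proof (rule ptime_snd, rule ptime_foldl_add[where k = 2])
  show "ptime (\<lambda>p. if fst (snd (snd p)) \<and> P (fst p) (fst (snd p))
         then (True, snd (snd (snd p)) @ [fst (snd p)]) else (False, snd (snd (snd p))))"
    by (intro ptime_intros ptime_app2[OF assms(2)])
qed (auto intro!: ptime_intros assms simp: power2_eq_square enc_of_prod)

section \<open>Arithmetic on binary numbers by folds over bit lists\<close>

subsection \<open>Binary arithmetic\<close>

fun bits :: "nat \<Rightarrow> bool list" where
  "bits n = (if n = 0 then [] else odd n # bits (n div 2))"

declare bits.simps [simp del]

primrec val :: "bool list \<Rightarrow> nat" where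
  "val [] = 0"
| "val (b # bs) = of_bool b + 2 * val bs"

lemma bits_0 [simp]: "bits 0 = []"
  by (simp add: bits.simps)

text \<open>Numbers are encoded as the lists of their bits, so \<open>ptime_cast\<close> moves
  between both and arithmetic can be programmed on boolean lists.\<close>

lemma enc_bits: "enc (bits n) = enc n"
proof (induction n rule: bits.induct)
  case (1 n)
  then show ?case
    by (cases "n = 0")
      (simp_all add: bits.simps[of n] enc_of_nat enc_nat.simps[of n] enc_nat.simps[of 0] enc_of_bool)
qed

lemma val_bits [simp]: "val (bits n) = n"
proof (induction n rule: bits.induct)
  case (1 n)
  then show ?case by (subst bits.simps) auto
qed

lemma bits_double: "bits (of_bool b + 2 * n) = (if n = 0 \<and> \<not> b then [] else b # bits n)"
  by (subst bits.simps) auto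

lemma length_bits_le_iff: "length (bits n) \<le> k \<longleftrightarrow> n < 2 ^ k"
proof (induction k arbitrary: n)
  case 0
  then show ?case by (subst bits.simps) auto
next
  case (Suc k)
  show ?case
  proof (cases "n = 0")
    case False
    then have "length (bits n) \<le> Suc k \<longleftrightarrow> length (bits (n div 2)) \<le> k" by (subst bits.simps) auto
    also have "\<dots> \<longleftrightarrow> n < 2 ^ Suc k" unfolding Suc by auto
    finally show ?thesis .
  qed simp
qed

abbreviation bitlen :: "nat \<Rightarrow> nat" where "bitlen n \<equiv> length (bits n)"

lemma less_power_bitlen: "n < 2 ^ bitlen n"
  using length_bits_le_iff by blast

lemma enc_size_bool_list: "enc_size (bs :: bool list) \<le> 2 * length bs"
proof (induction bs)
  case (Cons b bs)
  then show ?case by (cases b) auto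
qed simp

lemma enc_size_nat_le: "enc_size (n :: nat) \<le> 2 * bitlen n"
  using enc_size_bool_list[of "bits n"] by (simp add: enc_bits)

lemma bitlen_le_enc_size: "bitlen n \<le> enc_size n"
  using length_le_enc_size[of "bits n"] by (simp add: enc_bits)

lemma bitlen_mult: "bitlen (m * n) \<le> bitlen m + bitlen n"
  unfolding length_bits_le_iff power_add using less_power_bitlen[of m] less_power_bitlen[of n]
  by (rule mult_strict_mono) auto

lemma bitlen_add: "bitlen (m + n) \<le> bitlen m + bitlen n + 1"
proof -
  have "m + n < 2 ^ (bitlen m + bitlen n) + 2 ^ (bitlen m + bitlen n)"
    using order.strict_trans2[OF less_power_bitlen[of m] power_increasing[of "bitlen m" "bitlen m + bitlen n" 2]]
      order.strict_trans2[OF less_power_bitlen[of n] power_increasing[of "bitlen n" "bitlen m + bitlen n" 2]]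
    by simp
  then show ?thesis unfolding length_bits_le_iff by simp
qed

lemma bitlen_double: "bitlen (2 * n) \<le> bitlen n + 1"
  unfolding length_bits_le_iff using less_power_bitlen[of n] by simp

lemma bitlen_le: "n < k \<Longrightarrow> bitlen n \<le> k"
  unfolding length_bits_le_iff by (rule less_trans[OF _ less_exp])

lemma ptime_bits [ptime_intros]: "ptime f \<Longrightarrow> ptime (\<lambda>x. bits (f x))"
  by (rule ptime_cast) (auto simp: enc_bits)

text \<open>The list is read from the most significant bit. The test
  \<open>a = [] \<and> \<not> b\<close> drops leading zeros, which \<open>bits\<close> never
  produces but an adder may.\<close>

lemma bits_val: "bits (val bs) = foldl (\<lambda>a b. if a = [] \<and> \<not> b then [] else b # a) [] (rev bs)"
proof (induction bs)
  case (Cons b bs)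
  have "bits (val bs) = [] \<longleftrightarrow> val bs = 0" by (subst bits.simps) auto
  with Cons show ?case by (simp only: val.simps bits_double rev.simps foldl_append foldl.simps)
qed simp

lemma ptime_val [ptime_intros]:
  assumes "ptime f"
  shows "ptime (\<lambda>x. val (f x))"
proof -
  have "ptime (\<lambda>x. bits (val (f x)))"
    unfolding bits_val
  proof (rule ptime_foldl_add[where k = 1])
    show "enc_size (if a = [] \<and> \<not> b then [] else b # a) \<le> enc_size a + (enc_size x + enc_size b + 2) ^ 1" for x :: 'a and a b
      by simp
  qed (intro ptime_intros assms)+
  then show ?thesis by (rule ptime_cast) (simp add: enc_bits)
qed

text \<open>The default \<open>False\<close> reads a list beyond its end as zeros. It agrees with
  \<open>left Leaf = Leaf\<close>, so the function is a single \<open>LeftE\<close>.\<close>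

definition hd0 :: "bool list \<Rightarrow> bool" where
  "hd0 bs = (case bs of [] \<Rightarrow> False | b # _ \<Rightarrow> b)"

lemma hd0_simps [simp]: "hd0 [] = False" "hd0 (b # bs) = b"
  by (simp_all add: hd0_def)

lemma ptime_hd0 [ptime_intros]:
  assumes "ptime f"
  shows "ptime (\<lambda>x. hd0 (f x))"
proof (rule ptime_comp[OF assms, of hd0])
  have *: "left (enc bs) = enc (hd0 bs)" "enc_size (hd0 bs) \<le> enc_size bs" "enc_size (hd0 bs) \<le> Suc 0" for bs :: "bool list"
    using enc_size_bool[of "hd0 bs"] by (cases bs; simp)+
  show "ptime hd0"
    by (rule ptime_expr[where e = "LeftE (Var 0)" and q = "\<lambda>n. 4 + 2 * n" and q' = "\<lambda>_. 1"])
      (use * in \<open>auto intro!: pb_intros intro: le_trans le_SucI\<close>)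
qed

lemma ptime_tl [ptime_intros]:
  assumes "ptime f"
  shows "ptime (\<lambda>x. tl (f x))"
proof (rule ptime_comp[OF assms, of tl])
  have *: "right (enc bs) = enc (tl bs)" "enc_size (tl bs) \<le> enc_size bs" for bs :: "'b list"
    by (cases bs; simp)+
  show "ptime (tl :: 'b list \<Rightarrow> 'b list)"
    by (rule ptime_expr[where e = "RightE (Var 0)" and q = "\<lambda>n. 4 + 2 * n" and q' = "\<lambda>n. n"])
      (use * in \<open>auto intro!: pb_intros simp: le_Suc_eq add_mono\<close>)
qed

text \<open>The first list counts the positions, and shorter numbers are padded with zeros. The
  concatenation of both bit lists serves as counter below, being at least as long as either.\<close>

primrec zip_bits :: "'a list \<Rightarrow> bool list \<Rightarrow> bool list \<Rightarrow> (bool \<times> bool) list" where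
  "zip_bits [] as bs = []"
| "zip_bits (_ # cs) as bs = (hd0 as, hd0 bs) # zip_bits cs (tl as) (tl bs)"

lemma zip_bits_eq_foldl:
  "zip_bits cs as bs = rev (snd (snd (foldl
     (\<lambda>s _. (tl (fst s), (tl (fst (snd s)), (hd0 (fst s), hd0 (fst (snd s))) # snd (snd s)))) (as, (bs, [])) cs)))"
proof -
  have "snd (snd (foldl (\<lambda>s _. (tl (fst s), (tl (fst (snd s)), (hd0 (fst s), hd0 (fst (snd s))) # snd (snd s))))
      (as, (bs, zs)) cs)) = rev (zip_bits cs as bs) @ zs" for zs
    by (induction cs arbitrary: as bs zs) auto
  then show ?thesis by simp
qed

lemma ptime_zip_bits [ptime_intros]:
  assumes "ptime f" "ptime g" "ptime h"
  shows "ptime (\<lambda>x. zip_bits (f x) (g x) (h x))"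
  unfolding zip_bits_eq_foldl
proof (rule ptime_rev, rule ptime_snd, rule ptime_snd, rule ptime_foldl_add[where k = 2])
  fix x :: 'a and s :: "bool list \<times> bool list \<times> (bool \<times> bool) list" and e :: 'b
  obtain as bs zs where s: "s = (as, bs, zs)" by (cases s) auto
  have "enc_size (tl as) \<le> enc_size as" "enc_size (tl bs) \<le> enc_size bs" by (cases as; simp) (cases bs; simp)
  then have "enc_size (tl (fst s), tl (fst (snd s)), (hd0 (fst s), hd0 (fst (snd s))) # snd (snd s)) \<le> enc_size s + 4"
    using enc_size_bool[of "hd0 as"] enc_size_bool[of "hd0 bs"] by (simp add: s)
  also have "4 \<le> (enc_size x + enc_size e + 2) ^ 2" by (simp add: power2_eq_square)
  finally show "enc_size (tl (fst s), tl (fst (snd s)), (hd0 (fst s), hd0 (fst (snd s))) # snd (snd s))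
      \<le> enc_size s + (enc_size x + enc_size e + 2) ^ 2" by simp
qed (intro ptime_intros assms)+

lemma val_tl: "val as = of_bool (hd0 as) + 2 * val (tl as)"
  by (cases as) auto

lemma val_zip_bits:
  "length as \<le> length cs \<Longrightarrow> val (map fst (zip_bits cs as bs)) = val as"
  "length bs \<le> length cs \<Longrightarrow> val (map snd (zip_bits cs as bs)) = val bs"
proof (induction cs arbitrary: as bs)
  case (Cons c cs)
  { case 1 then show ?case using Cons.IH(1)[of "tl as" "tl bs"] val_tl[of as] by simp }
  { case 2 then show ?case using Cons.IH(2)[of "tl bs" "tl as"] val_tl[of bs] by simp }
qed simp_all

text \<open>Ripple-carry addition: \<open>c\<close> is the carry, the digit is the parity of three
  bits, and the next carry is their majority.\<close>

primrec add_bits :: "(bool \<times> bool) list \<Rightarrow> bool \<Rightarrow> bool list" where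
  "add_bits [] c = [c]"
| "add_bits (p # ps) c = ((fst p \<noteq> snd p) \<noteq> c) # add_bits ps (fst p \<and> snd p \<or> c \<and> (fst p \<or> snd p))"

lemma val_add_bits: "val (add_bits ps c) = val (map fst ps) + val (map snd ps) + of_bool c"
  by (induction ps arbitrary: c) auto

lemma add_bits_eq_foldl:
  "add_bits ps c = (let s = foldl (\<lambda>s p. (fst p \<and> snd p \<or> fst s \<and> (fst p \<or> snd p),
      ((fst p \<noteq> snd p) \<noteq> fst s) # snd s)) (c, []) ps in rev (fst s # snd s))"
proof -
  have "(let s = foldl (\<lambda>s p. (fst p \<and> snd p \<or> fst s \<and> (fst p \<or> snd p),
      ((fst p \<noteq> snd p) \<noteq> fst s) # snd s)) (c, zs) ps in rev (fst s # snd s)) = rev zs @ add_bits ps c" for zs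
    by (induction ps arbitrary: c zs) (auto simp: Let_def)
  then show ?thesis by simp
qed

lemma ptime_add_bits [ptime_intros]:
  assumes "ptime f" "ptime g"
  shows "ptime (\<lambda>x. add_bits (f x) (g x))"
proof -
  have "ptime (\<lambda>x. foldl (\<lambda>s p. (fst p \<and> snd p \<or> fst s \<and> (fst p \<or> snd p),
      ((fst p \<noteq> snd p) \<noteq> fst s) # snd s)) (g x, []) (f x))"
  proof (rule ptime_foldl_add[where k = 2])
    fix x :: 'a and s :: "bool \<times> bool list" and p :: "bool \<times> bool"
    have "enc_size (fst p \<and> snd p \<or> fst s \<and> (fst p \<or> snd p), ((fst p \<noteq> snd p) \<noteq> fst s) # snd s) \<le> enc_size s + 4"
      using enc_size_bool[of "fst p \<and> snd p \<or> fst s \<and> (fst p \<or> snd p)"] enc_size_bool[of "(fst p \<noteq> snd p) \<noteq> fst s"]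
      unfolding enc_of_prod by simp
    also have "4 \<le> (enc_size x + enc_size p + 2) ^ 2" by (simp add: power2_eq_square)
    finally show "enc_size (fst p \<and> snd p \<or> fst s \<and> (fst p \<or> snd p), ((fst p \<noteq> snd p) \<noteq> fst s) # snd s)
        \<le> enc_size s + (enc_size x + enc_size p + 2) ^ 2" by simp
  qed (intro ptime_intros assms)+
  note * = ptime_rev[OF ptime_Cons[OF ptime_fst[OF this] ptime_snd[OF this]]]
  show ?thesis unfolding add_bits_eq_foldl Let_def by (rule *)
qed

lemma ptime_plus [ptime_intros]:
  assumes "ptime f" "ptime g"
  shows "ptime (\<lambda>x. f x + g x :: nat)"
proof -
  have "ptime (\<lambda>x. val (add_bits (zip_bits (bits (f x) @ bits (g x)) (bits (f x)) (bits (g x))) False))"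
    by (intro ptime_intros assms)
  then show ?thesis by (simp add: val_add_bits val_zip_bits)
qed

text \<open>From the least significant bit upwards, the last position at which the numbers differ
  decides; \<open>r\<close> is the verdict if they agree everywhere.\<close>

lemma less_bits:
  "foldl (\<lambda>r p. if fst p = snd p then r else snd p) r ps \<longleftrightarrow>
    val (map fst ps) < val (map snd ps) \<or> val (map fst ps) = val (map snd ps) \<and> r"
proof (induction ps arbitrary: r)
  case (Cons p ps)
  show ?case unfolding foldl.simps Cons.IH by (cases "fst p"; cases "snd p"; simp; arith)
qed simp

lemma ptime_less [ptime_intros]:
  assumes "ptime f" "ptime g"
  shows "ptime (\<lambda>x. f x < (g x :: nat))"
proof -
  have "ptime (\<lambda>x. foldl (\<lambda>r p. if fst p = snd p then r else snd p) False
      (zip_bits (bits (f x) @ bits (g x)) (bits (f x)) (bits (g x))))"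
  proof (rule ptime_foldl_add[where k = 1])
    fix x :: 'a and r and p :: "bool \<times> bool"
    show "enc_size (if fst p = snd p then r else snd p) \<le> enc_size r + (enc_size x + enc_size p + 2) ^ 1"
      using enc_size_bool[of "snd p"] by auto
  qed (intro ptime_intros assms)+
  then show ?thesis by (simp add: less_bits val_zip_bits)
qed

text \<open>Horner's scheme from the most significant bit, with doubling as
  \<open>a + a\<close>.\<close>

lemma mult_eq_foldl: "m * n = foldl (\<lambda>a b. a + a + (if b then n else 0)) 0 (rev (bits m))"
proof -
  have "foldl (\<lambda>a b. a + a + (if b then n else 0)) 0 (rev bs) = val bs * n" for bs
    by (induction bs) (auto simp: algebra_simps)
  then show ?thesis by simp
qed

lemma ptime_times [ptime_intros]:
  assumes "ptime f" "ptime g"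
  shows "ptime (\<lambda>x. f x * g x :: nat)"
proof -
  have "ptime (\<lambda>x. (\<lambda>y. foldl (\<lambda>a b. a + a + (if b then snd y else 0)) 0 (rev (bits (fst y)))) (f x, g x))"
  proof (rule ptime_comp[OF ptime_Pair[OF assms]], rule ptime_foldl_measure[where \<mu> = bitlen and c = 2 and k = 1])
    fix y :: "nat \<times> nat" and a :: nat and b :: bool
    have "bitlen (a + a) \<le> bitlen a + 1" using bitlen_double[of a] by (simp add: mult_2)
    moreover have "bitlen (snd y) \<le> enc_size y" using bitlen_le_enc_size[of "snd y"] enc_size_snd[of y] by linarith
    ultimately show "bitlen (a + a + (if b then snd y else 0)) \<le> bitlen a + (enc_size y + enc_size b + 2) ^ 1"
      using bitlen_add[of "a + a" "snd y"] by auto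
  qed (intro ptime_intros enc_size_nat_le bitlen_le_enc_size)+
  then show ?thesis unfolding mult_eq_foldl by (simp cong: if_cong)
qed

lemma ptime_sum_list [ptime_intros]:
  assumes "ptime f"
  shows "ptime (\<lambda>x. sum_list (f x) :: nat)"
proof -
  have "ptime (\<lambda>x. foldl (\<lambda>a e. a + e) 0 (f x))"
  proof (rule ptime_foldl_measure[where \<mu> = bitlen and c = 2 and k = 1])
    fix x :: 'a and a e :: nat
    show "bitlen (a + e) \<le> bitlen a + (enc_size x + enc_size e + 2) ^ 1"
      using bitlen_add[of a e] bitlen_le_enc_size[of e] by simp
  qed (intro ptime_intros assms enc_size_nat_le bitlen_le_enc_size)+
  moreover have "foldl (\<lambda>a e. a + e) c xs = c + sum_list xs" for c :: nat and xs
    by (induction xs arbitrary: c) auto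
  ultimately show ?thesis by simp
qed

lemma ptime_prod_list [ptime_intros]:
  assumes "ptime f"
  shows "ptime (\<lambda>x. prod_list (f x) :: nat)"
proof -
  have "ptime (\<lambda>x. foldl (\<lambda>a e. e * a) 1 (f x))"
  proof (rule ptime_foldl_measure[where \<mu> = bitlen and c = 2 and k = 1])
    fix x :: 'a and a e :: nat
    show "bitlen (e * a) \<le> bitlen a + (enc_size x + enc_size e + 2) ^ 1"
      using bitlen_mult[of e a] bitlen_le_enc_size[of e] by simp
  qed (intro ptime_intros assms enc_size_nat_le bitlen_le_enc_size)+
  moreover have "foldl (\<lambda>a e. e * a) c xs = prod_list xs * c" for c :: nat and xs
    by (induction xs arbitrary: c) (auto simp: mult.assoc mult.left_commute)
  ultimately show ?thesis by simp
qed

lemma enumerate_eq_foldl: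
  "List.enumerate n xs = rev (snd (foldl (\<lambda>a e. (fst a + 1, (fst a, e) # snd a)) (n, []) xs))"
proof -
  have "snd (foldl (\<lambda>a e. (fst a + 1, (fst a, e) # snd a)) (n, zs) xs) = rev (List.enumerate n xs) @ zs" for zs
    by (induction xs arbitrary: n zs) auto
  then show ?thesis by simp
qed

lemma enc_size_enumerate: "enc_size (List.enumerate n xs) \<le> enc_size xs + length xs * (2 * (n + length xs) + 1)"
proof (induction xs arbitrary: n)
  case (Cons x xs)
  have "enc_size n \<le> 2 * (n + 1)" using enc_size_nat_le[of n] bitlen_le[of n "n + 1"] by simp
  then show ?case using Cons[of "Suc n"] by (simp add: algebra_simps)
qed simp

text \<open>Each new entry contains the counter, so the growth depends on the accumulator and the
  additive criteria do not apply; the accumulators are bounded directly by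
  \<open>enc_size_enumerate\<close>.\<close>

lemma ptime_enumerate [ptime_intros]:
  assumes "ptime f"
  shows "ptime (\<lambda>x. List.enumerate 0 (f x))"
proof -
  obtain a where a: "\<And>x. enc_size (f x) \<le> (enc_size x + 2) ^ a" using ptime_enc_size[OF assms] by blast
  define q where "q n = 10 * (n + 2) ^ a * (n + 2) ^ a + 10 * (n + 2) ^ a + 10" for n :: nat
  have pb: "poly_bounded q" unfolding q_def by (intro pb_intros)
  show ?thesis
    unfolding enumerate_eq_foldl
  proof (rule ptime_rev, rule ptime_snd, rule ptime_foldl[OF _ _ _ pb])
    fix x es1 es2
    assume "f x = es1 @ es2"
    then have le: "enc_size es1 \<le> (enc_size x + 2) ^ a" using a[of x] by simp
    let ?r = "foldl (\<lambda>a e. (fst a + 1, (fst a, e) # snd a)) (0 :: nat, []) es1"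
    have fst: "fst (foldl (\<lambda>a e. (fst a + 1, (fst a, e) # snd a)) (n, zs) xs) = n + length xs"
      for n :: nat and zs and xs :: "'b list"
      by (induction xs arbitrary: n zs) auto
    have snd: "snd ?r = rev (List.enumerate 0 es1)" by (simp add: enumerate_eq_foldl)
    have rev: "enc_size (rev zs) = enc_size zs" for zs :: "(nat \<times> 'b) list" by (induction zs) auto
    have l: "length es1 \<le> (enc_size x + 2) ^ a" using length_le_enc_size[of es1] le by linarith
    have "enc_size (length es1) \<le> 2 * (length es1 + 1)"
      using enc_size_nat_le[of "length es1"] bitlen_le[of "length es1" "length es1 + 1"] by simp
    moreover have "length es1 * (2 * length es1 + 1) \<le> (enc_size x + 2) ^ a * (2 * (enc_size x + 2) ^ a + 1)"
      using l by (intro mult_mono) auto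
    moreover have "?r = (length es1, rev (List.enumerate 0 es1))"
      by (rule prod_eqI) (simp_all only: fst snd add_0 prod.sel)
    then have "enc_size ?r = enc_size (length es1, rev (List.enumerate 0 es1))" by (rule arg_cong)
    then have "enc_size ?r = enc_size (length es1) + enc_size (List.enumerate 0 es1) + 1"
      using rev by simp
    ultimately show "enc_size ?r \<le> q (enc_size x)"
      using enc_size_enumerate[of 0 es1] l le unfolding q_def by (simp add: algebra_simps)
  qed (intro ptime_intros assms)+
qed

section \<open>Connectivity by cuts, components, and separate copies of P3\<close>

section \<open>Connectivity in terms of vertex sets\<close>

text \<open>Connectivity as the absence of empty cuts. Minimality arguments then apply directly to
  vertex sets, without walks.\<close>

definition conn :: "('a \<Rightarrow> 'a \<Rightarrow> bool) \<Rightarrow> 'a set \<Rightarrow> bool" where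
  "conn E S \<longleftrightarrow> S \<noteq> {} \<and> (\<forall>A\<subseteq>S. A \<noteq> {} \<longrightarrow> A \<noteq> S \<longrightarrow> (\<exists>a\<in>A. \<exists>b\<in>S - A. E a b))"

definition biconn :: "('a \<Rightarrow> 'a \<Rightarrow> bool) \<Rightarrow> 'a set \<Rightarrow> bool" where
  "biconn E S \<longleftrightarrow> 2 \<le> card S \<and> conn E S \<and> (\<forall>u\<in>S. conn E (S - {u}))"

definition comps :: "('a \<Rightarrow> 'a \<Rightarrow> bool) \<Rightarrow> 'a set \<Rightarrow> 'a set set" where
  "comps E X = {K. K \<subseteq> X \<and> conn E K \<and> (\<forall>a\<in>K. \<forall>b\<in>X - K. \<not> E a b)}"

definition bounded_core :: "('a \<Rightarrow> 'a \<Rightarrow> bool) \<Rightarrow> nat \<Rightarrow> nat \<Rightarrow> 'a set \<Rightarrow> bool" where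
  "bounded_core E m k X \<longleftrightarrow> (\<exists>W\<subseteq>X. card W \<le> k \<and> (\<forall>K\<in>comps E (X - W). card K \<le> m \<and>
     (\<forall>x\<in>K. \<forall>y\<in>K. x = y \<or> E x y) \<and>
     (\<forall>w\<in>W. \<forall>w'\<in>W. (\<exists>x\<in>K. E w x) \<longrightarrow> (\<exists>x\<in>K. E w' x) \<longrightarrow> w = w')))"

lemma conn_closed:
  assumes "conn E S" "S \<inter> K \<noteq> {}" "\<And>a b. a \<in> K \<Longrightarrow> b \<in> S - K \<Longrightarrow> \<not> E a b"
  shows "S \<subseteq> K"
proof (rule ccontr)
  assume "\<not> S \<subseteq> K"
  then have "S \<inter> K \<subseteq> S" "S \<inter> K \<noteq> S" by auto
  with assms(1,2) obtain a b where "a \<in> S \<inter> K" "b \<in> S - S \<inter> K" "E a b"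
    unfolding conn_def by meson
  with assms(3)[of a b] show False by auto
qed

lemma comps_eq:
  assumes "K \<in> comps E X" "L \<in> comps E X" "K \<inter> L \<noteq> {}"
  shows "K = L"
proof
  show "K \<subseteq> L" by (rule conn_closed[of E]) (use assms in \<open>auto simp: comps_def\<close>)
  show "L \<subseteq> K" by (rule conn_closed[of E]) (use assms in \<open>auto simp: comps_def\<close>)
qed

text \<open>
  R is meant to be reflexive (equal or adjacent), so that non-related elements are distinct and
  non-adjacent.
\<close>

primrec has_P3s :: "('a \<Rightarrow> 'a \<Rightarrow> bool) \<Rightarrow> nat \<Rightarrow> 'a set \<Rightarrow> bool" where
  "has_P3s R 0 S \<longleftrightarrow> True"
| "has_P3s R (Suc s) S \<longleftrightarrow> (\<exists>a\<in>S. \<exists>b\<in>S. \<exists>c\<in>S. R a b \<and> R b c \<and> \<not> R a c \<and>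
     has_P3s R s {u \<in> S. \<not> R u a \<and> \<not> R u b \<and> \<not> R u c})"

lemma has_P3s_mono: "has_P3s R s S \<Longrightarrow> S \<subseteq> T \<Longrightarrow> has_P3s R s T"
proof (induction s arbitrary: S T)
  case (Suc s)
  then obtain a b c where abc: "a \<in> S" "b \<in> S" "c \<in> S" "R a b" "R b c" "\<not> R a c"
    "has_P3s R s {u \<in> S. \<not> R u a \<and> \<not> R u b \<and> \<not> R u c}" by auto
  have "has_P3s R s {u \<in> T. \<not> R u a \<and> \<not> R u b \<and> \<not> R u c}"
    by (rule Suc.IH[OF abc(7)]) (use Suc.prems in auto)
  with abc Suc.prems show ?case by auto
qed simp

lemma has_P3sI:
  assumes "finite I"
    and "\<And>i. i \<in> I \<Longrightarrow> {a i, b i, c i} \<subseteq> S \<and> R (a i) (b i) \<and> R (b i) (c i) \<and> \<not> R (a i) (c i)"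
    and "\<And>i j x y. i \<in> I \<Longrightarrow> j \<in> I \<Longrightarrow> i \<noteq> j \<Longrightarrow> x \<in> {a i, b i, c i} \<Longrightarrow> y \<in> {a j, b j, c j} \<Longrightarrow> \<not> R x y"
  shows "has_P3s R (card I) S"
  using assms
proof (induction I arbitrary: S rule: finite_induct)
  case (insert i I)
  have "has_P3s R (card I) {u \<in> S. \<not> R u (a i) \<and> \<not> R u (b i) \<and> \<not> R u (c i)}"
  proof (rule insert.IH)
    fix j assume "j \<in> I"
    then have "j \<noteq> i" using insert.hyps by auto
    have "\<not> R x y" if "x \<in> {a j, b j, c j}" "y \<in> {a i, b i, c i}" for x y
      by (rule insert.prems(2)[of j i]) (use that \<open>j \<in> I\<close> \<open>j \<noteq> i\<close> in auto)
    then show "{a j, b j, c j} \<subseteq> {u \<in> S. \<not> R u (a i) \<and> \<not> R u (b i) \<and> \<not> R u (c i)} \<and>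
        R (a j) (b j) \<and> R (b j) (c j) \<and> \<not> R (a j) (c j)"
      using insert.prems(1)[of j] \<open>j \<in> I\<close> by auto
  next
    fix j k x y assume "j \<in> I" "k \<in> I" "j \<noteq> k" "x \<in> {a j, b j, c j}" "y \<in> {a k, b k, c k}"
    then show "\<not> R x y" by (intro insert.prems(2)[of j k]) auto
  qed
  then show ?case using insert.prems(1)[of i] insert.hyps by auto
qed simp

lemma has_P3sD:
  assumes "has_P3s R s S"
  obtains f :: "nat \<Rightarrow> nat \<Rightarrow> 'a"
  where "\<And>i j. i < s \<Longrightarrow> j < 3 \<Longrightarrow> f i j \<in> S"
    and "\<And>i. i < s \<Longrightarrow> R (f i 0) (f i 1) \<and> R (f i 1) (f i 2) \<and> \<not> R (f i 0) (f i 2)"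
    and "\<And>i j k l. i < j \<Longrightarrow> j < s \<Longrightarrow> k < 3 \<Longrightarrow> l < 3 \<Longrightarrow> \<not> R (f i k) (f j l)"
  using assms
proof (induction s arbitrary: S thesis)
  case 0
  show ?case by (rule 0(1)[of "\<lambda>_ _. undefined"]) auto
next
  case (Suc s)
  then obtain a b c where abc: "a \<in> S" "b \<in> S" "c \<in> S" "R a b" "R b c" "\<not> R a c"
    "has_P3s R s {u \<in> S. \<not> R u a \<and> \<not> R u b \<and> \<not> R u c}" by auto
  show ?case
  proof (rule Suc.IH[OF _ abc(7)])
    fix f :: "nat \<Rightarrow> nat \<Rightarrow> 'a"
    assume f: "\<And>i j. i < s \<Longrightarrow> j < 3 \<Longrightarrow> f i j \<in> {u \<in> S. \<not> R u a \<and> \<not> R u b \<and> \<not> R u c}"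
      "\<And>i. i < s \<Longrightarrow> R (f i 0) (f i 1) \<and> R (f i 1) (f i 2) \<and> \<not> R (f i 0) (f i 2)"
      "\<And>i j k l. i < j \<Longrightarrow> j < s \<Longrightarrow> k < 3 \<Longrightarrow> l < 3 \<Longrightarrow> \<not> R (f i k) (f j l)"
    \<comment> \<open>The P3 split off here receives the last index. The others avoid it in the form
      \<open>\<not> R u a\<close>, with the new vertex second, which is why the third property is
      claimed for \<open>i < j\<close> only: \<open>R\<close> need not be symmetric.\<close>
    define g where "g i = (if i = s then (\<lambda>j. if j = 0 then a else if j = 1 then b else c) else f i)"
      for i :: nat
    show thesis
    proof (rule Suc.prems(1)[of g])
      show "g i j \<in> S" if "i < Suc s" "j < 3" for i and j :: nat
        using f(1)[of i j] that abc by (auto simp: g_def)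
      show "R (g i 0) (g i 1) \<and> R (g i 1) (g i 2) \<and> \<not> R (g i 0) (g i 2)" if "i < Suc s" for i
        using f(2)[of i] that abc by (auto simp: g_def)
      show "\<not> R (g i k) (g j l)" if "i < j" "j < Suc s" "k < 3" "l < 3" for i j k l :: nat
        using f(3)[of i j k l] f(1)[of i k] that by (auto simp: g_def)
    qed
  qed
qed

section \<open>A bounded core by Ramsey's theorem\<close>

section \<open>The structure of sP3-free graphs with small blocks\<close>

locale simple_graph =
  fixes E :: "'a \<Rightarrow> 'a \<Rightarrow> bool"
  assumes adj_sym: "E x y \<Longrightarrow> E y x" and adj_irrefl: "\<not> E x x"
begin

abbreviation R :: "'a \<Rightarrow> 'a \<Rightarrow> bool" where "R x y \<equiv> x = y \<or> E x y"

definition small_biconn :: "nat \<Rightarrow> 'a set \<Rightarrow> bool" where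
  "small_biconn d X \<longleftrightarrow> (\<forall>S\<subseteq>X. biconn E S \<longrightarrow> card S \<le> d)"

text \<open>By symmetry an edge leaves a set if and only if one leaves its complement, so only the
  sets that avoid the root have to be tested.\<close>

lemma conn_rootI:
  assumes "r \<in> S" "\<And>A. A \<subseteq> S - {r} \<Longrightarrow> A \<noteq> {} \<Longrightarrow> \<exists>a\<in>A. \<exists>b\<in>S - A. E a b"
  shows "conn E S"
  unfolding conn_def
proof (intro conjI allI impI)
  show "S \<noteq> {}" using assms(1) by auto
next
  fix A assume A: "A \<subseteq> S" "A \<noteq> {}" "A \<noteq> S"
  show "\<exists>a\<in>A. \<exists>b\<in>S - A. E a b"
  proof (cases "r \<in> A")
    case False
    with A assms(2)[of A] show ?thesis by auto
  next
    case True
    with A assms(2)[of "S - A"] obtain a b where "a \<in> S - A" "b \<in> S - (S - A)" "E a b" by auto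
    with adj_sym[of a b] show ?thesis by auto
  qed
qed

lemma conn_cut:
  assumes "conn E S" "A \<subseteq> S" "A \<noteq> {}" "A \<noteq> S"
  obtains a b where "a \<in> A" "b \<in> S - A" "E a b"
  using assms unfolding conn_def by meson

lemma conn_insert:
  assumes "conn E S" "t \<in> S" "E t v"
  shows "conn E (insert v S)"
proof (rule conn_rootI[of v])
  fix A assume A: "A \<subseteq> insert v S - {v}" "A \<noteq> {}"
  show "\<exists>a\<in>A. \<exists>b\<in>insert v S - A. E a b"
  proof (cases "A = S")
    case True
    with assms A show ?thesis by auto
  next
    case False
    with A have "A \<subseteq> S" by auto
    from conn_cut[OF assms(1) this A(2) False] show ?thesis by blast
  qed
qed simp

lemma conn_star:
  assumes "\<And>K. K \<in> \<K> \<Longrightarrow> conn E K" "\<And>K. K \<in> \<K> \<Longrightarrow> \<exists>x\<in>K. E w x"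
  shows "conn E (insert w (\<Union>\<K>))"
proof (rule conn_rootI[of w])
  fix A assume A: "A \<subseteq> insert w (\<Union>\<K>) - {w}" "A \<noteq> {}"
  then obtain K x where K: "K \<in> \<K>" "x \<in> A" "x \<in> K" by blast
  show "\<exists>a\<in>A. \<exists>b\<in>insert w (\<Union>\<K>) - A. E a b"
  proof (cases "K \<subseteq> A")
    case True
    obtain y where "y \<in> K" "E w y" using assms(2) K by blast
    with True adj_sym[of w y] A show ?thesis by auto
  next
    case False
    then have "K \<inter> A \<subseteq> K" "K \<inter> A \<noteq> {}" "K \<inter> A \<noteq> K" using K by auto
    from conn_cut[OF assms(1)[OF K(1)] this] obtain a b where "a \<in> K \<inter> A" "b \<in> K - K \<inter> A" "E a b" .
    with K show ?thesis by blast
  qed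
qed simp

text \<open>The component of \<open>x\<close> is a smallest set around \<open>x\<close> that no edge
  leaves. If a part \<open>B\<close> without \<open>x\<close> had no edge to the rest, removing
  \<open>B\<close> would give a smaller such set.\<close>

lemma comps_cover:
  assumes "finite X" "x \<in> X"
  obtains K where "K \<in> comps E X" "x \<in> K"
proof -
  let ?P = "\<lambda>A. x \<in> A \<and> A \<subseteq> X \<and> (\<forall>a\<in>A. \<forall>b\<in>X - A. \<not> E a b)"
  have "?P X" using assms by auto
  from ex_has_least_nat[of ?P X card, OF this]
  obtain A where A: "?P A" "\<And>B. ?P B \<Longrightarrow> card A \<le> card B" by blast
  have "conn E A"
  proof (rule conn_rootI[of x])
    fix B assume B: "B \<subseteq> A - {x}" "B \<noteq> {}"
    show "\<exists>a\<in>B. \<exists>b\<in>A - B. E a b"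
    proof (rule ccontr)
      assume no: "\<not> ?thesis"
      have "?P (A - B)"
      proof (intro conjI ballI)
        fix a b assume "a \<in> A - B" "b \<in> X - (A - B)"
        then show "\<not> E a b" using A(1) no adj_sym[of a b] by blast
      qed (use A(1) B in auto)
      then have "card A \<le> card (A - B)" by (rule A(2))
      moreover have "finite A" using A(1) assms(1) finite_subset by auto
      then have "card (A - B) < card A" using B by (intro psubset_card_mono) auto
      ultimately show False by simp
    qed
  qed (use A in auto)
  then have "A \<in> comps E X" using A(1) by (auto simp: comps_def)
  with A(1) that show ?thesis by blast
qed

lemma biconn_clique:
  assumes "2 \<le> card S" "\<And>x y. x \<in> S \<Longrightarrow> y \<in> S \<Longrightarrow> R x y"
  shows "biconn E S"
proof -
  have c: "conn E T" if "T \<noteq> {}" "T \<subseteq> S" for T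
  proof -
    obtain r where r: "r \<in> T" using \<open>T \<noteq> {}\<close> by blast
    show ?thesis
    proof (rule conn_rootI[OF r])
      fix A assume A: "A \<subseteq> T - {r}" "A \<noteq> {}"
      then obtain a where "a \<in> A" by blast
      then have "E a r" using A r assms(2)[of a r] \<open>T \<subseteq> S\<close> by blast
      then show "\<exists>a\<in>A. \<exists>b\<in>T - A. E a b" using \<open>a \<in> A\<close> A r by blast
    qed
  qed
  have "finite S" using assms(1) card.infinite by fastforce
  have "S - {u} \<noteq> {}" for u
  proof
    assume "S - {u} = {}"
    then have "card S \<le> card {u}" by (intro card_mono) auto
    with assms(1) show False by simp
  qed
  then show ?thesis unfolding biconn_def using assms(1) c by auto
qed

text \<open>S is a minimal connected subset of Q that contains all neighbours of v.\<close>

lemma biconn_attach: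
  assumes "finite Q" "conn E Q" "v \<notin> Q" "x \<in> Q" "E v x"
  obtains S where "{x\<in>Q. E v x} \<subseteq> S" "S \<subseteq> Q" "biconn E (insert v S)"
proof -
  let ?T = "{x\<in>Q. E v x}"
  let ?P = "\<lambda>A. ?T \<subseteq> A \<and> A \<subseteq> Q \<and> conn E A"
  have "?P Q" using assms by auto
  from ex_has_least_nat[of ?P Q card, OF this]
  obtain S where S: "?P S" "\<And>B. ?P B \<Longrightarrow> card S \<le> card B" by blast
  have xS: "x \<in> S" using S assms by auto
  have fS: "finite S" using S assms(1) finite_subset by auto
  have vS: "v \<notin> S" using S assms by auto
  have c1: "conn E (insert v S)" by (rule conn_insert[of S x]) (use S xS assms adj_sym in auto)
  have "conn E (insert v S - {u})" if "u \<in> S" for u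
  proof (rule conn_rootI[of v])
    show "v \<in> insert v S - {u}" using that vS by auto
    fix A assume A: "A \<subseteq> insert v S - {u} - {v}" "A \<noteq> {}"
    show "\<exists>a\<in>A. \<exists>b\<in>insert v S - {u} - A. E a b"
    proof (rule ccontr)
      assume no: "\<not> ?thesis"
      then have noT: "a \<notin> ?T" if "a \<in> A" for a
        using that A adj_sym[of v a] \<open>v \<in> insert v S - {u}\<close> by blast
      \<comment> \<open>A part \<open>A\<close> that \<open>u\<close> cuts off contains no neighbour
        of \<open>v\<close>, and no edge joins it to \<open>S - A - {u}\<close>. Hence
        \<open>S - A\<close> is still connected, contains all neighbours of \<open>v\<close> and
        contradicts the minimality of \<open>S\<close>.\<close>
      have "?P (S - A)"
      proof (intro conjI)
        show "?T \<subseteq> S - A" using noT S by blast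
        show "S - A \<subseteq> Q" using S by auto
        show "conn E (S - A)"
        proof (rule conn_rootI[of u])
          show "u \<in> S - A" using that A by auto
          fix P assume P: "P \<subseteq> S - A - {u}" "P \<noteq> {}"
          then have "P \<subseteq> S" "P \<noteq> S" using that by auto
          then obtain a b where ab: "a \<in> P" "b \<in> S - P" "E a b"
            using conn_cut[of S P] S P(2) by blast
          have "b \<notin> A"
          proof
            assume "b \<in> A"
            moreover have "a \<in> insert v S - {u} - A" using ab(1) P by auto
            ultimately show False using no adj_sym[OF ab(3)] by blast
          qed
          then show "\<exists>a\<in>P. \<exists>b\<in>S - A - P. E a b" using ab by blast
        qed
      qed
      then have "card S \<le> card (S - A)" by (rule S(2))
      moreover have "card (S - A) < card S" using A fS by (intro psubset_card_mono) auto
      ultimately show False by simp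
    qed
  qed
  moreover have "conn E (insert v S - {v})" using S vS by (simp add: insert_Diff_if)
  moreover have "2 \<le> card (insert v S)"
    using fS vS xS by (simp add: Suc_le_eq card_gt_0_iff) blast
  ultimately have "biconn E (insert v S)" unfolding biconn_def using c1 by auto
  with S that show ?thesis by blast
qed

text \<open>By \<open>biconn_attach\<close> the neighbours of \<open>v\<close> in \<open>Q\<close>
  all lie with \<open>v\<close> in one biconnected set, which has at most \<open>d\<close>
  vertices.\<close>

lemma card_nbrs_conn:
  assumes "small_biconn d X" "finite X" "Q \<subseteq> X" "v \<in> X" "conn E Q" "v \<notin> Q"
  shows "card {x\<in>Q. E v x} \<le> d"
proof (cases "{x\<in>Q. E v x} = {}")
  case False
  have fQ: "finite Q" using assms finite_subset by auto
  from False obtain x where "x \<in> Q" "E v x" by blast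
  from biconn_attach[OF fQ assms(5,6) this] obtain S where
    S: "{x\<in>Q. E v x} \<subseteq> S" "S \<subseteq> Q" "biconn E (insert v S)" .
  have "finite S" using S fQ finite_subset by auto
  then have "card {x\<in>Q. E v x} \<le> card (insert v S)" using S by (intro card_mono) auto
  also have "\<dots> \<le> d" using assms S unfolding small_biconn_def by auto
  finally show ?thesis .
next
  case True
  show ?thesis unfolding True by simp
qed

abbreviation dirs :: "'a set \<Rightarrow> 'a \<Rightarrow> 'a set set" where
  "dirs X v \<equiv> {K \<in> comps E (X - {v}). \<exists>x\<in>K. E v x}"

lemma finite_comps: "finite X \<Longrightarrow> finite (comps E X)"
  by (rule finite_subset[of _ "Pow X"]) (auto simp: comps_def)

text \<open>By \<open>card_nbrs_conn\<close> each component contains at most \<open>d\<close>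
  neighbours, so a large degree forces many components of \<open>X - {v}\<close> adjacent to
  \<open>v\<close>.\<close>

lemma card_nbrs_dirs:
  assumes "small_biconn d X" "finite X" "v \<in> X"
  shows "card {x\<in>X. E v x} \<le> d * card (dirs X v)"
proof -
  have fin: "finite (dirs X v)" using finite_comps[of "X - {v}"] assms by auto
  have "{x\<in>X. E v x} \<subseteq> (\<Union>K\<in>dirs X v. {x\<in>K. E v x})"
  proof
    fix x assume x: "x \<in> {x\<in>X. E v x}"
    then have "x \<in> X - {v}" using adj_irrefl by auto
    then obtain K where "K \<in> comps E (X - {v})" "x \<in> K"
      using comps_cover[of "X - {v}"] assms(2) by blast
    with x show "x \<in> (\<Union>K\<in>dirs X v. {x\<in>K. E v x})" by auto
  qed
  moreover have "finite (\<Union>K\<in>dirs X v. {x\<in>K. E v x})"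
    by (rule finite_subset[OF _ assms(2)]) (auto simp: comps_def)
  ultimately have "card {x\<in>X. E v x} \<le> card (\<Union>K\<in>dirs X v. {x\<in>K. E v x})" by (rule card_mono[rotated])
  also have "\<dots> \<le> (\<Sum>K\<in>dirs X v. card {x\<in>K. E v x})" by (rule card_UN_le[OF fin])
  also have "\<dots> \<le> (\<Sum>K\<in>dirs X v. d)"
    by (intro sum_mono card_nbrs_conn[OF assms(1,2)]) (use assms(3) in \<open>auto simp: comps_def\<close>)
  finally show ?thesis by (simp add: mult.commute)
qed

text \<open>\<open>insert v K\<close> is connected and avoids \<open>v'\<close>, so it lies in a
  single component of \<open>X - {v'}\<close>, which is not \<open>K'\<close> because
  \<open>v\<close> is outside \<open>K'\<close>. Distinct components are non-adjacent.\<close>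

lemma private_dirs_anticomplete:
  assumes "v \<in> X" "v' \<in> X" "v \<noteq> v'" "K \<in> dirs X v" "v' \<notin> K" "K' \<in> dirs X v'" "v \<notin> K'"
    and "x \<in> insert v K" "y \<in> K'"
  shows "\<not> R x y"
proof -
  obtain t where "t \<in> K" "E v t" using assms(4) by blast
  then have c: "conn E (insert v K)"
    using assms(4) adj_sym[of v t] by (intro conn_insert[of K t]) (auto simp: comps_def)
  have sub: "insert v K \<subseteq> X - {v'}" using assms by (auto simp: comps_def)
  have cl: "\<And>a b. a \<in> K' \<Longrightarrow> b \<in> X - {v'} - K' \<Longrightarrow> \<not> E a b" using assms(6) by (auto simp: comps_def)
  have "insert v K \<inter> K' = {}"
    using conn_closed[OF c, of K'] cl sub assms(7) by blast
  then have "x \<in> X - {v'} - K'" using assms(8) sub by auto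
  then show ?thesis using cl[of y x] adj_sym[of x y] assms(9) by auto
qed

text \<open>Here \<open>q\<close> is a Ramsey number. The threshold \<open>d * q\<close> yields more
  than \<open>q\<close> components at each of \<open>q\<close> chosen vertices. At most
  \<open>q - 1\<close> of them contain another chosen vertex, so at least two are free of chosen
  vertices; they supply the ends of the P3 around \<open>v\<close>.\<close>

lemma few_high_degree:
  assumes "small_biconn d X" "finite X" "\<not> has_P3s R s X"
    and ram: "\<And>(V :: 'a set) F. finite V \<and> card V \<ge> q \<Longrightarrow>
      \<exists>A\<subseteq>V. card A = d + 2 \<and> clique A F \<or> card A = s \<and> indep A F"
    and "q \<ge> 1"
  shows "card {v\<in>X. card {x\<in>X. E v x} > d * q} < q"
proof (rule ccontr)
  assume "\<not> ?thesis"
  then have "q \<le> card {v\<in>X. card {x\<in>X. E v x} > d * q}" by (simp only: not_less)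
  then obtain W where W: "W \<subseteq> {v\<in>X. card {x\<in>X. E v x} > d * q}" "card W = q"
    by (rule obtain_subset_with_card_n)
  have fW: "finite W" using W assms(2) finite_subset[of W X] by auto
  have WX: "W \<subseteq> X" using W by auto
  have ex: "\<exists>K L. K \<in> dirs X v \<and> L \<in> dirs X v \<and> K \<noteq> L \<and> K \<inter> W = {} \<and> L \<inter> W = {}" if v: "v \<in> W" for v
  proof -
    have fin: "finite (dirs X v)" using finite_comps[of "X - {v}"] assms by auto
    have "v \<in> X" "d * q < card {x\<in>X. E v x}" using W(1) v by auto
    then have "d * q < d * card (dirs X v)"
      using card_nbrs_dirs[OF assms(1,2)] by (meson less_le_trans)
    then have big: "q < card (dirs X v)" by simp
    let ?M = "{K \<in> dirs X v. K \<inter> W \<noteq> {}}"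
    let ?f = "\<lambda>w. SOME K. K \<in> comps E (X - {v}) \<and> w \<in> K"
    have "?M \<subseteq> ?f ` (W - {v})"
    proof
      fix K assume K: "K \<in> ?M"
      then obtain w where w: "w \<in> K" "w \<in> W" by blast
      have KC: "K \<in> comps E (X - {v})" using K by auto
      have f: "?f w \<in> comps E (X - {v}) \<and> w \<in> ?f w" by (rule someI[of _ K]) (use KC w in auto)
      have "?f w = K" by (rule comps_eq[OF _ KC]) (use f w in auto)
      moreover have "w \<noteq> v" using KC w by (auto simp: comps_def)
      ultimately show "K \<in> ?f ` (W - {v})" using w by blast
    qed
    then have "card ?M \<le> card (W - {v})" using fW by (meson card_image_le card_mono finite_Diff finite_imageI order_trans)
    also have "\<dots> = q - 1" using W(2) v fW by simp
    finally have "card ?M \<le> q - 1" .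
    moreover have "card (dirs X v - ?M) = card (dirs X v) - card ?M"
      by (rule card_Diff_subset) (auto intro: finite_subset[OF _ fin])
    ultimately have "\<not> card (dirs X v - ?M) \<le> Suc 0" using big \<open>q \<ge> 1\<close> by linarith
    then obtain K L where "K \<in> dirs X v - ?M" "L \<in> dirs X v - ?M" "K \<noteq> L"
      using fin by (subst (asm) card_le_Suc0_iff_eq) auto
    then show ?thesis by blast
  qed
  then have "\<exists>K. \<forall>v\<in>W. \<exists>L. K v \<in> dirs X v \<and> L \<in> dirs X v \<and> K v \<noteq> L \<and> K v \<inter> W = {} \<and> L \<inter> W = {}"
    by (intro bchoice) blast
  then obtain K where "\<forall>v\<in>W. \<exists>L. K v \<in> dirs X v \<and> L \<in> dirs X v \<and> K v \<noteq> L \<and> K v \<inter> W = {} \<and> L \<inter> W = {}"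
    by blast
  from bchoice[OF this] obtain L
    where KL: "\<And>v. v \<in> W \<Longrightarrow> K v \<in> dirs X v \<and> L v \<in> dirs X v \<and> K v \<noteq> L v \<and> K v \<inter> W = {} \<and> L v \<inter> W = {}"
    by blast
  have "\<forall>v\<in>W. \<exists>x. x \<in> K v \<and> E v x" "\<forall>v\<in>W. \<exists>x. x \<in> L v \<and> E v x" using KL by blast+
  from this[THEN bchoice] obtain a b
    where ab: "\<And>v. v \<in> W \<Longrightarrow> a v \<in> K v \<and> E v (a v) \<and> b v \<in> L v \<and> E v (b v)" by blast
  define F where "F = {{x, y} | x y. E x y}"
  obtain A where A: "A \<subseteq> W" "card A = d + 2 \<and> clique A F \<or> card A = s \<and> indep A F"
    using ram[of W F] fW W(2) by auto
  have edge: "{x, y} \<in> F \<longleftrightarrow> E x y" for x y using adj_sym by (auto simp: F_def doubleton_eq_iff)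
  \<comment> \<open>The clique size \<open>d + 2\<close> rather than \<open>d + 1\<close> guarantees
    at least two vertices, as biconnectivity requires, also for \<open>d = 0\<close>.\<close>
  have "\<not> (card A = d + 2 \<and> clique A F)"
  proof
    assume h: "card A = d + 2 \<and> clique A F"
    then have "R x y" if "x \<in> A" "y \<in> A" for x y
      using that edge[of x y] unfolding clique_def by blast
    with h have "biconn E A" by (intro biconn_clique) simp_all
    moreover have "A \<subseteq> X" using A(1) WX by blast
    ultimately have "card A \<le> d" using assms(1) unfolding small_biconn_def by blast
    with h show False by simp
  qed
  then have AI: "card A = s" "indep A F" using A by auto
  have "has_P3s R (card A) X"
  proof (rule has_P3sI[of A a id b])
    show "finite A" using A fW finite_subset by auto
  next
    fix v assume "v \<in> A"
    then have v: "v \<in> W" using A by auto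
    have comp: "K v \<in> comps E (X - {v})" "L v \<in> comps E (X - {v})" "K v \<inter> L v = {}"
      using KL[OF v] comps_eq[of "K v" E "X - {v}" "L v"] by auto
    have "b v \<in> X - {v} - K v" using ab[OF v] comp by (auto simp: comps_def)
    then have "\<not> R (a v) (b v)" using ab[OF v] comp by (auto simp: comps_def)
    then show "{a v, id v, b v} \<subseteq> X \<and> R (a v) (id v) \<and> R (id v) (b v) \<and> \<not> R (a v) (b v)"
      using ab[OF v] comp v WX adj_sym by (auto simp: comps_def)
  next
    fix v v' x y assume h: "v \<in> A" "v' \<in> A" "v \<noteq> v'" "x \<in> {a v, id v, b v}" "y \<in> {a v', id v', b v'}"
    then have v: "v \<in> W" "v' \<in> W" using A by auto
    have nE: "\<not> E v v'" using AI(2) h edge unfolding indep_def by blast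
    have pr: "\<not> R p r" if "u \<in> W" "u' \<in> W" "u \<noteq> u'" "M = K u \<or> M = L u" "M' = K u' \<or> M' = L u'"
      "p \<in> insert u M" "r \<in> M'" for u u' M M' p r
      by (rule private_dirs_anticomplete[of u X u' M M']) (use that KL[of u] KL[of u'] WX in auto)
    have sR: "R p r \<Longrightarrow> R r p" for p r using adj_sym by auto
    \<comment> \<open>Independence of \<open>A\<close> settles the two middles; in every other pair
      at least one vertex is an end of its P3, and \<open>pr\<close> applies in one of the two
      orders.\<close>
    consider "y = v'" "x = v" | "y = a v'" | "y = b v'" | "y = v'" "x = a v" | "y = v'" "x = b v" using h by auto
    then show "\<not> R x y"
    proof cases
      case 1
      then show ?thesis using nE h by auto
    next
      case 2
      have "\<exists>M. (M = K v \<or> M = L v) \<and> x \<in> insert v M" using h(4) ab[OF v(1)] by auto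
      then show ?thesis using pr[of v v' _ "K v'" x y] v h(3) ab[OF v(2)] 2 by blast
    next
      case 3
      have "\<exists>M. (M = K v \<or> M = L v) \<and> x \<in> insert v M" using h(4) ab[OF v(1)] by auto
      then show ?thesis using pr[of v v' _ "L v'" x y] v h(3) ab[OF v(2)] 3 by blast
    next
      case 4
      then show ?thesis using pr[of v' v "K v'" "K v" y x] v h(3) ab[OF v(1)] sR by blast
    next
      case 5
      then show ?thesis using pr[of v' v "K v'" "L v" y x] v h(3) ab[OF v(1)] sR by blast
    qed
  qed
  with AI assms(3) show False by simp
qed

text \<open>A failure of transitivity of \<open>R\<close> is an induced P3, because equal vertices
  cannot violate it. Its closed neighbourhood has at most \<open>3 * (D + 1)\<close> vertices, and
  outside of it one P3 less is available, which gives the factor \<open>s\<close>.\<close>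

lemma bounded_degree_P3_hitting:
  assumes "finite X" "\<And>v. v \<in> X \<Longrightarrow> card {x\<in>X. E v x} \<le> D" "\<not> has_P3s R s X"
  shows "\<exists>N\<subseteq>X. card N \<le> s * (3 * (D + 1)) \<and>
    (\<forall>a\<in>X - N. \<forall>b\<in>X - N. \<forall>c\<in>X - N. R a b \<longrightarrow> R b c \<longrightarrow> R a c)"
  using assms
proof (induction s arbitrary: X)
  case (Suc s)
  show ?case
  proof (cases "\<forall>a\<in>X. \<forall>b\<in>X. \<forall>c\<in>X. R a b \<longrightarrow> R b c \<longrightarrow> R a c")
    case True
    then show ?thesis by (intro exI[of _ "{}"]) auto
  next
    case False
    then obtain a b c where abc: "a \<in> X" "b \<in> X" "c \<in> X" "R a b" "R b c" "\<not> R a c" by blast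
    define Y where "Y = {u \<in> X. \<not> R u a \<and> \<not> R u b \<and> \<not> R u c}"
    have "\<not> has_P3s R s Y" using Suc.prems(3) abc unfolding Y_def by auto
    moreover have "card {x\<in>Y. E v x} \<le> D" if "v \<in> Y" for v
    proof -
      have "card {x\<in>Y. E v x} \<le> card {x\<in>X. E v x}"
        using Suc.prems(1) by (intro card_mono) (auto simp: Y_def)
      then show ?thesis using Suc.prems(2)[of v] that by (auto simp: Y_def)
    qed
    moreover have "finite Y" using Suc.prems(1) by (simp add: Y_def)
    ultimately obtain N where N: "N \<subseteq> Y" "card N \<le> s * (3 * (D + 1))"
      "\<forall>a\<in>Y - N. \<forall>b\<in>Y - N. \<forall>c\<in>Y - N. R a b \<longrightarrow> R b c \<longrightarrow> R a c"
      using Suc.IH[of Y] by blast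
    have nb: "card {u\<in>X. R u z} \<le> D + 1" if "z \<in> X" for z
    proof -
      have "{u\<in>X. R u z} \<subseteq> insert z {x\<in>X. E z x}" using adj_sym by auto
      then have "card {u\<in>X. R u z} \<le> card (insert z {x\<in>X. E z x})"
        using Suc.prems(1) by (intro card_mono) auto
      also have "\<dots> \<le> D + 1" using Suc.prems(2)[OF that] card_insert_le_m1[of "D + 1"]
        by (simp add: card_insert_if Suc.prems(1))
      finally show ?thesis .
    qed
    have "X - Y = {u\<in>X. R u a} \<union> ({u\<in>X. R u b} \<union> {u\<in>X. R u c})" by (auto simp: Y_def)
    then have "card (X - Y) \<le> card {u\<in>X. R u a} + (card {u\<in>X. R u b} + card {u\<in>X. R u c})"
      by (metis (no_types, lifting) card_Un_le add_left_mono order_trans)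
    also have "\<dots> \<le> 3 * (D + 1)" using nb[OF abc(1)] nb[OF abc(2)] nb[OF abc(3)] by simp
    finally have "card (X - Y) \<le> 3 * (D + 1)" .
    then have "card (N \<union> (X - Y)) \<le> Suc s * (3 * (D + 1))"
      using N(2) card_Un_le[of N "X - Y"] by simp
    moreover have eq: "X - (N \<union> (X - Y)) = Y - N" by (auto simp: Y_def)
    moreover have "N \<union> (X - Y) \<subseteq> X" using N(1) by (auto simp: Y_def)
    moreover note N(3)[folded eq]
    ultimately show ?thesis by (intro exI[of _ "N \<union> (X - Y)"] conjI)
  qed
qed simp

text \<open>In \<open>k1\<close> the first summand bounds the vertices of degree above
  \<open>d * q\<close>, and the second is \<open>bounded_degree_P3_hitting\<close> with
  \<open>D = d * q\<close>. Each of at most \<open>k1 * k1\<close> pairs of core vertices has at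
  most \<open>d\<close> components adjacent to both, and each of these has at most
  \<open>d + 1\<close> vertices.\<close>

lemma structure_bound:
  assumes "small_biconn d X" "finite X" "\<not> has_P3s R s X"
    and ram: "\<And>(V :: 'a set) F. finite V \<and> card V \<ge> q \<Longrightarrow>
      \<exists>A\<subseteq>V. card A = d + 2 \<and> clique A F \<or> card A = s \<and> indep A F"
    and "q \<ge> 1" and k1: "k1 = q + s * (3 * (d * q + 1))"
  shows "bounded_core E (d + 1) (k1 + k1 * k1 * (d * (d + 1))) X"
proof -
  define W0 where "W0 = {v\<in>X. card {x\<in>X. E v x} > d * q}"
  have W0: "card W0 < q" unfolding W0_def by (rule few_high_degree[OF assms(1-5)])
  have "\<not> has_P3s R s (X - W0)" using assms(3) has_P3s_mono[of R s "X - W0" X] by auto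
  moreover have "card {x\<in>X - W0. E v x} \<le> d * q" if "v \<in> X - W0" for v
  proof -
    have "card {x\<in>X - W0. E v x} \<le> card {x\<in>X. E v x}" using assms(2) by (intro card_mono) auto
    also have "\<dots> \<le> d * q" using that by (auto simp: W0_def)
    finally show ?thesis .
  qed
  ultimately obtain N where N: "N \<subseteq> X - W0" "card N \<le> s * (3 * (d * q + 1))"
    "\<forall>a\<in>X - W0 - N. \<forall>b\<in>X - W0 - N. \<forall>c\<in>X - W0 - N. R a b \<longrightarrow> R b c \<longrightarrow> R a c"
    using bounded_degree_P3_hitting[of "X - W0" "d * q" s] assms(2) by auto
  define W1 where "W1 = W0 \<union> N"
  have W1X: "W1 \<subseteq> X" using N by (auto simp: W1_def W0_def)
  then have fW1: "finite W1" using assms(2) finite_subset by auto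
  have cW1: "card W1 \<le> k1" using card_Un_le[of W0 N] W0 N(2) k1 by (simp add: W1_def)
  have XW1: "X - W1 = X - W0 - N" by (auto simp: W1_def)
  have clique: "R x y" if K: "K \<in> comps E (X - W1)" and "x \<in> K" "y \<in> K" for K x y
  proof -
    have KX: "K \<subseteq> X - W1" "conn E K" using K by (auto simp: comps_def)
    have "K \<subseteq> {z\<in>K. R x z}"
    proof (rule conn_closed[OF KX(2)])
      show "K \<inter> {z \<in> K. R x z} \<noteq> {}" using \<open>x \<in> K\<close> by auto
      fix a b assume ab: "a \<in> {z\<in>K. R x z}" "b \<in> K - {z\<in>K. R x z}"
      show "\<not> E a b"
      proof
        assume "E a b"
        moreover have "x \<in> X - W0 - N" "a \<in> X - W0 - N" "b \<in> X - W0 - N"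
          using KX(1) ab \<open>x \<in> K\<close> unfolding XW1 by auto
        ultimately have "R x b" using N(3) ab by blast
        then show False using ab by auto
      qed
    qed
    then show ?thesis using \<open>y \<in> K\<close> by auto
  qed
  \<comment> \<open>A component with at least two vertices is a biconnected clique and has at most
    \<open>d\<close> vertices. The bound \<open>d + 1\<close> admits single vertices even if
    \<open>d = 0\<close>.\<close>
  have cK: "card K \<le> d + 1" if K: "K \<in> comps E (X - W1)" for K
  proof (rule ccontr)
    assume big: "\<not> ?thesis"
    show False
    proof (cases "2 \<le> card K")
      case True
      then have "biconn E K" using biconn_clique clique[OF K] by blast
      moreover have "K \<subseteq> X" using K by (auto simp: comps_def)
      ultimately have "card K \<le> d" using assms(1) unfolding small_biconn_def by blast
      with big show False by simp
    qed (use big in simp)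
  qed
  define bad where "bad p = {K \<in> comps E (X - W1). (\<exists>x\<in>K. E (fst p) x) \<and> (\<exists>x\<in>K. E (snd p) x)}" for p
  \<comment> \<open>Joining \<open>snd p\<close> with all components attached to both vertices gives
    a connected set \<open>Q\<close> without \<open>fst p\<close>, and \<open>fst p\<close> has a
    neighbour in each of these disjoint components. So \<open>card_nbrs_conn\<close> bounds their
    number.\<close>
  have card_bad: "card (bad p) \<le> d" if p: "p \<in> W1 \<times> W1" "fst p \<noteq> snd p" for p
  proof -
    define Q where "Q = insert (snd p) (\<Union>(bad p))"
    have c: "conn E Q" unfolding Q_def
      by (rule conn_star) (auto simp: bad_def comps_def)
    have QX: "Q \<subseteq> X" using p W1X by (auto simp: Q_def bad_def comps_def)
    have nQ: "fst p \<notin> Q" using p by (auto simp: Q_def bad_def comps_def)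
    have "\<forall>K\<in>bad p. \<exists>x. x \<in> K \<and> E (fst p) x" by (auto simp: bad_def)
    then obtain g where g: "\<And>K. K \<in> bad p \<Longrightarrow> g K \<in> K \<and> E (fst p) (g K)" by metis
    have "inj_on g (bad p)"
    proof (rule inj_onI)
      fix K L assume h: "K \<in> bad p" "L \<in> bad p" "g K = g L"
      then have "g K \<in> K \<inter> L" using g[of K] g[of L] by auto
      then show "K = L" using comps_eq[of K E "X - W1" L] h by (auto simp: bad_def)
    qed
    then have "card (bad p) = card (g ` bad p)" by (simp add: card_image)
    also have "\<dots> \<le> card {x\<in>Q. E (fst p) x}"
    proof (rule card_mono)
      show "finite {x\<in>Q. E (fst p) x}" using finite_subset[OF QX assms(2)] by auto
      show "g ` bad p \<subseteq> {x\<in>Q. E (fst p) x}" using g by (auto simp: Q_def)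
    qed
    also have "\<dots> \<le> d" using card_nbrs_conn[OF assms(1,2) QX _ c nQ] p W1X by auto
    finally show ?thesis .
  qed
  define B where "B = (\<Union>p\<in>{p\<in>W1 \<times> W1. fst p \<noteq> snd p}. bad p)"
  have BC: "B \<subseteq> comps E (X - W1)" by (auto simp: B_def bad_def)
  have finP: "finite {p\<in>W1 \<times> W1. fst p \<noteq> snd p}" using fW1 by auto
  have "card B \<le> (\<Sum>p\<in>{p\<in>W1 \<times> W1. fst p \<noteq> snd p}. card (bad p))"
    unfolding B_def by (rule card_UN_le[OF finP])
  also have "\<dots> \<le> (\<Sum>p\<in>{p\<in>W1 \<times> W1. fst p \<noteq> snd p}. d)"
    by (rule sum_mono) (use card_bad in auto)
  also have "\<dots> = card {p\<in>W1 \<times> W1. fst p \<noteq> snd p} * d" by simp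
  also have "card {p\<in>W1 \<times> W1. fst p \<noteq> snd p} \<le> card (W1 \<times> W1)" using fW1 by (intro card_mono) auto
  also have "card (W1 \<times> W1) \<le> k1 * k1" unfolding card_cartesian_product by (intro mult_mono cW1) auto
  finally have cB: "card B \<le> k1 * k1 * d" by (simp add: mult_right_mono)
  have "card (\<Union>B) \<le> (\<Sum>K\<in>B. card K)" by (rule card_Union_le_sum_card)
  also have "\<dots> \<le> (\<Sum>K\<in>B. d + 1)" by (rule sum_mono) (use cK BC in auto)
  also have "\<dots> = card B * (d + 1)" by simp
  also have "\<dots> \<le> k1 * k1 * d * (d + 1)" using cB by (rule mult_right_mono) simp
  finally have cUB: "card (\<Union>B) \<le> k1 * k1 * d * (d + 1)" .
  define W2 where "W2 = W1 \<union> \<Union>B"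
  have W2X: "W2 \<subseteq> X" using W1X BC by (auto simp: W2_def comps_def)
  have "card W2 \<le> k1 + k1 * k1 * (d * (d + 1))"
    using card_Un_le[of W1 "\<Union>B"] cW1 cUB unfolding W2_def mult.assoc by linarith
  moreover have "card K \<le> d + 1 \<and> (\<forall>x\<in>K. \<forall>y\<in>K. R x y) \<and>
      (\<forall>w\<in>W2. \<forall>w'\<in>W2. (\<exists>x\<in>K. E w x) \<longrightarrow> (\<exists>x\<in>K. E w' x) \<longrightarrow> w = w')"
    if K: "K \<in> comps E (X - W2)" for K
  proof -
    have K': "K \<subseteq> X - W2" "conn E K" "\<And>a b. a \<in> K \<Longrightarrow> b \<in> X - W2 - K \<Longrightarrow> \<not> E a b"
      using K by (auto simp: comps_def)
    \<comment> \<open>\<open>W2\<close> arises from \<open>W1\<close> by adding entire components,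
      so the components that remain are unchanged.\<close>
    have KC: "K \<in> comps E (X - W1)"
      unfolding comps_def
    proof (intro CollectI conjI ballI)
      show "K \<subseteq> X - W1" using K' by (auto simp: W2_def)
      show "conn E K" by (rule K')
      fix a b assume a: "a \<in> K" and b: "b \<in> X - W1 - K"
      show "\<not> E a b"
      proof (cases "b \<in> \<Union>B")
        case True
        then obtain L where L: "L \<in> B" "b \<in> L" by blast
        have "a \<in> X - W1 - L" using a K'(1) L by (auto simp: W2_def)
        then have "\<not> E b a" using L BC by (auto simp: comps_def)
        then show ?thesis using adj_sym by blast
      next
        case False
        then show ?thesis using K'(3)[OF a, of b] b by (auto simp: W2_def)
      qed
    qed
    have KB: "K \<notin> B" using K'(1,2) by (auto simp: W2_def conn_def)
    have "w = w'" if w: "w \<in> W2" "w' \<in> W2" "\<exists>x\<in>K. E w x" "\<exists>x\<in>K. E w' x" for w w'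
    proof (rule ccontr)
      assume ne: "w \<noteq> w'"
      have in1: "u \<in> W1" if u: "u \<in> W2" "\<exists>x\<in>K. E u x" for u
      proof (rule ccontr)
        assume "u \<notin> W1"
        moreover have "u \<notin> K" using u(1) K'(1) by auto
        ultimately have "u \<in> X - W1 - K" using u(1) W2X by auto
        moreover obtain x where "x \<in> K" "E u x" using u(2) by blast
        moreover have "\<forall>a\<in>K. \<forall>b\<in>X - W1 - K. \<not> E a b" using KC by (simp add: comps_def)
        ultimately show False using adj_sym by blast
      qed
      have "K \<in> bad (w, w')" using KC w by (auto simp: bad_def)
      then have "K \<in> B" using in1[of w] in1[of w'] w ne by (auto simp: B_def)
      with KB show False by simp
    qed
    then show ?thesis using cK[OF KC] clique[OF KC] by blast
  qed
  ultimately show ?thesis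
    unfolding bounded_core_def using W2X by (intro exI[of _ W2] conjI ballI) auto
qed

end

text \<open>The Ramsey number \<open>q\<close> is fixed before \<open>E\<close> and
  \<open>X\<close>, so one \<open>k\<close> serves all graphs on the given vertex type. The
  algorithm guesses that many vertices, which makes \<open>k\<close> an exponent of its running
  time.\<close>

theorem structure_theorem:
  fixes s d :: nat
  obtains k :: nat where "\<And>(E :: 'a \<Rightarrow> 'a \<Rightarrow> bool) X. simple_graph E \<Longrightarrow> finite X \<Longrightarrow>
    \<not> has_P3s (\<lambda>x y. x = y \<or> E x y) s X \<Longrightarrow> simple_graph.small_biconn E d X \<Longrightarrow>
    bounded_core E (d + 1) k X"
proof -
  obtain q where q: "q \<ge> 1" "\<And>(V :: 'a set) F. finite V \<and> card V \<ge> q \<Longrightarrow>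
      \<exists>A\<subseteq>V. card A = d + 2 \<and> clique A F \<or> card A = s \<and> indep A F"
    using ramsey2[of "d + 2" s, where 'a = 'a] by blast
  show ?thesis
    by (rule that, rule simple_graph.structure_bound[OF _ _ _ _ q(2,1) refl]) auto
qed

section \<open>From blocks as subgraphs to maximal biconnected vertex sets\<close>

section \<open>Blocks in terms of vertex sets\<close>

definition adj :: "'a pair_pre_digraph \<Rightarrow> 'a \<Rightarrow> 'a \<Rightarrow> bool" where
  "adj G u v \<longleftrightarrow> (u, v) \<in> parcs G"

lemma simple_graph_adj: "pair_graph G \<Longrightarrow> simple_graph (adj G)"
proof
  assume "pair_graph G"
  then interpret pair_graph G .
  show "adj G x y \<Longrightarrow> adj G y x" for x y
    using pair_sym_arcs unfolding adj_def symmetric_def sym_def by auto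
  show "\<not> adj G x x" for x
    using pair_no_loops[of "(x, x)"] unfolding adj_def by auto
qed

lemma graph_induce:
  assumes "pair_graph G" "S \<subseteq> pverts G"
  shows "graph (G \<restriction> S)"
proof -
  interpret pair_graph G by fact
  let ?H = "\<lparr>pverts = S, parcs = {e \<in> parcs G. fst e \<in> S \<and> snd e \<in> S}\<rparr>"
  have eq: "G \<restriction> S = with_proj ?H"
    by (simp add: with_proj_def induce_subgraph_def)
  have "pair_graph ?H"
  proof unfold_locales
    show "finite (pverts ?H)" using finite_subset[OF assms(2) pair_finite_verts] by simp
    show "finite (parcs ?H)" using pair_finite_arcs by auto
    show "symmetric (with_proj ?H)"
      using pair_sym_arcs unfolding symmetric_def sym_def by auto
  qed (use pair_no_loops in auto)
  then show ?thesis unfolding eq by (rule pair_graph.pair_graphD_graph)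
qed

text \<open>\<open>H\<close> is an arbitrary subgraph, perhaps not induced; its edges are among
  those of \<open>G\<close>, so a cut crossed in \<open>H\<close> is crossed in \<open>G\<close>
  too.\<close>

lemma connected_imp_conn:
  assumes "simple_graph (adj G)" "subgraph H (with_proj G)" "Digraph_Component.connected H"
  shows "conn (adj G) (verts H)"
proof -
  interpret simple_graph "adj G" by fact
  have th: "tail H = fst" "head H = snd" "arcs H \<subseteq> parcs G"
    using assms(2) by (auto simp: subgraph_def compatible_def)
  have arcs: "adj G a b" if "(a, b) \<in> parcs (mk_symmetric H)" for a b
    using that th adj_sym by (auto simp: mk_symmetric_def adj_def)
  have reach: "(u, v) \<in> rtrancl_on (verts H) (parcs (mk_symmetric H))" if "u \<in> verts H" "v \<in> verts H" for u v
    using assms(3) that unfolding connected_def strongly_connected_def reachable_def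
    by (simp add: mk_symmetric_def)
  show ?thesis
    unfolding conn_def
  proof (intro conjI allI impI)
    show "verts H \<noteq> {}" using assms(3) unfolding connected_def strongly_connected_def
      by (simp add: mk_symmetric_def)
    fix A assume A: "A \<subseteq> verts H" "A \<noteq> {}" "A \<noteq> verts H"
    then obtain u v where uv: "u \<in> A" "v \<in> verts H" "v \<notin> A" by blast
    show "\<exists>a\<in>A. \<exists>b\<in>verts H - A. adj G a b"
    proof (rule ccontr)
      assume no: "\<not> ?thesis"
      have "(u, v) \<in> rtrancl_on (verts H) (parcs (mk_symmetric H))" using reach uv A by blast
      then have "v \<in> A"
      proof (induction rule: rtrancl_on_induct)
        case (step y z)
        then show ?case using no arcs by blast
      qed (use uv in auto)
      with uv show False by simp
    qed
  qed
qed

lemma conn_imp_connected: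
  assumes "simple_graph (adj G)" "conn (adj G) S"
  shows "Digraph_Component.connected (G \<restriction> S)"
proof -
  interpret simple_graph "adj G" by fact
  let ?r = "parcs (mk_symmetric (G \<restriction> S))"
  have arc: "(a, b) \<in> ?r" if "adj G a b" "a \<in> S" "b \<in> S" for a b
    using that by (force simp: mk_symmetric_def adj_def)
  have "(u, v) \<in> rtrancl_on S ?r" if "u \<in> S" "v \<in> S" for u v
  proof -
    have "S \<subseteq> {v \<in> S. (u, v) \<in> rtrancl_on S ?r}"
    proof (rule conn_closed[OF assms(2)])
      show "S \<inter> {v \<in> S. (u, v) \<in> rtrancl_on S ?r} \<noteq> {}" using \<open>u \<in> S\<close> by auto
      fix a b assume "a \<in> {v \<in> S. (u, v) \<in> rtrancl_on S ?r}" "b \<in> S - {v \<in> S. (u, v) \<in> rtrancl_on S ?r}"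
      then show "\<not> adj G a b" using arc rtrancl_on_into_rtrancl_on[of u a S ?r b] by blast
    qed
    then show ?thesis using that by blast
  qed
  moreover have "S \<noteq> {}" using assms(2) unfolding conn_def by blast
  ultimately show ?thesis unfolding connected_def strongly_connected_def reachable_def
    by (simp add: mk_symmetric_def)
qed

lemma induce_mono:
  assumes "pair_graph G" "S \<subseteq> T"
  shows "subgraph (G \<restriction> S) (G \<restriction> T)"
proof -
  interpret pair_graph G by fact
  show ?thesis using assms(2) by (auto simp: subgraph_def compatible_def)
qed

lemma biconnected_imp_biconn:
  assumes "pair_graph G" "subgraph H (with_proj G)" "biconnected H"
  shows "biconn (adj G) (verts H)"
  unfolding biconn_def
proof (intro conjI ballI)
  note sg = simple_graph_adj[OF assms(1)]
  show "2 \<le> card (verts H)" using assms(3) by (simp add: biconnected_def)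
  show "conn (adj G) (verts H)"
    using connected_imp_conn[OF sg assms(2)] assms(3) by (simp add: biconnected_def)
  fix u assume u: "u \<in> verts H"
  have wf: "wf_digraph H" using assms(2) by (simp add: subgraph_def)
  have "subgraph (pre_digraph.del_vert H u) (with_proj G)"
    using assms(2) wf_digraph.wf_digraph_del_vert[OF wf, of u]
    by (auto simp: subgraph_def compatible_def pre_digraph.del_vert_def)
  then have "conn (adj G) (verts (pre_digraph.del_vert H u))"
    using connected_imp_conn[OF sg] assms(3) u by (simp add: biconnected_def)
  then show "conn (adj G) (verts H - {u})" by (simp add: pre_digraph.del_vert_def)
qed

lemma biconn_imp_biconnected:
  assumes "pair_graph G" "S \<subseteq> pverts G" "biconn (adj G) S"
  shows "biconnected (G \<restriction> S)"
  unfolding biconnected_def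
proof (intro conjI ballI)
  note sg = simple_graph_adj[OF assms(1)]
  show "graph (G \<restriction> S)" by (rule graph_induce[OF assms(1,2)])
  show "2 \<le> card (verts (G \<restriction> S))" using assms(3) by (simp add: biconn_def)
  show "Digraph_Component.connected (G \<restriction> S)"
    using conn_imp_connected[OF sg] assms(3) by (simp add: biconn_def)
  fix u assume u: "u \<in> verts (G \<restriction> S)"
  have "pre_digraph.del_vert (G \<restriction> S) u = G \<restriction> (S - {u})"
    by (auto simp: pre_digraph.del_vert_def induce_subgraph_def)
  then show "Digraph_Component.connected (pre_digraph.del_vert (G \<restriction> S) u)"
    using conn_imp_connected[OF sg, of "S - {u}"] assms(3) u by (simp add: biconn_def)
qed

definition max_biconn :: "('a \<Rightarrow> 'a \<Rightarrow> bool) \<Rightarrow> 'a set \<Rightarrow> 'a set \<Rightarrow> bool" where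
  "max_biconn E X S \<longleftrightarrow> S \<subseteq> X \<and> biconn E S \<and> (\<forall>T. S \<subseteq> T \<longrightarrow> T \<subseteq> X \<longrightarrow> biconn E T \<longrightarrow> T = S)"

lemma subgraph_induceD:
  assumes "pair_graph G" "subgraph H (G \<restriction> X)" "X \<subseteq> pverts G"
  shows "verts H \<subseteq> X" "subgraph H (with_proj G)" "subgraph H (G \<restriction> verts H)"
proof -
  interpret pair_graph G by fact
  show 1: "subgraph H (with_proj G)"
    using assms(2,3) wf_digraph by (auto simp: subgraph_def compatible_def)
  show "verts H \<subseteq> X" using assms by (auto simp: subgraph_def)
  show "subgraph H (G \<restriction> verts H)" by (rule subgraph_induce_subgraphI2[OF 1])
qed

text \<open>Adding edges between vertices of a biconnected subgraph keeps it biconnected. Hence a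
  maximal one contains all edges of \<open>G\<close> on its vertices and is determined by its vertex
  set.\<close>

lemma block_iff:
  assumes "pair_graph G" "X \<subseteq> pverts G"
  shows "block (G \<restriction> X) H \<longleftrightarrow> (\<exists>S. max_biconn (adj G) X S \<and> H = G \<restriction> S)"
proof
  assume "block (G \<restriction> X) H"
  then have H: "subgraph H (G \<restriction> X)" "biconnected H"
    "\<And>H'. H' \<noteq> H \<Longrightarrow> subgraph H H' \<Longrightarrow> subgraph H' (G \<restriction> X) \<Longrightarrow> \<not> biconnected H'"
    by (auto simp: block_def pre_digraph.max_subgraph_def)
  note sub = subgraph_induceD[OF assms(1) H(1) assms(2)]
  have bic: "biconn (adj G) (verts H)" by (rule biconnected_imp_biconn[OF assms(1) sub(2) H(2)])
  have eq: "G \<restriction> T = H" if "verts H \<subseteq> T" "T \<subseteq> X" "biconn (adj G) T" for T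
  proof (rule ccontr)
    assume ne: "G \<restriction> T \<noteq> H"
    have "biconnected (G \<restriction> T)"
      by (rule biconn_imp_biconnected) (use assms that in auto)
    moreover have "subgraph H (G \<restriction> T)"
      using subgraph_trans[OF sub(3) induce_mono[OF assms(1) that(1)]] .
    ultimately show False using H(3)[OF ne] induce_mono[OF assms(1) that(2)] by blast
  qed
  have "max_biconn (adj G) X (verts H)"
    unfolding max_biconn_def
  proof (intro conjI allI impI)
    fix T assume "verts H \<subseteq> T" "T \<subseteq> X" "biconn (adj G) T"
    from eq[OF this] have "verts (G \<restriction> T) = verts H" by simp
    then show "T = verts H" by simp
  qed (use sub bic in auto)
  moreover have "H = G \<restriction> verts H" using eq[of "verts H"] sub(1) bic by simp
  ultimately show "\<exists>S. max_biconn (adj G) X S \<and> H = G \<restriction> S" by blast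
next
  assume "\<exists>S. max_biconn (adj G) X S \<and> H = G \<restriction> S"
  then obtain S where S: "S \<subseteq> X" "biconn (adj G) S"
      "\<And>T. S \<subseteq> T \<Longrightarrow> T \<subseteq> X \<Longrightarrow> biconn (adj G) T \<Longrightarrow> T = S"
    and H: "H = G \<restriction> S" by (auto simp: max_biconn_def)
  have "biconnected H" unfolding H by (rule biconn_imp_biconnected) (use assms S in auto)
  moreover have "subgraph H (G \<restriction> X)" unfolding H by (rule induce_mono[OF assms(1) S(1)])
  moreover have "\<not> (subgraph H' (G \<restriction> X) \<and> biconnected H')" if "H' \<noteq> H" "subgraph H H'" for H'
  proof
    assume h: "subgraph H' (G \<restriction> X) \<and> biconnected H'"
    note sub = subgraph_induceD[OF assms(1) _ assms(2), of H']
    have "biconn (adj G) (verts H')" using biconnected_imp_biconn[OF assms(1) sub(2)] h by blast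
    moreover have "S \<subseteq> verts H'" using that(2) by (auto simp: H subgraph_def)
    ultimately have V: "verts H' = S" using S(3) sub(1) h by blast
    have "arcs H' \<subseteq> arcs (G \<restriction> S)" "tail H' = fst" "head H' = snd"
      using sub(3) h V by (auto simp: subgraph_def compatible_def)
    moreover have "arcs (G \<restriction> S) \<subseteq> arcs H'" using that(2) by (auto simp: H subgraph_def)
    ultimately have "H' = H" using V unfolding H
      by (intro pre_digraph.equality) (auto simp: induce_subgraph_def)
    with that show False by simp
  qed
  ultimately show "block (G \<restriction> X) H"
    unfolding block_def pre_digraph.max_subgraph_def by blast
qed

lemma block_graph_iff:
  assumes "pair_graph G" "X \<subseteq> pverts G"
  shows "block_graph \<C> (G \<restriction> X) \<longleftrightarrow>
    (\<forall>S. max_biconn (adj G) X S \<longrightarrow> (\<exists>K\<in>\<C>. digraph_iso (G \<restriction> S) K))"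
  unfolding block_graph_def block_iff[OF assms] by auto

lemma max_biconn_exists:
  assumes "finite X" "S \<subseteq> X" "biconn E S"
  obtains T where "S \<subseteq> T" "max_biconn E X T"
proof -
  define A where "A = {T. S \<subseteq> T \<and> T \<subseteq> X \<and> biconn E T}"
  have "finite A" by (rule finite_subset[of _ "Pow X"]) (use assms in \<open>auto simp: A_def\<close>)
  moreover have "S \<in> A" using assms by (auto simp: A_def)
  ultimately have "\<exists>T\<in>A. S \<subseteq> T \<and> (\<forall>U\<in>A. T \<subseteq> U \<longrightarrow> T = U)"
    by (rule finite_has_maximal2)
  then obtain T where T: "T \<in> A" "\<forall>U\<in>A. T \<subseteq> U \<longrightarrow> T = U" by blast
  have "max_biconn E X T"
    unfolding max_biconn_def using T by (auto simp: A_def)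
  with T that show ?thesis by (auto simp: A_def)
qed

lemma digraph_iso_card: "digraph_iso H K \<Longrightarrow> card (verts H) = card (verts K)"
  unfolding digraph_iso_def pre_digraph.digraph_isomorphism_def by (auto simp: card_image)

text \<open>Every biconnected set extends to a block, and a block has as many vertices as some
  member of \<C>.\<close>

lemma block_graph_small_biconn:
  assumes "pair_graph G" "X \<subseteq> pverts G" "block_graph \<C> (G \<restriction> X)"
    and "\<And>K. K \<in> \<C> \<Longrightarrow> card (verts K) \<le> d"
  shows "simple_graph.small_biconn (adj G) d X"
  unfolding simple_graph.small_biconn_def[OF simple_graph_adj[OF assms(1)]]
proof (intro allI impI)
  fix S assume S: "S \<subseteq> X" "biconn (adj G) S"
  have fin: "finite X"
    using assms(1,2) pair_fin_digraph.pair_finite_verts finite_subset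
    unfolding pair_graph_def pair_digraph_def by blast
  from max_biconn_exists[OF fin S] obtain T where T: "S \<subseteq> T" "max_biconn (adj G) X T" .
  then obtain K where "K \<in> \<C>" "digraph_iso (G \<restriction> T) K"
    using assms(3) block_graph_iff[OF assms(1,2)] by blast
  then have "card T \<le> d" using digraph_iso_card assms(4) by fastforce
  moreover have "finite T" using T(2) fin finite_subset by (auto simp: max_biconn_def)
  ultimately show "card S \<le> d" using card_mono[OF _ T(1)] by linarith
qed

text \<open>If \<open>S\<close> had vertices strictly on both sides, deleting the common vertex
  would leave no edge between them, while a biconnected set stays connected when one vertex is
  deleted.\<close>

lemma biconn_separation:
  assumes "biconn E S" "S \<subseteq> A \<union> B" "finite (A \<inter> B)" "card (A \<inter> B) \<le> 1"
    and no: "\<And>a b. a \<in> A - B \<Longrightarrow> b \<in> B - A \<Longrightarrow> \<not> E a b"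
  shows "S \<subseteq> A \<or> S \<subseteq> B"
proof (rule ccontr)
  assume "\<not> ?thesis"
  then obtain x y where xy: "x \<in> S - B" "y \<in> S - A" by blast
  have "conn E (S - A \<inter> B)"
  proof (cases "A \<inter> B \<inter> S = {}")
    case True
    then have "S - A \<inter> B = S" by blast
    with assms(1) show ?thesis by (simp add: biconn_def)
  next
    case False
    then obtain u where u: "u \<in> A \<inter> B" "u \<in> S" by blast
    have "A \<inter> B = {u}" using assms(3,4) u card_le_Suc0_iff_eq by fastforce
    then show ?thesis using assms(1) u by (auto simp: biconn_def)
  qed
  moreover have "(S - A \<inter> B) \<inter> (A - B) \<noteq> {}" using xy assms(2) by blast
  moreover have "\<not> E a b" if "a \<in> A - B" "b \<in> S - A \<inter> B - (A - B)" for a b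
    using no[of a b] that assms(2) by blast
  ultimately have "S - A \<inter> B \<subseteq> A - B" by (rule conn_closed)
  with xy assms(2) show False by blast
qed

text \<open>Every biconnected subset of the union lies in \<open>A\<close> or in \<open>B\<close>,
  and never in both, having at least two vertices. So the maximal ones of the union are exactly
  those of the two sides.\<close>

lemma block_graph_Un:
  assumes "pair_graph G" "A \<union> B \<subseteq> pverts G" "card (A \<inter> B) \<le> 1"
    and no: "\<And>a b. a \<in> A - B \<Longrightarrow> b \<in> B - A \<Longrightarrow> \<not> adj G a b"
  shows "block_graph \<C> (G \<restriction> (A \<union> B)) \<longleftrightarrow>
    block_graph \<C> (G \<restriction> A) \<and> block_graph \<C> (G \<restriction> B)"
proof -
  have fin: "finite (A \<inter> B)"
    using assms(1,2) pair_fin_digraph.pair_finite_verts finite_subset[of "A \<inter> B" "pverts G"]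
    unfolding pair_graph_def pair_digraph_def by blast
  have no': "\<not> adj G a b" if "a \<in> B - A" "b \<in> A - B" for a b
    using no[OF that(2,1)] simple_graph.adj_sym[OF simple_graph_adj[OF assms(1)]] by blast
  have sep: "S \<subseteq> A \<or> S \<subseteq> B" if "biconn (adj G) S" "S \<subseteq> A \<union> B" for S
    by (rule biconn_separation[OF that fin assms(3) no]) auto
  have small: "\<not> T \<subseteq> A \<inter> B" if "biconn (adj G) T" for T
    using card_mono[OF fin, of T] that assms(3) by (auto simp: biconn_def)
  have "max_biconn (adj G) (A \<union> B) S \<longleftrightarrow> max_biconn (adj G) A S \<or> max_biconn (adj G) B S" for S
  proof
    assume "max_biconn (adj G) (A \<union> B) S"
    then show "max_biconn (adj G) A S \<or> max_biconn (adj G) B S"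
      using sep[of S] unfolding max_biconn_def by blast
  next
    assume "max_biconn (adj G) A S \<or> max_biconn (adj G) B S"
    then consider "max_biconn (adj G) A S" | "max_biconn (adj G) B S" by blast
    then show "max_biconn (adj G) (A \<union> B) S"
    proof cases
      case 1
      then show ?thesis using sep small[of S] unfolding max_biconn_def by (metis (no_types) Int_greatest le_supI1 order_trans)
    next
      case 2
      then show ?thesis using sep small[of S] unfolding max_biconn_def by (metis (no_types) Int_greatest le_supI2 order_trans)
    qed
  qed
  then show ?thesis
    using assms(2) by (simp add: block_graph_iff[OF assms(1)]) blast
qed

section \<open>Invariance under isomorphism, and adjacency patterns\<close>

lemma conn_image:
  assumes "inj_on g S" "\<And>x y. x \<in> S \<Longrightarrow> y \<in> S \<Longrightarrow> E x y \<longleftrightarrow> F (g x) (g y)"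
  shows "conn E S \<longleftrightarrow> conn F (g ` S)"
proof
  assume c: "conn E S"
  show "conn F (g ` S)"
    unfolding conn_def
  proof (intro conjI allI impI)
    show "g ` S \<noteq> {}" using c by (auto simp: conn_def)
    fix A assume A: "A \<subseteq> g ` S" "A \<noteq> {}" "A \<noteq> g ` S"
    let ?A = "{x\<in>S. g x \<in> A}"
    have "?A \<noteq> {}" "?A \<noteq> S" using A by blast+
    then obtain a b where "a \<in> ?A" "b \<in> S - ?A" "E a b" using c unfolding conn_def by (metis (no_types, lifting) mem_Collect_eq subsetI)
    then show "\<exists>a\<in>A. \<exists>b\<in>g ` S - A. F a b" using assms(2)[of a b] by blast
  qed
next
  assume c: "conn F (g ` S)"
  show "conn E S"
    unfolding conn_def
  proof (intro conjI allI impI)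
    show "S \<noteq> {}" using c by (auto simp: conn_def)
    fix A assume A: "A \<subseteq> S" "A \<noteq> {}" "A \<noteq> S"
    have "g ` A \<noteq> g ` S" using A assms(1) by (simp add: inj_on_image_eq_iff)
    then obtain a b where ab: "a \<in> g ` A" "b \<in> g ` S - g ` A" "F a b"
      using c A unfolding conn_def by (metis image_is_empty image_mono)
    then obtain a' b' where "a' \<in> A" "b' \<in> S - A" "a = g a'" "b = g b'" by blast
    then show "\<exists>a\<in>A. \<exists>b\<in>S - A. E a b" using assms(2)[of a' b'] ab A by blast
  qed
qed

lemma biconn_image:
  assumes "inj_on g S" "\<And>x y. x \<in> S \<Longrightarrow> y \<in> S \<Longrightarrow> E x y \<longleftrightarrow> F (g x) (g y)"
  shows "biconn E S \<longleftrightarrow> biconn F (g ` S)"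
proof -
  have "conn E (S - {u}) \<longleftrightarrow> conn F (g ` S - {g u})" if "u \<in> S" for u
  proof -
    have "g ` (S - {u}) = g ` S - {g u}" using that assms(1) by (simp add: inj_on_image_set_diff[of g S])
    moreover have "inj_on g (S - {u})" using assms(1) inj_on_subset by blast
    ultimately show ?thesis using conn_image[of g "S - {u}" E F] assms(2) by auto
  qed
  then show ?thesis
    unfolding biconn_def using conn_image[of g S E F] assms card_image[OF assms(1)] by auto
qed

lemma digraph_iso_induce:
  assumes "pair_graph G" "S \<subseteq> pverts G" "inj_on g S"
    and "\<And>x y. x \<in> S \<Longrightarrow> y \<in> S \<Longrightarrow> adj G x y \<longleftrightarrow> adj H (g x) (g y)"
  shows "digraph_iso (G \<restriction> S) (H \<restriction> (g ` S))"
proof -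
  let ?f = "\<lparr>iso_verts = g, iso_arcs = map_prod g g, iso_head = snd, iso_tail = fst\<rparr>"
  have "wf_digraph (G \<restriction> S)"
    using graph_induce[OF assms(1,2)] by (simp add: graph_def digraph_def fin_digraph_def)
  moreover have "inj_on (map_prod g g) {e \<in> parcs G. fst e \<in> S \<and> snd e \<in> S}"
    by (rule inj_on_subset[OF map_prod_inj_on[OF assms(3,3)]]) auto
  ultimately have "pre_digraph.digraph_isomorphism (G \<restriction> S) ?f"
    using assms(3) by (auto simp: pre_digraph.digraph_isomorphism_def)
  moreover have "{e \<in> parcs H. fst e \<in> g ` S \<and> snd e \<in> g ` S} =
      map_prod g g ` {e \<in> parcs G. fst e \<in> S \<and> snd e \<in> S}"
    using assms(4) by (force simp: adj_def image_iff)
  then have "H \<restriction> (g ` S) = app_iso ?f (G \<restriction> S)"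
    by (simp add: app_iso_def induce_subgraph_def)
  ultimately show ?thesis unfolding digraph_iso_def by blast
qed

lemma block_graph_transfer:
  assumes "pair_graph G" "X \<subseteq> pverts G" "pair_graph H" "g ` X \<subseteq> pverts H" "inj_on g X"
    and g: "\<And>x y. x \<in> X \<Longrightarrow> y \<in> X \<Longrightarrow> adj G x y \<longleftrightarrow> adj H (g x) (g y)"
    and "block_graph \<C> (H \<restriction> (g ` X))"
  shows "block_graph \<C> (G \<restriction> X)"
  unfolding block_graph_iff[OF assms(1,2)]
proof (intro allI impI)
  fix S assume S: "max_biconn (adj G) X S"
  then have SX: "S \<subseteq> X" by (auto simp: max_biconn_def)
  have bi: "biconn (adj G) T \<longleftrightarrow> biconn (adj H) (g ` T)" if "T \<subseteq> X" for T
    by (rule biconn_image[where E = "adj G" and F = "adj H", OF inj_on_subset[OF assms(5) that] g])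
      (use that in auto)
  have "max_biconn (adj H) (g ` X) (g ` S)"
    unfolding max_biconn_def
  proof (intro conjI allI impI)
    show "g ` S \<subseteq> g ` X" using SX by auto
    show "biconn (adj H) (g ` S)" using S bi[OF SX] by (auto simp: max_biconn_def)
    fix T assume T: "g ` S \<subseteq> T" "T \<subseteq> g ` X" "biconn (adj H) T"
    let ?T = "{x\<in>X. g x \<in> T}"
    have eq: "g ` ?T = T" using T(2) by blast
    have "biconn (adj G) ?T" using bi[of ?T] eq T(3) by auto
    moreover have "S \<subseteq> ?T" using SX T(1) by blast
    ultimately have "?T = S" using S by (auto simp: max_biconn_def)
    with eq show "T = g ` S" by simp
  qed
  then obtain K where K: "K \<in> \<C>" "digraph_iso (H \<restriction> (g ` S)) K"
    using assms(7) block_graph_iff[OF assms(3,4)] by blast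
  have "digraph_iso (G \<restriction> S) (H \<restriction> (g ` S))"
    by (rule digraph_iso_induce[where G = G and H = H,
          OF assms(1) order_trans[OF SX assms(2)] inj_on_subset[OF assms(5) SX] g]) (use SX in auto)
  with K digraph_iso_trans show "\<exists>K\<in>\<C>. digraph_iso (G \<restriction> S) K" by blast
qed

text \<open>A list may have repetitions, so its pattern records equality as well as adjacency.\<close>

definition pattern :: "('a \<Rightarrow> 'a \<Rightarrow> bool) \<Rightarrow> 'a list \<Rightarrow> (bool \<times> bool) list list" where
  "pattern E vs = map (\<lambda>u. map (\<lambda>v. (u = v, E u v)) vs) vs"

text \<open>Entries at equal positions correspond. As equality of entries is recorded too, this is a
  well-defined bijection even for lists with repetitions, and it preserves adjacency. So the pattern
  alone decides, across different graphs.\<close>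

lemma block_graph_pattern:
  assumes "pair_graph G" "set us \<subseteq> pverts G" "pair_graph H" "set vs \<subseteq> pverts H"
    and eq: "pattern (adj G) us = pattern (adj H) vs"
    and "block_graph \<C> (H \<restriction> set vs)"
  shows "block_graph \<C> (G \<restriction> set us)"
proof -
  have len: "length us = length vs" using arg_cong[OF eq, of length] by (simp add: pattern_def)
  have nth: "(us ! i = us ! j) = (vs ! i = vs ! j)" "adj G (us ! i) (us ! j) = adj H (vs ! i) (vs ! j)"
    if "i < length us" "j < length us" for i j
  proof -
    have "pattern (adj G) us ! i ! j = pattern (adj H) vs ! i ! j" using eq by simp
    then show "(us ! i = us ! j) = (vs ! i = vs ! j)" "adj G (us ! i) (us ! j) = adj H (vs ! i) (vs ! j)"
      using that len by (auto simp: pattern_def)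
  qed
  define ix where "ix x = (SOME i. i < length us \<and> us ! i = x)" for x
  have ix: "ix x < length us" "us ! ix x = x" if "x \<in> set us" for x
  proof -
    have "\<exists>i. i < length us \<and> us ! i = x" using that by (simp add: in_set_conv_nth)
    from someI_ex[OF this] show "ix x < length us" "us ! ix x = x" by (auto simp: ix_def)
  qed
  define g where "g x = vs ! ix x" for x
  have g_nth: "g (us ! i) = vs ! i" if "i < length us" for i
    using nth(1)[of "ix (us ! i)" i] ix[of "us ! i"] that by (simp add: g_def)
  have img: "g ` set us = set vs"
    by (auto simp: set_conv_nth len g_nth image_iff) (metis g_nth len)
  have "inj_on g (set us)"
    using nth(1) ix by (intro inj_onI) (metis g_def)
  moreover have "adj G x y \<longleftrightarrow> adj H (g x) (g y)" if "x \<in> set us" "y \<in> set us" for x y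
    using nth(2)[of "ix x" "ix y"] ix that by (simp add: g_def)
  ultimately show ?thesis
    using assms by (intro block_graph_transfer[of G "set us" H g]) (auto simp: img)
qed

text \<open>The vertices \<open>f i j\<close> delivered by \<open>has_P3sD\<close> are all distinct,
  and \<open>(i, j) \<mapsto> f i j\<close> is an isomorphism from the disjoint copies onto an
  induced subgraph.\<close>

lemma free_of_P3s:
  assumes "pair_graph G" "free_of (with_proj (disjoint_copies s (path_graph 3))) (with_proj G)"
  shows "\<not> has_P3s (\<lambda>x y. x = y \<or> adj G x y) s (pverts G)"
proof
  assume "has_P3s (\<lambda>x y. x = y \<or> adj G x y) s (pverts G)"
  from has_P3sD[OF this] obtain f :: "nat \<Rightarrow> nat \<Rightarrow> 'a"
    where f1: "\<And>i j. i < s \<Longrightarrow> j < 3 \<Longrightarrow> f i j \<in> pverts G"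
    and f2: "\<And>i. i < s \<Longrightarrow> (f i 0 = f i 1 \<or> adj G (f i 0) (f i 1)) \<and> (f i 1 = f i 2 \<or> adj G (f i 1) (f i 2)) \<and>
        \<not> (f i 0 = f i 2 \<or> adj G (f i 0) (f i 2))"
    and f3: "\<And>i j k l. i < j \<Longrightarrow> j < s \<Longrightarrow> k < 3 \<Longrightarrow> l < 3 \<Longrightarrow> \<not> (f i k = f j l \<or> adj G (f i k) (f j l))"
    by blast
  interpret simple_graph "adj G" by (rule simple_graph_adj[OF assms(1)])
  interpret pair_graph G by fact
  let ?D = "disjoint_copies s (path_graph 3)"
  let ?F = "case_prod f"
  have less3: "j < 3 \<longleftrightarrow> j = 0 \<or> j = 1 \<or> j = (2 :: nat)" for j by auto
  have ne: "f i 0 \<noteq> f i 1" "f i 1 \<noteq> f i 2" "f i 0 \<noteq> f i 2" if "i < s" for i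
    using f2[OF that] by auto
  have ad: "adj G (f i 0) (f i 1)" "adj G (f i 1) (f i 2)" "\<not> adj G (f i 0) (f i 2)"
    "adj G (f i 1) (f i 0)" "adj G (f i 2) (f i 1)" "\<not> adj G (f i 2) (f i 0)" if "i < s" for i
    using f2[OF that] ne[OF that] adj_sym by auto
  have f4: "f i k \<noteq> f j l \<and> \<not> adj G (f i k) (f j l)" if "i \<noteq> j" "i < s" "j < s" "k < 3" "l < 3" for i j k l
    using f3[of i j k l] f3[of j i l k] that adj_sym by (metis nat_neq_iff)
  have D: "pair_graph ?D"
  proof unfold_locales
    show "finite (pverts ?D)" by (simp add: disjoint_copies_def path_graph_def)
    show "finite (parcs ?D)"
      by (rule finite_subset[of _ "({..<s} \<times> {..<3}) \<times> ({..<s} \<times> {..<3})"])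
        (auto simp: disjoint_copies_def path_graph_def)
    show "symmetric (with_proj ?D)"
      by (auto simp: symmetric_def sym_def disjoint_copies_def path_graph_def)
  qed (auto simp: disjoint_copies_def path_graph_def)
  have V: "pverts ?D = {..<s} \<times> {..<3}" by (simp add: disjoint_copies_def path_graph_def)
  have inj: "inj_on ?F (pverts ?D)"
  proof (rule inj_onI)
    fix x y assume h: "x \<in> pverts ?D" "y \<in> pverts ?D" "?F x = ?F y"
    obtain i k j l where xy: "x = (i, k)" "y = (j, l)" by (metis surj_pair)
    have "i = j" using f4[of i j k l] h by (auto simp: V xy)
    moreover have "k = l" using h ne[of i] unfolding V xy less3 \<open>i = j\<close> by (auto simp: less3)
    ultimately show "x = y" by (simp add: xy)
  qed
  have adjD: "adj ?D (i, k) (j, l) \<longleftrightarrow> i = j \<and> i < s \<and> k < 3 \<and> l < 3 \<and> (l = Suc k \<or> k = Suc l)" for i k j l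
    by (auto simp: adj_def disjoint_copies_def path_graph_def)
  have iso: "digraph_iso (with_proj ?D \<restriction> pverts ?D) (G \<restriction> (?F ` pverts ?D))"
  proof (rule digraph_iso_induce[OF D _ inj])
    fix x y assume h: "x \<in> pverts ?D" "y \<in> pverts ?D"
    obtain i k j l where xy: "x = (i, k)" "y = (j, l)" by (metis surj_pair)
    have b: "i < s" "j < s" "k < 3" "l < 3" using h by (auto simp: V xy)
    show "adj ?D x y \<longleftrightarrow> adj G (?F x) (?F y)"
    proof (cases "i = j")
      case False
      then show ?thesis using f4[OF False b(1,2,3,4)] by (simp add: xy adjD)
    next
      case True
      then show ?thesis using ad[OF b(1)] adj_irrefl b(1,3,4) unfolding xy adjD less3 by auto
    qed
  qed simp
  have "with_proj ?D \<restriction> pverts ?D = with_proj ?D"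
    using D pair_wf_digraph.arc_fst_in_verts[of ?D] pair_wf_digraph.arc_snd_in_verts[of ?D]
    by (auto simp: with_proj_def induce_subgraph_def pair_graph_def pair_digraph_def pair_fin_digraph_def)
  with iso have iso': "digraph_iso (with_proj ?D) (G \<restriction> (?F ` pverts ?D))" by simp
  have "wf_digraph (with_proj ?D)"
    using pair_graph.pair_graphD_graph[OF D] by (simp add: graph_def digraph_def fin_digraph_def)
  from digraph_iso_swap[OF this iso']
  have "digraph_iso (G \<restriction> (?F ` pverts ?D)) (with_proj ?D)" .
  moreover have "induced_subgraph (G \<restriction> (?F ` pverts ?D)) (with_proj G)"
    by (rule induced_induce) (use f1 in \<open>auto simp: V\<close>)
  ultimately show False using assms(2) unfolding free_of_def by blast
qed

section \<open>Covering independent sets by polynomially many P3-free sets\<close>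

section \<open>Independent sets of conflict graphs without many induced P3\<close>

declare has_P3s.simps(2) [simp del]

definition cluster :: "('i \<Rightarrow> 'i \<Rightarrow> bool) \<Rightarrow> 'i list \<Rightarrow> bool" where
  "cluster c H \<longleftrightarrow> (\<forall>x\<in>set H. \<forall>y\<in>set H. \<forall>z\<in>set H. c x y \<longrightarrow> c y z \<longrightarrow> c x z)"

definition greedy :: "('i \<Rightarrow> 'i \<Rightarrow> bool) \<Rightarrow> 'i list \<Rightarrow> 'i list \<Rightarrow> 'i list" where
  "greedy c H S = foldl (\<lambda>H v. if cluster c (v # H) then v # H else H) H S"

definition before :: "'i \<Rightarrow> 'i list \<Rightarrow> 'i list" where
  "before v L = takeWhile (\<lambda>u. u \<noteq> v) L"

definition after :: "'i \<Rightarrow> 'i list \<Rightarrow> 'i list" where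
  "after v L = rev (before v (rev L))"

text \<open>
  A family of polynomially many clusters (P3-free sets) that cover all independent sets, in the
  spirit of Farber's enumeration of the maximal independent sets of a 2K2-free graph: the list is
  scanned, and an element v that does not extend the current cluster H forms a P3 with two
  elements a, b of H, outside of whose neighbourhood one P3 less has to be dealt with.
\<close>

primrec clusters :: "('i \<Rightarrow> 'i \<Rightarrow> bool) \<Rightarrow> nat \<Rightarrow> 'i list \<Rightarrow> 'i list list" where
  "clusters c 0 L = []"
| "clusters c (Suc l) L = greedy c [] L # concat (map (\<lambda>v. concat (map (\<lambda>a. concat (map (\<lambda>b.
     if cluster c [v, a, b] then [] else map (\<lambda>Z. greedy c (v # b # Z) (after v L))
       (clusters c l (filter (\<lambda>u. \<not> c u v \<and> \<not> c u a \<and> \<not> c u b) (before v L))))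
     (before v L))) (before v L))) L)"

lemma cluster_mono: "cluster c H \<Longrightarrow> set H' \<subseteq> set H \<Longrightarrow> cluster c H'"
  unfolding cluster_def by blast

lemma greedy_Nil [simp]: "greedy c H [] = H"
  and greedy_snoc [simp]: "greedy c H (S @ [v]) =
    (if cluster c (v # greedy c H S) then v # greedy c H S else greedy c H S)"
  by (simp_all add: greedy_def)

lemma clustersI:
  assumes "v \<in> set L" "a \<in> set (before v L)" "b \<in> set (before v L)" "\<not> cluster c [v, a, b]"
    and "Z \<in> set (clusters c l (filter (\<lambda>u. \<not> c u v \<and> \<not> c u a \<and> \<not> c u b) (before v L)))"
  shows "greedy c (v # b # Z) (after v L) \<in> set (clusters c (Suc l) L)"
proof -
  have "greedy c (v # b # Z) (after v L) \<in> (\<Union>v\<in>set L. \<Union>a\<in>set (before v L). \<Union>b\<in>set (before v L).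
     set (if cluster c [v, a, b] then [] else map (\<lambda>Z. greedy c (v # b # Z) (after v L))
       (clusters c l (filter (\<lambda>u. \<not> c u v \<and> \<not> c u a \<and> \<not> c u b) (before v L)))))"
    by (rule UN_I[OF assms(1)], rule UN_I[OF assms(2)], rule UN_I[OF assms(3)]) (use assms(4,5) in simp)
  then show ?thesis by (simp only: clusters.simps list.set set_concat set_map image_image insert_iff simp_thms)
qed

declare clusters.simps(2) [simp del]

lemma set_before: "set (before v L) \<subseteq> set L"
  using set_takeWhileD unfolding before_def by fastforce

lemma set_after: "set (after v L) \<subseteq> set L"
  using set_before[of v "rev L"] by (simp add: after_def)

lemma before_snoc: "v \<in> set L \<Longrightarrow> before v (L @ [w]) = before v L"
  by (simp add: before_def)

lemma before_last: "v \<notin> set L \<Longrightarrow> before v (L @ [v]) = L"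
  unfolding before_def by (subst takeWhile_append2) auto

lemma after_snoc: "w \<noteq> v \<Longrightarrow> after v (L @ [w]) = after v L @ [w]"
  by (simp add: after_def before_def)

lemma after_last: "after v (L @ [v]) = []"
  by (simp add: after_def before_def)

lemma set_greedy: "set H \<subseteq> set (greedy c H S)" "set (greedy c H S) \<subseteq> set H \<union> set S"
  by (induction S rule: rev_induct) auto

lemma cluster_greedy: "cluster c H \<Longrightarrow> cluster c (greedy c H S)"
  by (induction S rule: rev_induct) auto

locale conflict =
  fixes c :: "'i \<Rightarrow> 'i \<Rightarrow> bool"
  assumes conf_refl: "c x x" and conf_sym: "c x y \<Longrightarrow> c y x"
begin

text \<open>No element of \<open>Z\<close> is related to \<open>v\<close> or \<open>b\<close>, so a
  chain of two conflicts stays inside \<open>Z\<close> or inside \<open>{v, b}\<close>, and two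
  elements alone cannot violate transitivity.\<close>

lemma cluster_pair:
  assumes "cluster c Z" "\<And>z. z \<in> set Z \<Longrightarrow> \<not> c z v \<and> \<not> c z b"
  shows "cluster c (v # b # Z)"
proof -
  have n: "\<not> c z v" "\<not> c z b" "\<not> c v z" "\<not> c b z" if "z \<in> set Z" for z
    using assms(2) that conf_sym by blast+
  show ?thesis
    unfolding cluster_def
  proof (intro ballI impI)
    fix x y z
    assume m: "x \<in> set (v # b # Z)" "y \<in> set (v # b # Z)" "z \<in> set (v # b # Z)" and h: "c x y" "c y z"
    show "c x z"
    proof (cases "y \<in> set Z")
      case True
      then have "x \<in> set Z" "z \<in> set Z" using m h n[OF True] by auto
      then show ?thesis using assms(1) True h unfolding cluster_def by blast
    next
      case False
      then have "y = v \<or> y = b" using m by auto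
      then have "x = v \<or> x = b" "z = v \<or> z = b" using m h n by auto
      then show ?thesis using \<open>y = v \<or> y = b\<close> h conf_refl by auto
    qed
  qed
qed

lemma clusters_sound:
  assumes "H \<in> set (clusters c l L)"
  shows "cluster c H \<and> set H \<subseteq> set L"
  using assms
proof (induction l arbitrary: L H)
  case (Suc l)
  have nil: "cluster c []" by (simp add: cluster_def)
  from Suc.prems consider "H = greedy c [] L"
    | v a b Z where "v \<in> set L" "a \<in> set (before v L)" "b \<in> set (before v L)"
      "Z \<in> set (clusters c l (filter (\<lambda>u. \<not> c u v \<and> \<not> c u a \<and> \<not> c u b) (before v L)))"
      "H = greedy c (v # b # Z) (after v L)"
    by (auto simp: clusters.simps(2) split: if_splits)
  then show ?case
  proof cases
    case 1
    then show ?thesis using cluster_greedy[OF nil] set_greedy(2)[of c "[]" L] by auto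
  next
    case 2
    from Suc.IH[OF 2(4)] have Z: "cluster c Z"
      "set Z \<subseteq> set (filter (\<lambda>u. \<not> c u v \<and> \<not> c u a \<and> \<not> c u b) (before v L))" by auto
    have "cluster c (v # b # Z)" by (rule cluster_pair) (use Z in auto)
    then have "cluster c H" unfolding 2(5) by (rule cluster_greedy)
    moreover have "set (v # b # Z) \<subseteq> set L" using 2(1-3) Z(2) set_before[of v L] by auto
    then have "set H \<subseteq> set L"
      using set_greedy(2)[of c "v # b # Z" "after v L"] set_after[of v L] unfolding 2(5) by blast
    ultimately show ?thesis by blast
  qed
qed simp

text \<open>The scan is incremental: when an element is appended, each member of the family
  survives, with that element added if possible, since the greedy extension runs from left to
  right.\<close>

lemma clusters_step:
  assumes "H \<in> set (clusters c (Suc l) L)" "w \<notin> set L"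
  shows "(if cluster c (w # H) then w # H else H) \<in> set (clusters c (Suc l) (L @ [w]))"
proof -
  from assms(1) consider "H = greedy c [] L"
    | v a b Z where "v \<in> set L" "a \<in> set (before v L)" "b \<in> set (before v L)" "\<not> cluster c [v, a, b]"
      "Z \<in> set (clusters c l (filter (\<lambda>u. \<not> c u v \<and> \<not> c u a \<and> \<not> c u b) (before v L)))"
      "H = greedy c (v # b # Z) (after v L)"
    by (auto simp: clusters.simps(2) split: if_splits)
  then show ?thesis
  proof cases
    case 1
    then show ?thesis by (simp add: clusters.simps(2))
  next
    case 2
    have "greedy c (v # b # Z) (after v (L @ [w])) \<in> set (clusters c (Suc l) (L @ [w]))"
      by (rule clustersI) (use 2(1-5) in \<open>simp_all add: before_snoc\<close>)
    moreover have "after v (L @ [w]) = after v L @ [w]"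
      by (rule after_snoc) (use 2(1) assms(2) in auto)
    ultimately show ?thesis unfolding 2(6) by (simp only: greedy_snoc)
  qed
qed

text \<open>Apart from \<open>v\<close> and \<open>b\<close>, the set \<open>I\<close> avoids the
  neighbourhood of the P3 on \<open>v\<close>, \<open>a\<close>, \<open>b\<close>, where one P3 less
  is left, so the hypothesis for \<open>l\<close> applies. \<open>b\<close> is added to
  \<open>Z\<close> because it may belong to \<open>I\<close>; \<open>a\<close> completes the
  P3.\<close>

lemma clusters_new:
  assumes cov: "\<And>L I. distinct L \<Longrightarrow> \<not> has_P3s c l (set L) \<Longrightarrow> I \<subseteq> set L \<Longrightarrow>
      (\<forall>x\<in>I. \<forall>y\<in>I. c x y \<longrightarrow> x = y) \<Longrightarrow> \<exists>H\<in>set (clusters c l L). I \<subseteq> set H"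
    and "distinct (L @ [v])" "\<not> has_P3s c (Suc l) (set (L @ [v]))"
    and ind: "\<forall>x\<in>I. \<forall>y\<in>I. c x y \<longrightarrow> x = y"
    and ab: "a \<in> set L" "b \<in> set L" "\<not> cluster c [v, a, b]"
    and I: "\<And>u. u \<in> I \<Longrightarrow> u \<noteq> v \<Longrightarrow> u \<noteq> b \<Longrightarrow> u \<in> set L \<and> \<not> c u v \<and> \<not> c u a \<and> \<not> c u b"
  shows "\<exists>H\<in>set (clusters c (Suc l) (L @ [v])). I \<subseteq> set H"
proof -
  let ?F = "filter (\<lambda>u. \<not> c u v \<and> \<not> c u a \<and> \<not> c u b) L"
  have v: "v \<notin> set L" using assms(2) by simp
  obtain x y z where xyz: "x \<in> {v, a, b}" "y \<in> {v, a, b}" "z \<in> {v, a, b}" "c x y" "c y z" "\<not> c x z"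
    using ab(3) unfolding cluster_def by auto
  then have "x \<noteq> y" "y \<noteq> z" "x \<noteq> z" using conf_refl by auto
  with xyz have eq: "{x, y, z} = {v, a, b}" by auto
  have "set ?F \<subseteq> {u \<in> set (L @ [v]). \<not> c u x \<and> \<not> c u y \<and> \<not> c u z}"
    using eq by auto
  moreover have "\<not> has_P3s c l {u \<in> set (L @ [v]). \<not> c u x \<and> \<not> c u y \<and> \<not> c u z}"
  proof
    assume "has_P3s c l {u \<in> set (L @ [v]). \<not> c u x \<and> \<not> c u y \<and> \<not> c u z}"
    moreover have "x \<in> set (L @ [v])" "y \<in> set (L @ [v])" "z \<in> set (L @ [v])" using xyz(1-3) ab by auto
    ultimately have "has_P3s c (Suc l) (set (L @ [v]))" unfolding has_P3s.simps using xyz(4-6) by blast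
    with assms(3) show False by contradiction
  qed
  ultimately have "\<not> has_P3s c l (set ?F)" using has_P3s_mono by blast
  moreover have "I - {v, b} \<subseteq> set ?F" using I by auto
  ultimately obtain Z where Z: "Z \<in> set (clusters c l ?F)" "I - {v, b} \<subseteq> set Z"
    using cov[of ?F "I - {v, b}"] assms(2) ind by auto
  have "v # b # Z \<in> set (clusters c (Suc l) (L @ [v]))"
    using clustersI[of v "L @ [v]" a b c Z l] Z(1) ab v by (simp add: before_last after_last)
  moreover have "I \<subseteq> set (v # b # Z)" using Z(2) by auto
  ultimately show ?thesis by blast
qed

theorem clusters_cover:
  assumes "distinct L" "\<not> has_P3s c l (set L)" "I \<subseteq> set L" "\<forall>x\<in>I. \<forall>y\<in>I. c x y \<longrightarrow> x = y"
  shows "\<exists>H\<in>set (clusters c l L). I \<subseteq> set H"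
  using assms
proof (induction l arbitrary: L I)
  case (Suc l)
  note cov = Suc.IH
  from Suc.prems show ?case
  proof (induction L arbitrary: I rule: rev_induct)
    case (snoc v L)
    have v: "v \<notin> set L" using snoc.prems(1) by simp
    have "\<not> has_P3s c (Suc l) (set L)"
      using snoc.prems(2) has_P3s_mono[of c "Suc l" "set L" "set (L @ [v])"] by auto
    have "\<exists>H\<in>set (clusters c (Suc l) L). I - {v} \<subseteq> set H"
      by (rule snoc.IH) (use snoc.prems \<open>\<not> has_P3s c (Suc l) (set L)\<close> in auto)
    then obtain H where H: "H \<in> set (clusters c (Suc l) L)" "I - {v} \<subseteq> set H" by blast
    note step = clusters_step[OF H(1) v]
    have clH: "cluster c H" "set H \<subseteq> set L" using clusters_sound[OF H(1)] by auto
    show ?case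
    proof (cases "v \<in> I \<and> \<not> cluster c (v # H)")
      case False
      then have "I \<subseteq> set (if cluster c (v # H) then v # H else H)" using H(2) by auto
      then show ?thesis using step by blast
    next
      case True
      note new = clusters_new[OF cov snoc.prems(1,2,4)]
      have IH: "u \<in> set H" "u \<in> set L" "\<not> c u v" if "u \<in> I" "u \<noteq> v" for u
        using that H(2) clH True snoc.prems(4) by blast+
      have tr: "c x z" if "x \<in> set H" "y \<in> set H" "z \<in> set H" "c x y" "c y z" for x y z
        using clH(1) that unfolding cluster_def by blast
      show ?thesis
      proof (cases "\<exists>a\<in>set H. \<exists>u\<in>I - {v}. c v a \<and> c a u")
        case True
        \<comment> \<open>\<open>v\<close> and \<open>u\<close> both belong to \<open>I\<close> and
          do not conflict, so \<open>v\<close>, \<open>a\<close>, \<open>u\<close> form a P3. The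
          other elements of \<open>I\<close> avoid \<open>a\<close>: in the cluster \<open>H\<close>
          a conflict with \<open>a\<close> would imply one with \<open>u\<close>.\<close>
        then obtain a u where au: "a \<in> set H" "u \<in> I" "u \<noteq> v" "c v a" "c a u" by blast
        have nvu: "\<not> c v u" using IH(3)[OF au(2,3)] conf_sym by blast
        show ?thesis
        proof (rule new)
          show "\<not> cluster c [v, a, u]" using au nvu unfolding cluster_def by auto
          show "a \<in> set L" using au(1) clH by blast
          show "u \<in> set L" using IH au by blast
          fix u' assume u': "u' \<in> I" "u' \<noteq> v" "u' \<noteq> u"
          then have "\<not> c u' u" using snoc.prems(4) au by blast
          moreover have "\<not> c u' a" using tr[of u' a u] IH(1) u' au \<open>\<not> c u' u\<close> by blast
          ultimately show "u' \<in> set L \<and> \<not> c u' v \<and> \<not> c u' a \<and> \<not> c u' u" using IH u' by blast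
        qed
      next
        case no: False
        have noE: "\<not> c u a" if "u \<in> I" "u \<noteq> v" "a \<in> set H" "c v a" for u a
          using no that conf_sym by blast
        obtain x y z where xyz: "x \<in> set (v # H)" "y \<in> set (v # H)" "z \<in> set (v # H)"
          "c x y" "c y z" "\<not> c x z" using \<open>v \<in> I \<and> \<not> cluster c (v # H)\<close> unfolding cluster_def by blast
        \<comment> \<open>Now no neighbour of \<open>v\<close> in \<open>H\<close> conflicts with
          the rest of \<open>I\<close>. A P3 of \<open>v # H\<close> has \<open>v\<close> as its
          middle or as an end. In the second case \<open>z'\<close> lies in the class of
          \<open>y'\<close>, so it conflicts with no other element of \<open>I\<close>
          either.\<close>
        consider "y = v" "x \<in> set H" "z \<in> set H" | y' z' where "y' \<in> set H" "z' \<in> set H" "c v y'" "c y' z'" "\<not> c v z'"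
        proof -
          consider "y = v" | "y \<noteq> v" "x = v" | "y \<noteq> v" "x \<noteq> v" "z = v" | "y \<noteq> v" "x \<noteq> v" "z \<noteq> v" by blast
          then show thesis
          proof cases
            case 1
            then have "x \<noteq> v" "z \<noteq> v" using xyz by auto
            then show thesis using that(1) 1 xyz by auto
          next
            case 2
            then have "z \<noteq> v" using xyz conf_refl by auto
            then show thesis using that(2)[of y z] 2 xyz by auto
          next
            case 3
            then show thesis using that(2)[of y x] xyz conf_sym by auto
          next
            case 4
            then show thesis using tr[of x y z] xyz by auto
          qed
        qed
        then show ?thesis
        proof cases
          case 1
          show ?thesis
          proof (rule new)
            show "\<not> cluster c [v, x, z]" using xyz 1 unfolding cluster_def by auto
            show "x \<in> set L" "z \<in> set L" using 1 clH by auto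
            fix u assume "u \<in> I" "u \<noteq> v"
            then show "u \<in> set L \<and> \<not> c u v \<and> \<not> c u x \<and> \<not> c u z"
              using IH noE 1 xyz conf_sym by blast
          qed
        next
          case 2
          show ?thesis
          proof (rule new)
            show "\<not> cluster c [v, y', z']" using 2 unfolding cluster_def by auto
            show "y' \<in> set L" "z' \<in> set L" using 2 clH by auto
            fix u assume u: "u \<in> I" "u \<noteq> v"
            have "\<not> c u y'" using noE[OF u 2(1,3)] .
            moreover have "\<not> c u z'" using tr[of u z' y'] IH(1)[OF u] 2 conf_sym \<open>\<not> c u y'\<close> by blast
            ultimately show "u \<in> set L \<and> \<not> c u v \<and> \<not> c u y' \<and> \<not> c u z'" using IH u by blast
          qed
        qed
      qed
    qed
  qed (simp add: clusters.simps(2))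
qed simp

end

section \<open>Heaviest independent set of a cluster\<close>

definition pick :: "('i \<Rightarrow> 'i \<Rightarrow> bool) \<Rightarrow> ('i \<Rightarrow> nat) \<Rightarrow> 'i list \<Rightarrow> 'i list" where
  "pick c w H = foldl (\<lambda>P K. if \<exists>K'\<in>set P. c K K' \<and> \<not> w K' < w K then P
     else K # filter (\<lambda>K'. \<not> c K K') P) [] H"

context conflict
begin

text \<open>A chosen element is replaced only by a heavier one of its class, so by transitivity
  everything represented before stays represented by something at least as heavy.\<close>

lemma pick_invariant:
  assumes "cluster c H"
  shows "set (pick c w H) \<subseteq> set H \<and> (\<forall>x\<in>set (pick c w H). \<forall>y\<in>set (pick c w H). c x y \<longrightarrow> x = y) \<and>
    (\<forall>K\<in>set H. \<exists>K'\<in>set (pick c w H). c K K' \<and> w K \<le> w K')"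
  using assms
proof (induction H rule: rev_induct)
  case Nil
  then show ?case by (simp add: pick_def)
next
  case (snoc K H)
  have tr: "c x z" if "x \<in> set (H @ [K])" "y \<in> set (H @ [K])" "z \<in> set (H @ [K])" "c x y" "c y z" for x y z
    using snoc.prems that unfolding cluster_def by blast
  have "cluster c H" by (rule cluster_mono[OF snoc.prems]) auto
  note IH = snoc.IH[OF this]
  define P where "P = pick c w H"
  have P: "set P \<subseteq> set H" "\<And>x y. x \<in> set P \<Longrightarrow> y \<in> set P \<Longrightarrow> c x y \<Longrightarrow> x = y"
    "\<And>J. J \<in> set H \<Longrightarrow> \<exists>K'\<in>set P. c J K' \<and> w J \<le> w K'" using IH unfolding P_def by auto
  have eq: "pick c w (H @ [K]) = (if \<exists>K'\<in>set P. c K K' \<and> \<not> w K' < w K then P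
     else K # filter (\<lambda>K'. \<not> c K K') P)"
    unfolding P_def pick_def foldl_append by (simp only: foldl.simps)
  show ?case
  proof (cases "\<exists>K'\<in>set P. c K K' \<and> \<not> w K' < w K")
    case True
    then have "pick c w (H @ [K]) = P" unfolding eq by (rule if_P)
    moreover have "\<exists>K'\<in>set P. c K K' \<and> w K \<le> w K'" using True by (auto simp: not_less)
    ultimately show ?thesis using P by auto
  next
    case False
    then have eq': "pick c w (H @ [K]) = K # filter (\<lambda>K'. \<not> c K K') P" unfolding eq by (rule if_not_P)
    have "\<exists>K'\<in>set (K # filter (\<lambda>K'. \<not> c K K') P). c J K' \<and> w J \<le> w K'" if J: "J \<in> set (H @ [K])" for J
    proof (cases "J = K")
      case True
      then show ?thesis using conf_refl by auto
    next
      case False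
      then have "J \<in> set H" using J by auto
      then obtain K' where K': "K' \<in> set P" "c J K'" "w J \<le> w K'" using P(3) by blast
      show ?thesis
      proof (cases "c K K'")
        case True
        then have "w K' < w K" using \<open>\<not> (\<exists>K'\<in>set P. c K K' \<and> \<not> w K' < w K)\<close> K' by blast
        moreover have "c J K" using tr[of J K' K] J K' True P(1) conf_sym by auto
        ultimately show ?thesis using K' by auto
      next
        case False
        then show ?thesis using K' by auto
      qed
    qed
    then show ?thesis unfolding eq' using P(1,2) conf_sym by auto
  qed
qed

text \<open>Sending each element of \<open>I\<close> to its representative does not decrease the
  weight, and it is injective, as two elements with the same representative would conflict by
  transitivity.\<close>

lemma pick_optimal:
  assumes "cluster c H" "I \<subseteq> set H" "\<forall>x\<in>I. \<forall>y\<in>I. c x y \<longrightarrow> x = y"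
  shows "(\<Sum>K\<in>I. w K) \<le> (\<Sum>K\<in>set (pick c w H). w K)"
proof -
  note P = pick_invariant[OF assms(1), of w]
  have "\<forall>K\<in>I. \<exists>K'. K' \<in> set (pick c w H) \<and> c K K' \<and> w K \<le> w K'" using P assms(2) by blast
  from bchoice[OF this] obtain g
    where g: "\<And>K. K \<in> I \<Longrightarrow> g K \<in> set (pick c w H) \<and> c K (g K) \<and> w K \<le> w (g K)" by blast
  have "inj_on g I"
  proof (rule inj_onI)
    fix K L assume KL: "K \<in> I" "L \<in> I" "g K = g L"
    have m: "K \<in> set H" "L \<in> set H" "g K \<in> set H" using KL assms(2) g[OF KL(1)] P by auto
    have "c K (g K)" "c (g K) L" using g[OF KL(1)] g[OF KL(2)] KL(3) conf_sym by auto
    then have "c K L" using assms(1) m unfolding cluster_def by blast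
    then show "K = L" using assms(3) KL by blast
  qed
  have "(\<Sum>K\<in>I. w K) \<le> (\<Sum>K\<in>I. w (g K))" by (rule sum_mono) (use g in auto)
  also have "\<dots> = (\<Sum>K\<in>g ` I. w K)" using \<open>inj_on g I\<close> by (simp add: sum.reindex)
  also have "\<dots> \<le> (\<Sum>K\<in>set (pick c w H). w K)" by (rule sum_mono2) (use g in auto)
  finally show ?thesis .
qed

end

section \<open>Enumeration of lists of bounded length\<close>

primrec tuples :: "nat \<Rightarrow> 'a list \<Rightarrow> 'a list list" where
  "tuples 0 V = [[]]"
| "tuples (Suc k) V = [] # concat (map (\<lambda>v. map (\<lambda>t. v # t) (tuples k V)) V)"

lemma set_tuples: "set (tuples k V) = {t. length t \<le> k \<and> set t \<subseteq> set V}"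
proof (induction k)
  case (Suc k)
  have "t \<in> set (tuples (Suc k) V) \<longleftrightarrow> length t \<le> Suc k \<and> set t \<subseteq> set V" for t
    by (cases t) (auto simp: Suc)
  then show ?case by blast
qed auto

lemma distinct_tuples: "distinct V \<Longrightarrow> distinct (tuples k V)"
proof (induction k)
  case (Suc k)
  have "distinct (concat (map (\<lambda>v. map (\<lambda>t. v # t) (tuples k V)) U))" if "distinct U" for U :: "'a list"
    using that by (induction U) (auto simp: distinct_map Suc)
  then show ?case using Suc.prems by auto
qed simp

section \<open>Candidate solutions and their correctness\<close>

section \<open>The algorithm\<close>

declare tuples.simps(2) [simp del]

text \<open>Items that share a vertex conflict as well, so two listings of the same clique are never
  chosen together. The case \<open>K = L\<close> makes the relation reflexive also at the empty
  list.\<close>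

definition conf :: "('a \<times> 'a) list \<Rightarrow> 'a list \<Rightarrow> 'a list \<Rightarrow> bool" where
  "conf A K L \<longleftrightarrow> K = L \<or> (\<exists>x\<in>set K. \<exists>y\<in>set L. x = y \<or> (x, y) \<in> set A)"

definition attached :: "('a \<times> 'a) list \<Rightarrow> 'a \<Rightarrow> 'a list \<Rightarrow> bool" where
  "attached A w K \<longleftrightarrow> (\<exists>x\<in>set K. (w, x) \<in> set A)"

definition allowed :: "(bool \<times> bool) list list set \<Rightarrow> ('a \<times> 'a) list \<Rightarrow> 'a list \<Rightarrow> bool" where
  "allowed T A vs \<longleftrightarrow> pattern (\<lambda>u v. (u, v) \<in> set A) vs \<in> T"

definition item :: "(bool \<times> bool) list list set \<Rightarrow> ('a \<times> 'a) list \<Rightarrow> 'a list \<Rightarrow> 'a list \<Rightarrow> bool" where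
  "item T A W K \<longleftrightarrow> \<not> K = [] \<and> (\<forall>x\<in>set K. \<forall>y\<in>set K. x = y \<or> (x, y) \<in> set A) \<and>
     (\<forall>x\<in>set K. \<not> x \<in> set W) \<and>
     (\<forall>w\<in>set W. \<forall>w'\<in>set W. attached A w K \<longrightarrow> attached A w' K \<longrightarrow> w = w') \<and>
     allowed T A (K @ filter (\<lambda>w. attached A w K) W)"

definition weight :: "('a \<times> nat) list \<Rightarrow> 'a list \<Rightarrow> nat" where
  "weight ws X = sum_list (map snd (filter (\<lambda>p. fst p \<in> set X) ws))"

definition candidates :: "nat \<Rightarrow> nat \<Rightarrow> nat \<Rightarrow> (bool \<times> bool) list list set \<Rightarrow>
    ('a \<times> 'a) list \<Rightarrow> ('a \<times> nat) list \<Rightarrow> 'a list \<Rightarrow> 'a list list" where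
  "candidates s k m T A ws V = concat (map (\<lambda>W. if allowed T A W
     then map (\<lambda>H. W @ concat (pick (conf A) (weight ws) H))
       (clusters (conf A) s (filter (item T A W) (tuples m V)))
     else []) (tuples k V))"

definition heaviest :: "('a \<times> nat) list \<Rightarrow> 'a list list \<Rightarrow> 'a list" where
  "heaviest ws Xs = foldl (\<lambda>X Y. if weight ws X < weight ws Y then Y else X) [] Xs"

text \<open>A candidate may list vertices repeatedly, since \<open>W\<close> is an arbitrary tuple;
  filtering the vertex list yields an answer without repetitions.\<close>

definition best_set :: "nat \<Rightarrow> nat \<Rightarrow> nat \<Rightarrow> (bool \<times> bool) list list set \<Rightarrow>
    ('a \<times> 'a) list \<Rightarrow> ('a \<times> nat) list \<Rightarrow> 'a list \<Rightarrow> 'a list" where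
  "best_set s k m T A ws V = filter (\<lambda>u. u \<in> set (heaviest ws (candidates s k m T A ws V))) V"

lemma heaviest: "heaviest ws Xs \<in> insert [] (set Xs)"
  "X \<in> set Xs \<Longrightarrow> weight ws X \<le> weight ws (heaviest ws Xs)"
proof (induction Xs rule: rev_induct)
  case Nil
  { case 1 then show ?case by (simp add: heaviest_def) }
  { case 2 then show ?case by simp }
next
  case (snoc Y Xs)
  have eq: "heaviest ws (Xs @ [Y]) =
      (if weight ws (heaviest ws Xs) < weight ws Y then Y else heaviest ws Xs)"
    by (simp add: heaviest_def)
  { case 1 then show ?case using snoc(1) unfolding eq by auto }
  { case 2 then show ?case using snoc(2) unfolding eq by fastforce }
qed

text \<open>If the union of three cliques that form a P3 of conflicts contained no P3 of vertices,
  adjacency would be transitive there and would carry over from the first clique through the second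
  to the third. Items without conflict with the three have no vertex equal or adjacent to one of the
  union, so the construction can be repeated.\<close>

lemma has_P3s_items:
  assumes "has_P3s (conf A) s \<S>" "\<forall>x y. (x, y) \<in> set A \<longrightarrow> (y, x) \<in> set A"
    and "\<And>K. K \<in> \<S> \<Longrightarrow> K \<noteq> [] \<and> set K \<subseteq> X \<and> (\<forall>x\<in>set K. \<forall>y\<in>set K. x = y \<or> (x, y) \<in> set A)"
  shows "has_P3s (\<lambda>x y. x = y \<or> (x, y) \<in> set A) s X"
  using assms(1,3)
proof (induction s arbitrary: \<S> X)
  case (Suc s)
  let ?R = "\<lambda>x y. x = y \<or> (x, y) \<in> set A"
  obtain K1 K2 K3 where K: "K1 \<in> \<S>" "K2 \<in> \<S>" "K3 \<in> \<S>" "conf A K1 K2" "conf A K2 K3" "\<not> conf A K1 K3"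
    and P: "has_P3s (conf A) s {K \<in> \<S>. \<not> conf A K K1 \<and> \<not> conf A K K2 \<and> \<not> conf A K K3}"
    using Suc.prems(1) unfolding has_P3s.simps(2) by blast
  let ?U = "set K1 \<union> set K2 \<union> set K3"
  have cl: "?R x y" if "x \<in> set K" "y \<in> set K" "K \<in> \<S>" for x y K
    using Suc.prems(2)[OF that(3)] that by blast
  have touch: "\<exists>x\<in>set K. \<exists>y\<in>set L. ?R x y" if h: "conf A K L" "K \<in> \<S>" for K L
  proof (cases "K = L")
    case True
    have "hd K \<in> set K" using Suc.prems(2)[OF h(2)] by simp
    with True show ?thesis by blast
  qed (use h in \<open>auto simp: conf_def\<close>)
  have "\<exists>a\<in>?U. \<exists>b\<in>?U. \<exists>c\<in>?U. ?R a b \<and> ?R b c \<and> \<not> ?R a c"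
  proof (rule ccontr)
    assume "\<not> ?thesis"
    then have tr: "?R a c" if "a \<in> ?U" "b \<in> ?U" "c \<in> ?U" "?R a b" "?R b c" for a b c
      using that by blast
    obtain x1 x2 where 1: "x1 \<in> set K1" "x2 \<in> set K2" "?R x1 x2" using touch[OF K(4,1)] by blast
    obtain y2 y3 where 2: "y2 \<in> set K2" "y3 \<in> set K3" "?R y2 y3" using touch[OF K(5,2)] by blast
    have "?R x1 y2" by (rule tr[of x1 x2 y2]) (use 1 2 cl[OF _ _ K(2)] in auto)
    then have "?R x1 y3" by (intro tr[of x1 y2 y3]) (use 1 2 in auto)
    then show False using K(6) 1(1) 2(2) unfolding conf_def by blast
  qed
  then obtain a b c where abc: "a \<in> ?U" "b \<in> ?U" "c \<in> ?U" "?R a b" "?R b c" "\<not> ?R a c" by blast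
  have "has_P3s ?R s {u \<in> X. \<not> ?R u a \<and> \<not> ?R u b \<and> \<not> ?R u c}"
  proof (rule Suc.IH[OF P])
    fix K assume "K \<in> {K \<in> \<S>. \<not> conf A K K1 \<and> \<not> conf A K K2 \<and> \<not> conf A K K3}"
    then have h: "K \<in> \<S>" "\<not> conf A K K1" "\<not> conf A K K2" "\<not> conf A K K3" by auto
    have "\<not> ?R u v" if "u \<in> set K" "v \<in> ?U" for u v
      using h(2-4) that unfolding conf_def by blast
    then show "K \<noteq> [] \<and> set K \<subseteq> {u \<in> X. \<not> ?R u a \<and> \<not> ?R u b \<and> \<not> ?R u c} \<and>
        (\<forall>x\<in>set K. \<forall>y\<in>set K. ?R x y)"
      using Suc.prems(2)[OF h(1)] abc(1-3) by blast
  qed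
  moreover have "a \<in> X" "b \<in> X" "c \<in> X"
    using abc(1-3) Suc.prems(2)[OF K(1)] Suc.prems(2)[OF K(2)] Suc.prems(2)[OF K(3)] by blast+
  ultimately show ?case unfolding has_P3s.simps(2) using abc(4-6) by blast
qed simp

text \<open>A clique together with its only possible neighbour in \<open>W\<close> meets everything
  glued before in at most that neighbour, so \<open>block_graph_Un\<close> adds the cliques one by
  one.\<close>

lemma block_graph_items:
  assumes "pair_graph G" "finite I" "W \<subseteq> pverts G"
    and "\<And>K. K \<in> I \<Longrightarrow> set K \<subseteq> pverts G - W \<and> card {w \<in> W. \<exists>x\<in>set K. adj G w x} \<le> 1"
    and "\<And>K L x y. K \<in> I \<Longrightarrow> L \<in> I \<Longrightarrow> K \<noteq> L \<Longrightarrow> x \<in> set K \<Longrightarrow> y \<in> set L \<Longrightarrow> x \<noteq> y \<and> \<not> adj G x y"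
  shows "block_graph \<C> (G \<restriction> (W \<union> (\<Union>K\<in>I. set K))) \<longleftrightarrow> block_graph \<C> (G \<restriction> W) \<and>
    (\<forall>K\<in>I. block_graph \<C> (G \<restriction> (set K \<union> {w \<in> W. \<exists>x\<in>set K. adj G w x})))"
  using assms(2,4,5)
proof (induction I rule: finite_induct)
  case (insert K I)
  let ?N = "{w \<in> W. \<exists>x\<in>set K. adj G w x}"
  let ?A = "W \<union> (\<Union>K\<in>I. set K)" and ?B = "set K \<union> ?N"
  have K: "set K \<subseteq> pverts G - W" "card ?N \<le> 1" using insert.prems(1)[of K] by auto
  have dis: "x \<noteq> y \<and> \<not> adj G x y" if "L \<in> I" "x \<in> set L" "y \<in> set K" for L x y
    by (rule insert.prems(2)[of L K]) (use that insert.hyps in auto)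
  have "?A \<inter> ?B = ?N" using K dis by blast
  then have card: "card (?A \<inter> ?B) \<le> 1" using K(2) by (simp only:)
  have sub: "?A \<union> ?B \<subseteq> pverts G" using K assms(3) insert.prems(1) by blast
  have no: "\<not> adj G a b" if "a \<in> ?A - ?B" "b \<in> ?B - ?A" for a b
    using that dis by blast
  have un: "W \<union> (\<Union>K\<in>insert K I. set K) = ?A \<union> ?B" by auto
  have IH: "block_graph \<C> (G \<restriction> ?A) \<longleftrightarrow> block_graph \<C> (G \<restriction> W) \<and>
    (\<forall>K\<in>I. block_graph \<C> (G \<restriction> (set K \<union> {w \<in> W. \<exists>x\<in>set K. adj G w x})))"
  proof (rule insert.IH)
    show "set L \<subseteq> pverts G - W \<and> card {w \<in> W. \<exists>x\<in>set L. adj G w x} \<le> 1" if "L \<in> I" for L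
      by (rule insert.prems(1)) (use that in simp)
    show "x \<noteq> y \<and> \<not> adj G x y" if "L \<in> I" "M \<in> I" "L \<noteq> M" "x \<in> set L" "y \<in> set M" for L M x y
      by (rule insert.prems(2)[of L M]) (use that in simp_all)
  qed
  have "block_graph \<C> (G \<restriction> (?A \<union> ?B)) \<longleftrightarrow>
      block_graph \<C> (G \<restriction> ?A) \<and> block_graph \<C> (G \<restriction> ?B)"
    by (rule block_graph_Un[OF assms(1) sub card no])
  then show ?case
    unfolding un IH by (simp only: ball_simps conj_ac)
qed simp

text \<open>The length \<open>k + (d + 1)\<close> covers an item of at most \<open>d + 1\<close>
  vertices followed by its attachments in a guess of length at most \<open>k\<close>. The assumption
  on \<open>ws\<close> hides the representation of the weights, and the one on \<open>k\<close> is
  the conclusion of \<open>structure_theorem\<close>.\<close>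

locale block_graph_instance =
  fixes G :: "'a pair_pre_digraph" and V :: "'a list" and A :: "('a \<times> 'a) list"
    and ws :: "('a \<times> nat) list" and f :: "'a \<Rightarrow> nat"
    and \<C> :: "('c, 'd) pre_digraph set" and s k d :: nat and T :: "(bool \<times> bool) list list set"
  assumes graph: "pair_graph G"
    and V: "set V = pverts G" "distinct V" and A: "set A = parcs G"
    and ws: "\<And>X. set X \<subseteq> set V \<Longrightarrow> weight ws X = sum f (set X)"
    and T: "\<And>vs. set vs \<subseteq> pverts G \<Longrightarrow> length vs \<le> k + (d + 1) \<Longrightarrow>
      pattern (adj G) vs \<in> T \<longleftrightarrow> block_graph \<C> (G \<restriction> set vs)"
    and no_P3s: "\<not> has_P3s (\<lambda>x y. x = y \<or> adj G x y) s (pverts G)"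
    and d: "\<And>K. K \<in> \<C> \<Longrightarrow> card (verts K) \<le> d"
    and k: "\<And>X. finite X \<Longrightarrow> \<not> has_P3s (\<lambda>x y. x = y \<or> adj G x y) s X \<Longrightarrow>
      simple_graph.small_biconn (adj G) d X \<Longrightarrow>
      bounded_core (adj G) (d + 1) k X"
begin

sublocale simple_graph "adj G"
  by (rule simple_graph_adj[OF graph])

lemma adj_A: "adj G x y \<longleftrightarrow> (x, y) \<in> set A"
  by (simp add: adj_def A)

sublocale conflict "conf A"
proof
  show "conf A K K" for K by (simp add: conf_def)
  show "conf A K L \<Longrightarrow> conf A L K" for K L
    unfolding conf_def adj_A[symmetric] using adj_sym by blast
qed

lemma allowed_iff:
  "set vs \<subseteq> pverts G \<Longrightarrow> length vs \<le> k + (d + 1) \<Longrightarrow>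
    allowed T A vs \<longleftrightarrow> block_graph \<C> (G \<restriction> set vs)"
  using T[of vs] by (simp add: allowed_def adj_A[symmetric])

lemma attached_filter: "set (filter (\<lambda>w. attached A w K) W) = {w \<in> set W. \<exists>x\<in>set K. adj G w x}"
  by (auto simp: attached_def adj_A)

lemma item_iff:
  assumes "W \<in> set (tuples k V)" "K \<in> set (tuples (d + 1) V)"
  shows "item T A W K \<longleftrightarrow> K \<noteq> [] \<and> (\<forall>x\<in>set K. \<forall>y\<in>set K. x = y \<or> adj G x y) \<and>
    set K \<inter> set W = {} \<and>
    (\<forall>w\<in>set W. \<forall>w'\<in>set W. (\<exists>x\<in>set K. adj G w x) \<longrightarrow> (\<exists>x\<in>set K. adj G w' x) \<longrightarrow> w = w') \<and>
    block_graph \<C> (G \<restriction> (set K \<union> {w \<in> set W. \<exists>x\<in>set K. adj G w x}))"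
proof -
  let ?vs = "K @ filter (\<lambda>w. attached A w K) W"
  have "length (filter (\<lambda>w. attached A w K) W) \<le> length W" by (rule length_filter_le)
  moreover have "length W \<le> k" "length K \<le> d + 1" using assms by (simp_all add: set_tuples)
  ultimately have "length ?vs \<le> k + (d + 1)" unfolding length_append by linarith
  moreover have "set ?vs \<subseteq> pverts G" using assms V(1) by (auto simp: set_tuples)
  ultimately have "allowed T A ?vs \<longleftrightarrow> block_graph \<C> (G \<restriction> set ?vs)" by (rule allowed_iff[rotated])
  then have al: "allowed T A ?vs \<longleftrightarrow>
      block_graph \<C> (G \<restriction> (set K \<union> {w \<in> set W. \<exists>x\<in>set K. adj G w x}))"
    by (simp only: set_append attached_filter)
  have at: "attached A w K \<longleftrightarrow> (\<exists>x\<in>set K. adj G w x)" for w by (simp add: attached_def adj_A)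
  have dj: "(\<forall>x\<in>set K. \<not> x \<in> set W) \<longleftrightarrow> set K \<inter> set W = {}" by blast
  show ?thesis unfolding item_def al dj unfolding at adj_A[symmetric] by (rule refl)
qed

abbreviation "items W \<equiv> filter (item T A W) (tuples (d + 1) V)"

text \<open>Items without conflicts are disjoint from each other and from \<open>W\<close>, and
  non-adjacent to each other. So the blocks can be checked item by item, and the weights add
  up.\<close>

lemma items_props:
  assumes "W \<in> set (tuples k V)" "set I \<subseteq> set (items W)" "\<forall>K\<in>set I. \<forall>L\<in>set I. conf A K L \<longrightarrow> K = L"
  shows "block_graph \<C> (G \<restriction> (set W \<union> (\<Union>K\<in>set I. set K))) \<longleftrightarrow> block_graph \<C> (G \<restriction> set W)"
    and "sum f (set W \<union> (\<Union>K\<in>set I. set K)) = weight ws W + (\<Sum>K\<in>set I. weight ws K)"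
    and "set W \<union> (\<Union>K\<in>set I. set K) \<subseteq> pverts G"
proof -
  have W: "set W \<subseteq> set V" using assms(1) by (simp add: set_tuples)
  have it: "K \<noteq> []" "set K \<subseteq> set V" "set K \<inter> set W = {}"
    "\<forall>w\<in>set W. \<forall>w'\<in>set W. (\<exists>x\<in>set K. adj G w x) \<longrightarrow> (\<exists>x\<in>set K. adj G w' x) \<longrightarrow> w = w'"
    "block_graph \<C> (G \<restriction> (set K \<union> {w \<in> set W. \<exists>x\<in>set K. adj G w x}))"
    if "K \<in> set I" for K
  proof -
    have "K \<in> set (tuples (d + 1) V)" "item T A W K" using that assms(2) by auto
    with item_iff[OF assms(1)] show "K \<noteq> []" "set K \<subseteq> set V" "set K \<inter> set W = {}"
      "\<forall>w\<in>set W. \<forall>w'\<in>set W. (\<exists>x\<in>set K. adj G w x) \<longrightarrow> (\<exists>x\<in>set K. adj G w' x) \<longrightarrow> w = w'"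
      "block_graph \<C> (G \<restriction> (set K \<union> {w \<in> set W. \<exists>x\<in>set K. adj G w x}))"
      by (simp_all add: set_tuples)
  qed
  have dis: "x \<noteq> y \<and> \<not> adj G x y" if "K \<in> set I" "L \<in> set I" "K \<noteq> L" "x \<in> set K" "y \<in> set L" for K L x y
  proof -
    have "\<not> conf A K L" using assms(3) that by blast
    then show ?thesis using that unfolding conf_def adj_A by blast
  qed
  have "block_graph \<C> (G \<restriction> (set W \<union> (\<Union>K\<in>set I. set K))) \<longleftrightarrow> block_graph \<C> (G \<restriction> set W) \<and>
    (\<forall>K\<in>set I. block_graph \<C> (G \<restriction> (set K \<union> {w \<in> set W. \<exists>x\<in>set K. adj G w x})))"
  proof (rule block_graph_items[OF graph])
    fix K assume "K \<in> set I"
    note K = it[OF this]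
    have "card {w \<in> set W. \<exists>x\<in>set K. adj G w x} \<le> Suc 0"
      using K(4) by (subst card_le_Suc0_iff_eq) auto
    then show "set K \<subseteq> pverts G - set W \<and> card {w \<in> set W. \<exists>x\<in>set K. adj G w x} \<le> 1"
      using K(2,3) V(1) by auto
  qed (use W V(1) dis in auto)
  then show "block_graph \<C> (G \<restriction> (set W \<union> (\<Union>K\<in>set I. set K))) \<longleftrightarrow> block_graph \<C> (G \<restriction> set W)"
    using it(5) by blast
  have "sum f (set W \<union> (\<Union>K\<in>set I. set K)) = sum f (set W) + sum f (\<Union>K\<in>set I. set K)"
    by (rule sum.union_disjoint) (use it(3) in auto)
  also have "sum f (\<Union>K\<in>set I. set K) = (\<Sum>K\<in>set I. sum f (set K))"
  proof (rule sum.UNION_disjoint)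
    show "\<forall>K\<in>set I. \<forall>L\<in>set I. K \<noteq> L \<longrightarrow> set K \<inter> set L = {}" using dis by blast
  qed auto
  also have "\<dots> = (\<Sum>K\<in>set I. weight ws K)" by (rule sum.cong) (use ws it(2) in auto)
  finally show "sum f (set W \<union> (\<Union>K\<in>set I. set K)) = weight ws W + (\<Sum>K\<in>set I. weight ws K)"
    using ws[OF W] by simp
  show "set W \<union> (\<Union>K\<in>set I. set K) \<subseteq> pverts G" using W it(2) V(1) by blast
qed

lemma candidates_sound:
  assumes "X \<in> set (candidates s k (d + 1) T A ws V)"
  shows "set X \<subseteq> pverts G \<and> block_graph \<C> (G \<restriction> set X)"
proof -
  from assms obtain W H where W: "W \<in> set (tuples k V)" "allowed T A W"
    and H: "H \<in> set (clusters (conf A) s (items W))"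
    and X: "X = W @ concat (pick (conf A) (weight ws) H)"
    by (auto simp: candidates_def split: if_splits)
  note cl = clusters_sound[OF H]
  note P = pick_invariant[of H "weight ws"]
  have sub: "set (pick (conf A) (weight ws) H) \<subseteq> set (items W)" using P cl by blast
  have ind: "\<forall>K\<in>set (pick (conf A) (weight ws) H). \<forall>L\<in>set (pick (conf A) (weight ws) H). conf A K L \<longrightarrow> K = L"
    using P cl by blast
  have eq: "set X = set W \<union> (\<Union>K\<in>set (pick (conf A) (weight ws) H). set K)" by (simp add: X)
  have "set W \<subseteq> pverts G" "length W \<le> k + (d + 1)" using W(1) V(1) by (auto simp: set_tuples)
  then have "block_graph \<C> (G \<restriction> set W)" using allowed_iff W(2) by blast
  then show ?thesis using items_props(1,3)[OF W(1) sub ind] unfolding eq by blast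
qed

text \<open>The solution \<open>Y\<close> itself need not be a candidate. Its core is among the
  guesses and its cliques form an independent set of items, so some cluster contains them, and the
  items picked from that cluster weigh at least as much.\<close>

lemma candidates_cover:
  assumes "Y \<subseteq> pverts G" "block_graph \<C> (G \<restriction> Y)"
  shows "\<exists>X\<in>set (candidates s k (d + 1) T A ws V). sum f Y \<le> weight ws X"
proof -
  have fin: "finite Y" using assms(1) V(1) by (metis finite_set finite_subset)
  have sb: "small_biconn d Y" by (rule block_graph_small_biconn[OF graph assms d])
  have "\<not> has_P3s (\<lambda>x y. x = y \<or> adj G x y) s Y"
    using no_P3s has_P3s_mono[OF _ assms(1)] by blast
  from k[OF fin this sb, unfolded bounded_core_def] obtain W0 where W0: "W0 \<subseteq> Y" "card W0 \<le> k"
    and C': "\<forall>K\<in>comps (adj G) (Y - W0). card K \<le> d + 1 \<and>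
        (\<forall>x\<in>K. \<forall>y\<in>K. x = y \<or> adj G x y) \<and>
        (\<forall>w\<in>W0. \<forall>w'\<in>W0. (\<exists>x\<in>K. adj G w x) \<longrightarrow> (\<exists>x\<in>K. adj G w' x) \<longrightarrow> w = w')"
    by (elim exE conjE) (rule that)
  note C = bspec[OF C']
  \<comment> \<open>Listings without repetition keep the lengths within the bounds of
    \<open>tuples\<close>.\<close>
  have listing: "\<exists>l. set l = S \<and> length l = card S" if "S \<subseteq> Y" for S
    using finite_distinct_list[OF finite_subset[OF that fin]] distinct_card by metis
  obtain W where W: "set W = W0" "length W = card W0" using listing[OF W0(1)] by blast
  define \<K> where "\<K> = comps (adj G) (Y - W0)"
  have KY: "K \<subseteq> Y - W0" "K \<noteq> {}" if "K \<in> \<K>" for K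
    using that by (auto simp: \<K>_def comps_def conn_def)
  have "\<forall>K\<in>\<K>. \<exists>l. set l = K \<and> length l = card K" using listing KY by blast
  from bchoice[OF this] obtain ls where ls: "\<And>K. K \<in> \<K> \<Longrightarrow> set (ls K) = K \<and> length (ls K) = card K"
    by blast
  have "finite \<K>" unfolding \<K>_def using fin by (intro finite_comps) auto
  then obtain Is where Is: "set Is = ls ` \<K>" using finite_list by (metis finite_imageI)
  have Wt: "W \<in> set (tuples k V)" using W W0 assms(1) V(1) by (auto simp: set_tuples)
  have cov: "\<Union>\<K> = Y - W0"
  proof
    show "Y - W0 \<subseteq> \<Union>\<K>" using comps_cover[of "Y - W0"] fin unfolding \<K>_def by blast
  qed (use KY in blast)
  have eqY: "Y = set W \<union> (\<Union>K\<in>set Is. set K)"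
  proof -
    have "(\<Union>K\<in>set Is. set K) = \<Union>\<K>" unfolding Is using ls by auto
    then show ?thesis using cov W(1) W0(1) by auto
  qed
  have ad: "x \<noteq> y \<and> \<not> adj G x y" if "K \<in> \<K>" "L \<in> \<K>" "K \<noteq> L" "x \<in> K" "y \<in> L" for K L x y
  proof -
    have "K \<inter> L = {}" using comps_eq[of K "adj G" "Y - W0" L] that unfolding \<K>_def by blast
    moreover have "\<forall>a\<in>K. \<forall>b\<in>(Y - W0) - K. \<not> adj G a b" using that(1) by (simp add: \<K>_def comps_def)
    ultimately show ?thesis using that KY(1)[OF that(2)] by blast
  qed
  have ind: "\<forall>K\<in>set Is. \<forall>L\<in>set Is. conf A K L \<longrightarrow> K = L"
  proof (intro ballI impI)
    fix K' L' assume "K' \<in> set Is" "L' \<in> set Is" and c: "conf A K' L'"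
    then obtain K L where KL: "K \<in> \<K>" "L \<in> \<K>" "K' = ls K" "L' = ls L" unfolding Is by blast
    show "K' = L'"
    proof (rule ccontr)
      assume "K' \<noteq> L'"
      then have "K \<noteq> L" using KL by blast
      then show False using ad[OF KL(1,2)] c \<open>K' \<noteq> L'\<close> ls[OF KL(1)] ls[OF KL(2)]
        unfolding conf_def KL(3,4) adj_A by blast
    qed
  qed
  have bgY: "block_graph \<C> (G \<restriction> (set W \<union> (\<Union>K\<in>set Is. set K)))"
    using assms(2) unfolding eqY[symmetric] .
  have bg: "block_graph \<C> (G \<restriction> set W) \<and>
    (\<forall>K\<in>set Is. block_graph \<C> (G \<restriction> (set K \<union> {w \<in> set W. \<exists>x\<in>set K. adj G w x})))"
  proof (subst block_graph_items[OF graph, symmetric])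
    fix K' assume "K' \<in> set Is"
    then obtain K where K: "K \<in> \<K>" "set K' = K" unfolding Is using ls by blast
    have "card {w \<in> W0. \<exists>x\<in>K. adj G w x} \<le> Suc 0"
      using C[of K] K(1) finite_subset[OF W0(1) fin] unfolding \<K>_def
      by (subst card_le_Suc0_iff_eq) auto
    then show "set K' \<subseteq> pverts G - set W \<and> card {w \<in> set W. \<exists>x\<in>set K'. adj G w x} \<le> 1"
      using KY(1)[OF K(1)] assms(1) unfolding K(2) W(1) by auto
  next
    fix K' L' x y assume h: "K' \<in> set Is" "L' \<in> set Is" "K' \<noteq> L'" "x \<in> set K'" "y \<in> set L'"
    then have "\<not> conf A K' L'" using ind by blast
    then show "x \<noteq> y \<and> \<not> adj G x y" using h unfolding conf_def adj_A by blast
  next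
    show "block_graph \<C> (G \<restriction> (set W \<union> (\<Union>K\<in>set Is. set K)))" by (rule bgY)
  qed (use W(1) W0(1) assms(1) in auto)
  have "set Is \<subseteq> set (items W)"
  proof
    fix K' assume K': "K' \<in> set Is"
    then obtain K where K: "K \<in> \<K>" "K' = ls K" unfolding Is by blast
    note lK = ls[OF K(1)] and CK = C[OF K(1)[unfolded \<K>_def]]
    have t: "K' \<in> set (tuples (d + 1) V)"
      using lK CK KY(1)[OF K(1)] assms(1) V(1) K(2) by (auto simp: set_tuples)
    have "item T A W K'"
      unfolding item_iff[OF Wt t]
    proof (intro conjI)
      show "K' \<noteq> []" using lK KY(2)[OF K(1)] K(2) by auto
      show "set K' \<inter> set W = {}" using lK KY(1)[OF K(1)] K(2) W(1) by auto
      show "\<forall>x\<in>set K'. \<forall>y\<in>set K'. x = y \<or> adj G x y" using lK CK K(2) by simp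
      show "\<forall>w\<in>set W. \<forall>w'\<in>set W. (\<exists>x\<in>set K'. adj G w x) \<longrightarrow> (\<exists>x\<in>set K'. adj G w' x) \<longrightarrow> w = w'"
        using lK CK K(2) W(1) by simp
      show "block_graph \<C> (G \<restriction> (set K' \<union> {w \<in> set W. \<exists>x\<in>set K'. adj G w x}))"
        using bg K' by blast
    qed
    with t show "K' \<in> set (items W)" by simp
  qed
  note sub = this
  \<comment> \<open>The conflict graph inherits the absence of \<open>s\<close> separate copies of
    P3 from \<open>G\<close>, which is what \<open>clusters_cover\<close> asks for.\<close>
  have "\<not> has_P3s (conf A) s (set (items W))"
  proof
    assume h: "has_P3s (conf A) s (set (items W))"
    have "has_P3s (\<lambda>x y. x = y \<or> (x, y) \<in> set A) s (pverts G)"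
    proof (rule has_P3s_items[OF h])
      show "\<forall>x y. (x, y) \<in> set A \<longrightarrow> (y, x) \<in> set A" using adj_sym unfolding adj_A by blast
      fix K assume "K \<in> set (items W)"
      then have "K \<in> set (tuples (d + 1) V)" "item T A W K" by auto
      then show "K \<noteq> [] \<and> set K \<subseteq> pverts G \<and> (\<forall>x\<in>set K. \<forall>y\<in>set K. x = y \<or> (x, y) \<in> set A)"
        using item_iff[OF Wt] V(1) by (simp add: set_tuples adj_A)
    qed
    then show False using no_P3s by (simp add: adj_A)
  qed
  moreover have "distinct (items W)" using distinct_tuples[OF V(2)] by simp
  ultimately obtain H where H: "H \<in> set (clusters (conf A) s (items W))" "set Is \<subseteq> set H"
    using clusters_cover[of "items W" s "set Is"] sub ind by blast
  define P where "P = pick (conf A) (weight ws) H"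
  note cl = clusters_sound[OF H(1)]
  have P: "set P \<subseteq> set (items W)" "\<forall>K\<in>set P. \<forall>L\<in>set P. conf A K L \<longrightarrow> K = L"
    using pick_invariant[of H "weight ws"] cl unfolding P_def by blast+
  have "allowed T A W"
    using bg allowed_iff[of W] Wt V(1) by (simp add: set_tuples)
  then have cand: "W @ concat P \<in> set (candidates s k (d + 1) T A ws V)"
    using Wt H(1) unfolding candidates_def P_def by auto
  have "sum f Y = weight ws W + (\<Sum>K\<in>set Is. weight ws K)"
    using items_props(2)[OF Wt sub ind] eqY by simp
  also have "\<dots> \<le> weight ws W + (\<Sum>K\<in>set P. weight ws K)"
    using pick_optimal[of H "set Is" "weight ws"] cl H(2) ind unfolding P_def by simp
  also have "\<dots> = sum f (set (W @ concat P))" using items_props(2)[OF Wt P] by simp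
  also have "\<dots> = weight ws (W @ concat P)"
    using ws[of "W @ concat P"] items_props(3)[OF Wt P] V(1) by simp
  finally show ?thesis using cand by blast
qed

theorem best_set_correct:
  defines "X \<equiv> set (best_set s k (d + 1) T A ws V)"
  shows "X \<subseteq> pverts G" "block_graph \<C> (G \<restriction> X)"
    and "\<And>Y. Y \<subseteq> pverts G \<Longrightarrow> block_graph \<C> (G \<restriction> Y) \<Longrightarrow> sum f Y \<le> sum f X"
proof -
  let ?C = "candidates s k (d + 1) T A ws V"
  let ?H = "heaviest ws ?C"
  \<comment> \<open>\<open>heaviest\<close> starts from the empty list, which is feasible because
    the empty set has no blocks.\<close>
  have "block_graph \<C> (G \<restriction> {})"
    unfolding block_graph_iff[OF graph empty_subsetI] max_biconn_def biconn_def by auto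
  then have H: "set ?H \<subseteq> pverts G \<and> block_graph \<C> (G \<restriction> set ?H)"
    using heaviest(1)[of ws ?C] candidates_sound by auto
  then have X: "X = set ?H" using V(1) by (auto simp: X_def best_set_def)
  show "X \<subseteq> pverts G" "block_graph \<C> (G \<restriction> X)" using H X by auto
  fix Y assume "Y \<subseteq> pverts G" "block_graph \<C> (G \<restriction> Y)"
  then obtain Z where "Z \<in> set ?C" "sum f Y \<le> weight ws Z" using candidates_cover by blast
  then have "sum f Y \<le> weight ws ?H" using heaviest(2) le_trans by blast
  also have "\<dots> = sum f X" unfolding X by (rule ws) (use H V(1) in auto)
  finally show "sum f Y \<le> sum f X" .
qed

end

section \<open>Running time for fixed parameters\<close>

section \<open>The algorithm runs in polynomial time\<close>

lemma ptime_app3: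
  assumes "ptime (\<lambda>p. f (fst p) (fst (snd p)) (snd (snd p)))" "ptime a" "ptime b" "ptime c"
  shows "ptime (\<lambda>x. f (a x) (b x) (c x))"
  using ptime_comp[OF ptime_Pair[OF assms(2) ptime_Pair[OF assms(3,4)]] assms(1)] by simp

lemma enc_size_filter: "enc_size (filter P xs) \<le> enc_size xs"
  by (induction xs) auto

text \<open>The set is a constant of the program, and membership is a fixed disjunction of
  comparisons. This is how the table of patterns is consulted without computing any block.\<close>

lemma ptime_in_finite:
  assumes "finite T" "ptime f"
  shows "ptime (\<lambda>x. f x \<in> T)"
  using assms(1)
proof (induction T rule: finite_induct)
  case (insert a T)
  have "ptime (\<lambda>x. f x = a \<or> f x \<in> T)" by (intro ptime_intros assms(2) insert.IH)
  then show ?case by simp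
qed (simp add: ptime_const)

lemma ptime_conf: "ptime (\<lambda>p. conf (fst p :: ('a::encodable \<times> 'a) list) (fst (snd p)) (snd (snd p)))"
  unfolding conf_def by (intro ptime_intros)

lemma ptime_attached: "ptime (\<lambda>p. attached (fst p :: ('a::encodable \<times> 'a) list) (fst (snd p)) (snd (snd p)))"
  unfolding attached_def by (intro ptime_intros)

lemma ptime_allowed:
  assumes "finite T"
  shows "ptime (\<lambda>p. allowed T (fst p :: ('a::encodable \<times> 'a) list) (snd p))"
  unfolding allowed_def pattern_def by (intro ptime_in_finite[OF assms] ptime_intros)

lemma ptime_item:
  assumes "finite T"
  shows "ptime (\<lambda>p. item T (fst p :: ('a::encodable \<times> 'a) list) (fst (snd p)) (snd (snd p)))"
  unfolding item_def
  by (intro ptime_intros ptime_app3[OF ptime_attached] ptime_app2[OF ptime_allowed[OF assms]])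

lemma ptime_weight: "ptime (\<lambda>p. weight (fst p :: ('a::encodable \<times> nat) list) (snd p))"
  unfolding weight_def
  by (intro ptime_sum_list ptime_map[where f = "\<lambda>_. snd"] ptime_intros)

lemma ptime_cluster: "ptime (\<lambda>p. cluster (conf (fst p :: ('a::encodable \<times> 'a) list)) (snd p))"
  unfolding cluster_def by (intro ptime_intros ptime_app3[OF ptime_conf])

lemma ptime_before: "ptime (\<lambda>p. before (fst p :: 'a::encodable) (snd p))"
  unfolding before_def by (intro ptime_intros)

lemma ptime_after: "ptime (\<lambda>p. after (fst p :: 'a::encodable) (snd p))"
  unfolding after_def by (intro ptime_intros ptime_app2[OF ptime_before])

lemma ptime_greedy: "ptime (\<lambda>p. greedy (conf (fst p :: ('a::encodable \<times> 'a) list)) (fst (snd p)) (snd (snd p)))"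
  unfolding greedy_def
proof (rule ptime_foldl_add[where k = 1])
  show "enc_size (if cluster (conf (fst p)) (v # H) then v # H else H) \<le> enc_size H + (enc_size p + enc_size v + 2) ^ 1"
    for p :: "('a \<times> 'a) list \<times> 'a list list \<times> 'a list list" and v H
    by simp
qed (intro ptime_intros ptime_app2[OF ptime_cluster])+

text \<open>The depth \<open>l\<close> is a constant, so the recursion is unrolled into the program;
  each level contributes three nested loops over the list.\<close>

lemma ptime_clusters: "ptime (\<lambda>p. clusters (conf (fst p :: ('a::encodable \<times> 'a) list)) l (snd p))"
proof (induction l)
  case (Suc l)
  show ?case
    unfolding clusters.simps(2)
    by (intro ptime_intros ptime_app3[OF ptime_greedy] ptime_app2[OF ptime_cluster] ptime_app2[OF ptime_before]
        ptime_app2[OF ptime_after] ptime_app2[OF Suc.IH] ptime_app3[OF ptime_conf])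
qed (simp add: ptime_const)

lemma ptime_pick: "ptime (\<lambda>p. pick (conf (fst p :: ('a::encodable \<times> 'a) list)) (weight (fst (snd p))) (snd (snd p)))"
  unfolding pick_def
proof (rule ptime_foldl_add[where k = 1])
  show "enc_size (if \<exists>K'\<in>set P. conf (fst p) K K' \<and> \<not> weight (fst (snd p)) K' < weight (fst (snd p)) K then P
      else K # filter (\<lambda>K'. \<not> conf (fst p) K K') P) \<le> enc_size P + (enc_size p + enc_size K + 2) ^ 1"
    for p :: "('a \<times> 'a) list \<times> ('a \<times> nat) list \<times> 'a list list" and K P
    using enc_size_filter[of "\<lambda>K'. \<not> conf (fst p) K K'" P] by simp
qed (intro ptime_intros ptime_app3[OF ptime_conf] ptime_app2[OF ptime_weight])+

lemma ptime_tuples: "ptime (\<lambda>V :: 'a::encodable list. tuples k V)"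
proof (induction k)
  case (Suc k)
  show ?case
    unfolding tuples.simps(2)
    by (intro ptime_intros ptime_comp[OF _ Suc.IH])
qed (simp add: ptime_const)

lemma ptime_candidates:
  assumes "finite T"
  shows "ptime (\<lambda>p. candidates s k m T (fst p :: ('a::encodable \<times> 'a) list) (fst (snd p)) (snd (snd p)))"
  unfolding candidates_def
  by (intro ptime_intros ptime_app2[OF ptime_allowed[OF assms]] ptime_app3[OF ptime_pick] ptime_app2[OF ptime_clusters]
      ptime_app3[OF ptime_item[OF assms]] ptime_comp[OF _ ptime_tuples])

lemma ptime_heaviest: "ptime (\<lambda>p. heaviest (fst p :: ('a::encodable \<times> nat) list) (snd p))"
  unfolding heaviest_def
proof (rule ptime_foldl_add[where k = 1])
  show "enc_size (if weight (fst p) X < weight (fst p) Y then Y else X) \<le> enc_size X + (enc_size p + enc_size Y + 2) ^ 1"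
    for p :: "('a \<times> nat) list \<times> 'a list list" and X Y :: "'a list"
    by simp
qed (intro ptime_intros ptime_app2[OF ptime_weight])+

lemma ptime_best_set:
  assumes "finite T"
  shows "ptime (\<lambda>p. best_set s k m T (fst p :: ('a::encodable \<times> 'a) list) (fst (snd p)) (snd (snd p)))"
  unfolding best_set_def
  by (intro ptime_intros ptime_app2[OF ptime_heaviest] ptime_app3[OF ptime_candidates[OF assms]])

section \<open>Reading graphs and weights from the input tree\<close>

section \<open>Decoding the input\<close>

type_synonym raw_graph = "((nat \<times> nat) \<times> bool list) list"

definition vertices :: "raw_graph \<Rightarrow> nat list" where
  "vertices L = map (\<lambda>p. fst p) (List.enumerate 0 L)"

definition arc_list :: "raw_graph \<Rightarrow> (nat \<times> nat) list" where
  "arc_list L = concat (map (\<lambda>p. concat (map (\<lambda>q. if snd q then [(fst p, fst q)] else [])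
     (List.enumerate 0 (snd (snd p))))) (List.enumerate 0 L))"

text \<open>The rational weights are brought to the common denominator given by the product of all denominators.\<close>

definition weight_list :: "raw_graph \<Rightarrow> (nat \<times> nat) list" where
  "weight_list L = map (\<lambda>p. (fst p, fst (fst (snd p)) * prod_list (map (\<lambda>q.
     if fst q = fst p then 1 else snd (fst (snd q))) (List.enumerate 0 L)))) (List.enumerate 0 L)"

lemma ptime_vertices: "ptime vertices" and ptime_arc_list: "ptime arc_list" and ptime_weight_list: "ptime weight_list"
  unfolding vertices_def arc_list_def weight_list_def by (intro ptime_intros)+

lemma enumerate_map_upt: "List.enumerate 0 (map g [0..<n]) = map (\<lambda>i. (i, g i)) [0..<n]"
  by (rule nth_equalityI) (auto simp: nth_enumerate_eq)

text \<open>This value has the same encoding as the input (\<open>enc_raw\<close>), so decoding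
  costs no time. Applying \<open>nat\<close> to numerators and denominators loses nothing for
  positive weights.\<close>

definition raw :: "nat pair_pre_digraph \<Rightarrow> (nat \<Rightarrow> rat) \<Rightarrow> raw_graph" where
  "raw G w = map (\<lambda>u. (map_prod nat nat (quotient_of (w u)),
     map (\<lambda>v. (u, v) \<in> parcs G) [0..<card (pverts G)])) [0..<card (pverts G)]"

lemma enc_raw: "enc (raw G w) = enc_weighted_graph (G, w)"
  by (simp add: raw_def enc_weighted_graph_def enc_of_list enc_of_prod enc_rat_def enc_of_bool
      enc_of_nat Let_def split_beta comp_def)

lemma vertices_raw: "vertices (raw G w) = [0..<card (pverts G)]"
  by (simp add: vertices_def raw_def enumerate_map_upt comp_def)

lemma arc_list_raw:
  "set (arc_list (raw G w)) = {(u, v) \<in> parcs G. u < card (pverts G) \<and> v < card (pverts G)}"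
  by (auto simp: arc_list_def raw_def enumerate_map_upt comp_def split: if_splits)

definition scaled :: "nat pair_pre_digraph \<Rightarrow> (nat \<Rightarrow> rat) \<Rightarrow> nat \<Rightarrow> nat" where
  "scaled G w u = nat (fst (quotient_of (w u))) *
     (\<Prod>v\<in>{..<card (pverts G)} - {u}. nat (snd (quotient_of (w v))))"

lemma weight_list_raw:
  "weight_list (raw G w) = map (\<lambda>u. (u, scaled G w u)) [0..<card (pverts G)]"
proof -
  let ?n = "card (pverts G)"
  have "prod_list (map (\<lambda>v. if v = u then 1 else nat (snd (quotient_of (w v)))) [0..<?n]) =
      (\<Prod>v\<in>{..<?n} - {u}. nat (snd (quotient_of (w v))))" for u
  proof -
    have "prod_list (map (\<lambda>v. if v = u then 1 else nat (snd (quotient_of (w v)))) [0..<?n]) =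
        (\<Prod>v\<in>{..<?n}. if v = u then 1 else nat (snd (quotient_of (w v))))"
      by (subst prod.distinct_set_conv_list[symmetric]) (auto simp: atLeast0LessThan)
    also have "\<dots> = (\<Prod>v\<in>{..<?n} - {u}. nat (snd (quotient_of (w v))))"
      by (rule prod.mono_neutral_cong_right) auto
    finally show ?thesis .
  qed
  then show ?thesis
    by (simp add: weight_list_def raw_def enumerate_map_upt scaled_def comp_def map_prod_def split_beta
        cong: if_cong)
qed

lemma weight_raw:
  assumes "set X \<subseteq> {..<card (pverts G)}"
  shows "weight (weight_list (raw G w)) X = sum (scaled G w) (set X)"
proof -
  have "weight (weight_list (raw G w)) X = sum_list (map (scaled G w) (filter (\<lambda>u. u \<in> set X) [0..<card (pverts G)]))"
    by (simp add: weight_def weight_list_raw filter_map comp_def)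
  also have "\<dots> = sum (scaled G w) (set (filter (\<lambda>u. u \<in> set X) [0..<card (pverts G)]))"
    by (rule sum_list_distinct_conv_sum_set) simp
  also have "set (filter (\<lambda>u. u \<in> set X) [0..<card (pverts G)]) = set X" using assms by auto
  finally show ?thesis .
qed

text \<open>With \<open>w u = a / b\<close>, multiplying by all denominators cancels
  \<open>b\<close> and leaves \<open>a\<close> times the others. All weights are scaled by the same
  positive factor, so comparisons of sums do not change.\<close>

lemma scaled_eq:
  assumes "u < card (pverts G)" "\<And>v. v < card (pverts G) \<Longrightarrow> 0 < w v"
  shows "of_nat (scaled G w u) = w u * (\<Prod>v<card (pverts G). of_int (snd (quotient_of (w v))))"
proof -
  let ?n = "card (pverts G)"
  obtain a b where ab: "quotient_of (w u) = (a, b)" by (cases "quotient_of (w u)")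
  have b: "b > 0" using quotient_of_denom_pos[OF ab] .
  have wu: "w u = of_int a / of_int b" using quotient_of_div[OF ab] .
  have "0 < w u" using assms by blast
  then have a: "a > 0" using b unfolding wu by (simp add: zero_less_divide_iff)
  have pos: "snd (quotient_of (w v)) > 0" for v using quotient_of_denom_pos' by blast
  have "(\<Prod>v<?n. of_int (snd (quotient_of (w v)))) =
      (of_int b :: rat) * (\<Prod>v\<in>{..<?n} - {u}. of_int (snd (quotient_of (w v))))"
    using assms(1) ab by (subst prod.remove[of _ u]) auto
  moreover have "of_nat (scaled G w u) = (of_int a :: rat) * (\<Prod>v\<in>{..<?n} - {u}. of_int (snd (quotient_of (w v))))"
    using a pos by (simp add: scaled_def ab of_nat_prod of_nat_nat less_imp_le)
  ultimately show ?thesis using b by (simp add: wu)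
qed

text \<open>A pattern is a table with at most \<open>N\<close> rows and columns over the four pairs
  of truth values, whatever the relation, so there are finitely many.\<close>

lemma finite_patterns: "finite {pattern E vs | E vs. length vs \<le> N}"
proof -
  let ?R = "{xs :: (bool \<times> bool) list. set xs \<subseteq> UNIV \<and> length xs \<le> N}"
  have "finite ?R" by (rule finite_lists_length_le) simp
  then have "finite {xss. set xss \<subseteq> ?R \<and> length xss \<le> N}" by (rule finite_lists_length_le)
  moreover have "{pattern E vs | E vs. length vs \<le> N} \<subseteq> {xss. set xss \<subseteq> ?R \<and> length xss \<le> N}"
    by (auto simp: pattern_def)
  ultimately show ?thesis by (rule finite_subset[rotated])
qed

theorem theorem1:
  fixes s :: nat and \<C> :: "('c, 'd) pre_digraph set"
  assumes "s \<ge> 1"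
    and "finite \<C>"
    and "\<forall>H\<in>\<C>. biconnected H"
  shows "max_block_graph_poly_time_on
           (\<lambda>G. free_of (with_proj (disjoint_copies s (path_graph 3))) (with_proj G)) \<C>"
proof -
  \<comment> \<open>The element 0 is for an empty class, where \<open>Max\<close> would otherwise be
    applied to the empty set.\<close>
  define d where "d = Max (insert 0 ((\<lambda>K. card (verts K)) ` \<C>))"
  have d: "card (verts K) \<le> d" if "K \<in> \<C>" for K
    unfolding d_def using assms(2) that by (intro Max_ge) auto
  obtain k where k: "\<And>(E :: nat \<Rightarrow> nat \<Rightarrow> bool) X. simple_graph E \<Longrightarrow> finite X \<Longrightarrow>
    \<not> has_P3s (\<lambda>x y. x = y \<or> E x y) s X \<Longrightarrow> simple_graph.small_biconn E d X \<Longrightarrow>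
    bounded_core E (d + 1) k X"
    by (rule structure_theorem[of s d, where 'a = nat]) blast
  \<comment> \<open>The table collects the good patterns of short vertex lists from all finite
    graphs on natural numbers. By \<open>block_graph_pattern\<close> an entry that stems from one
    graph is valid for every other, so one table serves all inputs.\<close>
  define T where "T = {pattern (adj G) vs | (G :: nat pair_pre_digraph) vs. pair_graph G \<and>
    set vs \<subseteq> pverts G \<and> length vs \<le> k + (d + 1) \<and> block_graph \<C> (G \<restriction> set vs)}"
  have "finite T"
    by (rule finite_subset[OF _ finite_patterns[where 'a = nat and N = "k + (d + 1)"]]) (auto simp: T_def)
  define alg where "alg L = best_set s k (d + 1) T (arc_list L) (weight_list L) (vertices L)" for L
  have "ptime alg"
    unfolding alg_def
    by (rule ptime_app3[OF ptime_best_set[OF \<open>finite T\<close>] ptime_arc_list ptime_weight_list ptime_vertices])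
  then obtain c N j where c: "runs c N j alg" unfolding ptime_def by blast
  have correct: "optimal \<C> (G, w) (set (alg (raw G w)))" "distinct (alg (raw G w))"
    if Gw: "(G, w) \<in> weighted_graphs"
      and free: "free_of (with_proj (disjoint_copies s (path_graph 3))) (with_proj G)" for G w
  proof -
    obtain n where G: "pair_graph G" "pverts G = {..<n}" and w: "\<And>v. v < n \<Longrightarrow> 0 < w v"
      using Gw by (auto simp: weighted_graphs_def)
    interpret pair_graph G by (rule G(1))
    have arcs: "set (arc_list (raw G w)) = parcs G"
      using G(2) wellformed' by (auto simp: arc_list_raw)
    interpret block_graph_instance G "[0..<n]" "arc_list (raw G w)" "weight_list (raw G w)"
      "scaled G w" \<C> s k d T
    proof
      show "pattern (adj G) vs \<in> T \<longleftrightarrow> block_graph \<C> (G \<restriction> set vs)"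
        if "set vs \<subseteq> pverts G" "length vs \<le> k + (d + 1)" for vs
      proof
        assume "pattern (adj G) vs \<in> T"
        then obtain H :: "nat pair_pre_digraph" and us
          where "pattern (adj G) vs = pattern (adj H) us" "pair_graph H"
          "set us \<subseteq> pverts H" "block_graph \<C> (H \<restriction> set us)" by (auto simp: T_def)
        then show "block_graph \<C> (G \<restriction> set vs)"
          using block_graph_pattern[OF G(1) that(1)] by blast
      qed (use that G(1) in \<open>auto simp: T_def\<close>)
      show "\<not> has_P3s (\<lambda>x y. x = y \<or> adj G x y) s (pverts G)"
        by (rule free_of_P3s[OF G(1) free])
    qed (use G arcs weight_raw d k[OF simple_graph_adj[OF G(1)]] in \<open>auto simp: atLeast0LessThan\<close>)
    have alg: "alg (raw G w) = best_set s k (d + 1) T (arc_list (raw G w)) (weight_list (raw G w)) [0..<n]"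
      by (simp add: alg_def vertices_raw G(2))
    \<comment> \<open>The common factor between the integral weights of the algorithm and the
      rational weights of the input.\<close>
    define D where "D = (\<Prod>v<n. of_int (snd (quotient_of (w v))) :: rat)"
    have D: "D > 0" unfolding D_def by (rule prod_pos) (simp add: quotient_of_denom_pos')
    have sum: "of_nat (sum (scaled G w) X) = sum w X * D" if "X \<subseteq> pverts G" for X
      unfolding of_nat_sum sum_distrib_right D_def
      by (rule sum.cong) (use that G(2) scaled_eq[of _ G w] w in auto)
    note cor = best_set_correct[folded alg]
    show "optimal \<C> (G, w) (set (alg (raw G w)))"
      unfolding optimal_def feasible_def prod.case
    proof (intro conjI allI impI; (elim conjE)?)
      fix Y assume Y: "Y \<subseteq> pverts G" "block_graph \<C> (G \<restriction> Y)"
      have "of_nat (sum (scaled G w) Y) \<le> (of_nat (sum (scaled G w) (set (alg (raw G w)))) :: rat)"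
        unfolding of_nat_le_iff by (rule cor(3)[OF Y])
      then have "sum w Y * D \<le> sum w (set (alg (raw G w))) * D"
        unfolding sum[OF Y(1)] sum[OF cor(1)] .
      then show "sum w Y \<le> sum w (set (alg (raw G w)))" using D by simp
    qed (use cor(1,2) in auto)
    show "distinct (alg (raw G w))" unfolding alg best_set_def by simp
  qed
  have enc_vs: "enc vs = enc_vertices vs" for vs :: "nat list"
    by (simp add: enc_of_list enc_vertices_def enc_of_nat cong: map_cong)
  \<comment> \<open>\<open>[:2, 1:]\<close> is the polynomial with value \<open>x + 2\<close>, so
    its power is the time bound of \<open>runs\<close> in the required form.\<close>
  have poly: "poly ([:2, 1:] ^ j) x = (x + 2) ^ j" for x :: nat by (simp add: poly_power add.commute)
  show ?thesis
    unfolding max_block_graph_poly_time_on_def poly_time_solvable_def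
  proof (intro exI[of _ c] exI[of _ "[:2, 1:] ^ j"] ballI)
    fix x assume x: "x \<in> {(G, w) \<in> weighted_graphs.
      free_of (with_proj (disjoint_copies s (path_graph 3))) (with_proj G)}"
    obtain G w where Gw: "x = (G, w)" by (cases x)
    let ?\<sigma> = "(\<lambda>_. Leaf)(0 := enc_weighted_graph x)"
    have "?\<sigma> 0 = enc (raw G w)" by (simp add: enc_raw Gw)
    then obtain t \<tau> where t: "exec c ?\<sigma> t \<tau>" "\<tau> 0 = enc (alg (raw G w))" "t \<le> (enc_size (raw G w) + 2) ^ j"
      by (rule runsE[OF c]) blast
    moreover have "optimal \<C> x (set (alg (raw G w)))" "distinct (alg (raw G w))"
      using correct[of G w] x Gw by auto
    ultimately show "\<exists>t \<tau>. exec c ?\<sigma> t \<tau> \<and> t \<le> poly ([:2, 1:] ^ j) (size (enc_weighted_graph x)) \<and>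
        (\<exists>vs. \<tau> 0 = enc_vertices vs \<and> distinct vs \<and> optimal \<C> x (set vs))"
      unfolding poly enc_vs Gw enc_raw by blast
  qed
qed

end
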